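(* Let $d>2$ and let $G$ be the disjointness graph of a finite set of segments in $\mathbb{R}^d$ all of which lie in the union of $k$ two-dimensional planes. Then $$\chi(G)\le(k-1)\omega(G)+(\omega(G))^4.$$ Moreover, given the segments representing the vertices of $G$ and $k$ planes containing them, there is a polynomial time algorithm that finds a complete subgraph $K\subseteq G$ and a proper coloring of $G$ with at most $(k-1)|V(K)|+|V(K)|^4$ colors.
   Context: The disjointness graph of a family of segments is the graph whose vertices are the segments, two adjacent iff they are disjoint. $\chi$ and $\omega$ denote chromatic number and clique number. *)

theory Defs
  imports
    "HOL-Analysis.Analysis"
    "HOL-Library.Ramsey"
    "HOL-Computational_Algebra.Polynomial"
begin

text \<open>
  A finite simple graph is given by its vertex set \<open>V\<close> and its set \<open>E\<close> of two-element edges, the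
  convention of \<^const>\<open>clique\<close> in \<open>HOL-Library.Ramsey\<close>.
\<close>

definition proper_coloring :: "'v set \<Rightarrow> 'v set set \<Rightarrow> ('v \<Rightarrow> nat) \<Rightarrow> bool" where
  "proper_coloring V E f \<longleftrightarrow> (\<forall>v\<in>V. \<forall>w\<in>V. {v, w} \<in> E \<longrightarrow> f v \<noteq> f w)"

definition chromatic_number :: "'v set \<Rightarrow> 'v set set \<Rightarrow> nat" where
  "chromatic_number V E = (LEAST c. \<exists>f. proper_coloring V E f \<and> f ` V \<subseteq> {..<c})"

definition clique_number :: "'v set \<Rightarrow> 'v set set \<Rightarrow> nat" where
  "clique_number V E = Max (card ` {K. K \<subseteq> V \<and> clique K E})"

definition is_segment :: "'a::euclidean_space set \<Rightarrow> bool" where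
  "is_segment s \<longleftrightarrow> (\<exists>a b. a \<noteq> b \<and> s = closed_segment a b)"

definition is_plane :: "'a::euclidean_space set \<Rightarrow> bool" where
  "is_plane A \<longleftrightarrow> affine A \<and> aff_dim A = 2"

definition disjointness_edges :: "'a set set \<Rightarrow> 'a set set set" where
  "disjointness_edges S = {{s, t} |s t. s \<in> S \<and> t \<in> S \<and> s \<noteq> t \<and> s \<inter> t = {}}"

text \<open>
  Algorithms on inputs with real coordinates are programs of a real RAM. The memory consists of
  infinitely many cells holding natural numbers, used for addresses, counters and discrete data,
  and infinitely many cells holding real numbers. Cells are addressed indirectly by natural numbers;
  \<open>NCell e\<close> and \<open>RCell e\<close> denote the contents of the cell whose address is the value of \<open>e\<close>.
  The only literals are integers, so no uncomputable real constant can be built into a program, and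
  information flows from reals to naturals only through comparisons (there is no rounding).
  Subtraction of naturals is truncated, and division of a real by \<open>0\<close> yields \<open>0\<close>.
\<close>

type_synonym memory = "(nat \<Rightarrow> nat) \<times> (nat \<Rightarrow> real)"

datatype nexp = NLit nat | NCell nexp | NAdd nexp nexp | NSub nexp nexp

datatype rexp = RLit int | RCell nexp | RAdd rexp rexp | RSub rexp rexp | RMul rexp rexp | RDiv rexp rexp

datatype bexp = NLess nexp nexp | RLess rexp rexp | BNot bexp | BAnd bexp bexp

datatype com =
    Skip
  | NStore nexp nexp
  | RStore nexp rexp
  | Seq com com
  | Cond bexp com com
  | While bexp com

primrec nval :: "nexp \<Rightarrow> memory \<Rightarrow> nat" where
  "nval (NLit c) m = c"
| "nval (NCell e) m = fst m (nval e m)"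
| "nval (NAdd e e') m = nval e m + nval e' m"
| "nval (NSub e e') m = nval e m - nval e' m"

primrec rval :: "rexp \<Rightarrow> memory \<Rightarrow> real" where
  "rval (RLit c) m = of_int c"
| "rval (RCell e) m = snd m (nval e m)"
| "rval (RAdd e e') m = rval e m + rval e' m"
| "rval (RSub e e') m = rval e m - rval e' m"
| "rval (RMul e e') m = rval e m * rval e' m"
| "rval (RDiv e e') m = rval e m / rval e' m"

primrec bval :: "bexp \<Rightarrow> memory \<Rightarrow> bool" where
  "bval (NLess e e') m \<longleftrightarrow> nval e m < nval e' m"
| "bval (RLess e e') m \<longleftrightarrow> rval e m < rval e' m"
| "bval (BNot b) m \<longleftrightarrow> \<not> bval b m"
| "bval (BAnd b b') m \<longleftrightarrow> bval b m \<and> bval b' m"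

text \<open>
  \<open>runs c m t m'\<close>: started in memory \<open>m\<close>, the program \<open>c\<close> terminates after \<open>t\<close> steps in memory \<open>m'\<close>.
  Every executed store, skip and test counts as one step. Expressions have no loops, so for a fixed
  program this is the number of elementary operations up to a constant factor.
\<close>

inductive runs :: "com \<Rightarrow> memory \<Rightarrow> nat \<Rightarrow> memory \<Rightarrow> bool" where
  Skip: "runs Skip m 1 m"
| NStore: "runs (NStore a e) m 1 ((fst m)(nval a m := nval e m), snd m)"
| RStore: "runs (RStore a e) m 1 (fst m, (snd m)(nval a m := rval e m))"
| Seq: "runs c m t m' \<Longrightarrow> runs c' m' t' m'' \<Longrightarrow> runs (Seq c c') m (t + t') m''"
| CondTrue: "bval b m \<Longrightarrow> runs c m t m' \<Longrightarrow> runs (Cond b c c') m (Suc t) m'"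
| CondFalse: "\<not> bval b m \<Longrightarrow> runs c' m t m' \<Longrightarrow> runs (Cond b c c') m (Suc t) m'"
| WhileFalse: "\<not> bval b m \<Longrightarrow> runs (While b c) m 1 m"
| WhileTrue: "bval b m \<Longrightarrow> runs c m t m' \<Longrightarrow> runs (While b c) m' t' m'' \<Longrightarrow>
    runs (While b c) m (Suc (t + t')) m''"

inductive_cases runs_SkipE: "runs Skip m t m'"
inductive_cases runs_NStoreE: "runs (NStore a e) m t m'"
inductive_cases runs_RStoreE: "runs (RStore a e) m t m'"
inductive_cases runs_SeqE: "runs (Seq c c') m t m'"
inductive_cases runs_CondE: "runs (Cond b c c') m t m'"
inductive_cases runs_WhileE: "runs (While b c) m t m'"

lemma runs_deterministic:
  "runs c m t m' \<Longrightarrow> runs c m u m'' \<Longrightarrow> u = t \<and> m'' = m'"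
proof (induction arbitrary: u m'' rule: runs.induct)
  case (Seq c m t m' c' t' n')
  from Seq.prems show ?case by (rule runs_SeqE) (use Seq.IH in blast)
next
  case (CondTrue b m c t m' c')
  from CondTrue.prems show ?case by (rule runs_CondE) (use CondTrue in blast)+
next
  case (CondFalse b m c' t m' c)
  from CondFalse.prems show ?case by (rule runs_CondE) (use CondFalse in blast)+
next
  case (WhileTrue b m c t m' t' n')
  from WhileTrue.prems show ?case by (rule runs_WhileE) (use WhileTrue in blast)+
qed (auto elim: runs_SkipE runs_NStoreE runs_RStoreE runs_WhileE)

text \<open>
  A segment is given by its two endpoints, a plane by three affinely independent points. Points are
  given by their coordinates; \<^term>\<open>from_nat_into (UNIV :: 'n::finite set)\<close> enumerates the
  index type bijectively by the natural numbers below \<^term>\<open>CARD('n::finite)\<close>.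
\<close>

definition segment_of :: "(real^'n) \<times> (real^'n) \<Rightarrow> (real^'n) set" where
  "segment_of = (\<lambda>(a, b). closed_segment a b)"

definition plane_of :: "(real^'n) \<times> (real^'n) \<times> (real^'n) \<Rightarrow> (real^'n) set" where
  "plane_of = (\<lambda>(p, q, r). affine hull {p, q, r})"

definition coords :: "real^'n \<Rightarrow> real list" where
  "coords x = map (\<lambda>i. x $ from_nat_into UNIV i) [0..<CARD('n)]"

definition input_reals ::
  "((real^'n) \<times> (real^'n)) list \<Rightarrow> ((real^'n) \<times> (real^'n) \<times> (real^'n)) list \<Rightarrow> real list" where
  "input_reals ss ps =
     concat (map (\<lambda>(a, b). coords a @ coords b) ss) @
     concat (map (\<lambda>(p, q, r). coords p @ coords q @ coords r) ps)"

text \<open>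
  Initially, natural-number cells \<open>0\<close> and \<open>1\<close> hold the numbers of segments and of planes, the real
  cells from \<open>0\<close> on hold the coordinates, and all other cells hold \<open>0\<close>.
\<close>

definition load :: "'a::zero list \<Rightarrow> nat \<Rightarrow> 'a" where
  "load xs i = (if i < length xs then xs ! i else 0)"

definition input_memory ::
  "((real^'n) \<times> (real^'n)) list \<Rightarrow> ((real^'n) \<times> (real^'n) \<times> (real^'n)) list \<Rightarrow> memory" where
  "input_memory ss ps = (load [length ss, length ps], load (input_reals ss ps))"

definition valid_input ::
  "((real^'n) \<times> (real^'n)) list \<Rightarrow> ((real^'n) \<times> (real^'n) \<times> (real^'n)) list \<Rightarrow> bool" where
  "valid_input ss ps \<longleftrightarrow>
     (\<forall>(a, b)\<in>set ss. a \<noteq> b) \<and> distinct (map segment_of ss) \<and>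
     (\<forall>p\<in>set ps. is_plane (plane_of p)) \<and> distinct (map plane_of ps) \<and> length ps \<ge> 1 \<and>
     (\<forall>s\<in>set ss. segment_of s \<subseteq> (\<Union>p\<in>set ps. plane_of p))"

text \<open>
  With \<open>n\<close> the number of segments, the final natural-number cells \<open>0, \<dots>, n - 1\<close> hold the colors
  of the segments in input order, and cell \<open>n + i\<close> is nonzero iff the \<open>i\<close>-th segment is selected.
\<close>

definition output_vertices :: "((real^'n) \<times> (real^'n)) list \<Rightarrow> memory \<Rightarrow> (real^'n) set set" where
  "output_vertices ss m = {segment_of (ss ! i) |i. i < length ss \<and> fst m (length ss + i) \<noteq> 0}"

definition output_coloring ::
  "((real^'n) \<times> (real^'n)) list \<Rightarrow> memory \<Rightarrow> ((real^'n) set \<Rightarrow> nat) \<Rightarrow> bool" where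
  "output_coloring ss m f \<longleftrightarrow> (\<forall>i<length ss. f (segment_of (ss ! i)) = fst m i)"

end

theory Submission
  imports Defs
begin

text \<open>
  Put each segment into the class of the last plane that contains it, and treat the classes in
  order, building a set \<open>Z\<close> of pairwise disjoint segments. In a class, call a segment hit if it meets
  some \<open>t \<in> Z\<close> from an earlier class. Such a \<open>t\<close> is not contained in the plane of the class, so it
  pierces the plane in one point; hence all segments of the class hit by \<open>t\<close> share that point and may
  receive the same color. This takes at most \<open>k - 1\<close> colors for each \<open>t\<close>.

  Disjoint segments of one plane are comparable in one of four partial orders, and comparable segments
  are disjoint. The unhit segments of a class are colored by their four heights, and a longest of the
  chains, with \<open>m\<close> elements, is added to \<open>Z\<close>; this takes at most \<open>m ^ 4\<close> colors, and
  the sum of the \<open>m ^ 4\<close> over all classes is at most \<open>card Z ^ 4\<close>.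

  All geometric predicates have quantifier-free descriptions in the coordinates and become tests of the
  program. The bound on the chromatic number follows from the correctness of the program.
\<close>

section \<open>Four partial orders on plane segments\<close>

text \<open>Putting a segment into its last plane makes piercing automatic: a segment contained in
  the plane of a later class would itself have that class or a later one. Drawing chains from unhit
  segments keeps \<open>Z\<close> a clique of the disjointness graph. Class \<open>0\<close> has no
  hit segments, whence \<open>k - 1\<close> and not \<open>k\<close>. The exponent counts the
  orders. For disjoint segments of a plane, left ends, right ends and vertical positions are
  compared in some coordinates: three binary choices, one of which is absorbed by exchanging the
  segments. Vertical position alone is not transitive; the conditions on projections repair this.
  The bound refers to the clique that is found, so no maximum clique has to be computed; being
  monotone in the clique size, it implies the inequality with \<omega>. Since the programs have
  neither roots nor rounding, a plane gets oblique coordinates from inner products with two spanning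
  vectors, and conditions on all points of a segment are reduced to its endpoints.\<close>

definition below :: "('a \<Rightarrow> real) \<Rightarrow> ('a \<Rightarrow> real) \<Rightarrow> 'a set \<Rightarrow> 'a set \<Rightarrow> bool" where
  "below \<xi> \<eta> A B \<longleftrightarrow> (\<forall>x\<in>A. \<forall>y\<in>B. \<xi> x = \<xi> y \<longrightarrow> \<eta> x < \<eta> y)"

definition starts_before :: "('a \<Rightarrow> real) \<Rightarrow> 'a set \<Rightarrow> 'a set \<Rightarrow> bool" where
  "starts_before \<xi> A B \<longleftrightarrow> (\<forall>y\<in>B. \<exists>x\<in>A. \<xi> x \<le> \<xi> y)"

definition ends_before :: "('a \<Rightarrow> real) \<Rightarrow> 'a set \<Rightarrow> 'a set \<Rightarrow> bool" where
  "ends_before \<xi> A B \<longleftrightarrow> (\<forall>x\<in>A. \<exists>y\<in>B. \<xi> x \<le> \<xi> y)"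

text \<open>
  The four partial orders of Larman, Matousek, Pach and Torocsik, indexed by \<open>q < 4\<close>; the bits of
  \<open>q\<close> choose between shifted and nested projections, and between below and above.
\<close>

definition seg_order :: "('a \<Rightarrow> real) \<Rightarrow> ('a \<Rightarrow> real) \<Rightarrow> nat \<Rightarrow> 'a set \<Rightarrow> 'a set \<Rightarrow> bool" where
  "seg_order \<xi> \<eta> q A B \<longleftrightarrow> starts_before \<xi> A B \<and>
     (if q < 2 then ends_before \<xi> A B else ends_before \<xi> B A) \<and>
     (if even q then below \<xi> \<eta> A B else below \<xi> \<eta> B A)"

text \<open>If \<open>A\<close> passed above \<open>B\<close> on one vertical line and below it on
  another, convexity would give an intermediate vertical line on which both have points of equal
  \<eta>-value, contradicting the separation.\<close>

lemma below_or_above: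
  fixes A B :: "'a::real_vector set"
  assumes "convex A" "convex B" and lin: "linear \<xi>" "linear \<eta>"
    and sep: "\<And>x y. x \<in> A \<Longrightarrow> y \<in> B \<Longrightarrow> \<xi> x = \<xi> y \<Longrightarrow> \<eta> x \<noteq> \<eta> y"
  shows "below \<xi> \<eta> A B \<or> below \<xi> \<eta> B A"
proof (rule ccontr)
  assume "\<not> ?thesis"
  then obtain x y x' y' where
    xy: "x \<in> A" "y \<in> B" "\<xi> x = \<xi> y" "\<eta> y \<le> \<eta> x" and
    xy': "x' \<in> A" "y' \<in> B" "\<xi> x' = \<xi> y'" "\<eta> x' \<le> \<eta> y'"
    unfolding below_def by (metis not_less)
  define \<alpha> \<beta> where "\<alpha> = \<eta> x - \<eta> y" and "\<beta> = \<eta> y' - \<eta> x'"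
  have pos: "\<alpha> > 0" "\<beta> > 0"
    using sep[OF xy(1-3)] sep[OF xy'(1-3)] xy(4) xy'(4) by (auto simp: \<alpha>_def \<beta>_def)
  \<comment> \<open>The weight is chosen such that the gaps \<alpha> and \<beta>, which have
    opposite orientation, cancel in the convex combination.\<close>
  define w where "w = \<beta> / (\<alpha> + \<beta>)"
  have w: "0 \<le> w" "w \<le> 1" "w * \<alpha> = (1 - w) * \<beta>"
    using pos by (auto simp: w_def field_simps)
  define X Y where "X = w *\<^sub>R x + (1 - w) *\<^sub>R x'" and "Y = w *\<^sub>R y + (1 - w) *\<^sub>R y'"
  have "X \<in> A" "Y \<in> B"
    unfolding X_def Y_def using xy xy' w assms(1,2) by (auto intro!: convexD)
  moreover have "\<xi> X = \<xi> Y"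
    by (simp add: X_def Y_def linear_add[OF lin(1)] linear_scale[OF lin(1)] xy(3) xy'(3))
  moreover have "\<eta> X - \<eta> Y = w * \<alpha> - (1 - w) * \<beta>"
    unfolding X_def Y_def linear_add[OF lin(2)] linear_scale[OF lin(2)] \<alpha>_def \<beta>_def
    by (simp add: algebra_simps)
  ultimately show False using sep w(3) by force
qed

section \<open>Reduction of the orders to endpoints\<close>

lemma finite_real_sets_separated:
  fixes L U :: "real set"
  assumes "finite L" "finite U" "\<And>l u. l \<in> L \<Longrightarrow> u \<in> U \<Longrightarrow> l < u"
  obtains \<mu> where "\<And>l. l \<in> L \<Longrightarrow> l < \<mu>" "\<And>u. u \<in> U \<Longrightarrow> \<mu> < u"
proof (cases "L = {} \<or> U = {}")
  case True
  then show ?thesis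
  proof
    assume "L = {}"
    \<comment> \<open>\<open>Min\<close> says nothing about an empty set, so an arbitrary number is
      taken if both sets are empty.\<close>
    with that[of "(if U = {} then 0 else Min U) - 1"] show ?thesis
      using Min_le[OF assms(2)] by fastforce
  next
    assume "U = {}"
    with that[of "(if L = {} then 0 else Max L) + 1"] show ?thesis
      using Max_ge[OF assms(1)] by fastforce
  qed
next
  case False
  then have "Max L < Min U" using assms by simp
  then obtain \<mu> where "Max L < \<mu>" "\<mu> < Min U" using dense by blast
  with that[of \<mu>] show ?thesis
    using Max_ge[OF assms(1)] Min_le[OF assms(2)] by fastforce
qed

text \<open>In the coordinates (\<xi>, \<eta>), the relation says that no difference of a point of
  the second hull and a point of the first lies on the vertical axis at or below the origin. These
  differences form the convex hull of the finitely many differences of generators, and a planar hull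
  meets that half-line iff a generator does or a segment joining a generator on the left to one on
  the right. Clearing denominators gives the product inequality.\<close>

lemma below_convex_hull_iff:
  fixes A B :: "'a::real_vector set"
  assumes fin: "finite A" "finite B" and lin: "linear \<xi>" "linear \<eta>"
  shows "below \<xi> \<eta> (convex hull A) (convex hull B) \<longleftrightarrow>
    below \<xi> \<eta> A B \<and>
    (\<forall>p\<in>A. \<forall>q\<in>B. \<forall>p'\<in>A. \<forall>q'\<in>B. \<xi> q < \<xi> p \<longrightarrow> \<xi> p' < \<xi> q' \<longrightarrow>
      (\<eta> q' - \<eta> p') * (\<xi> q - \<xi> p) < (\<eta> q - \<eta> p) * (\<xi> q' - \<xi> p'))"
    (is "?l \<longleftrightarrow> ?r1 \<and> ?r2")
proof (intro iffI conjI)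
  assume l: ?l
  then show ?r1 unfolding below_def by (meson hull_inc)
  show ?r2
  proof (intro ballI impI)
    fix p q p' q' assume h: "p \<in> A" "q \<in> B" "p' \<in> A" "q' \<in> B" "\<xi> q < \<xi> p" "\<xi> p' < \<xi> q'"
    define s t where "s = \<xi> p - \<xi> q" and "t = \<xi> q' - \<xi> p'"
    have st: "s > 0" "t > 0" using h by (auto simp: s_def t_def)
    \<comment> \<open>Weights that put the combination of a left and a right difference on the
      vertical axis.\<close>
    define w where "w = t / (s + t)"
    have w: "0 \<le> w" "w \<le> 1" "w * s = (1 - w) * t" "1 - w = s / (s + t)"
      using st by (auto simp: w_def field_simps)
    let ?X = "w *\<^sub>R p + (1 - w) *\<^sub>R p'" and ?Y = "w *\<^sub>R q + (1 - w) *\<^sub>R q'"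
    have X: "?X \<in> convex hull A" "?Y \<in> convex hull B"
      using w(1,2) by (intro convexD[OF convex_convex_hull] hull_inc h; simp)+
    have "\<xi> ?Y - \<xi> ?X = (1 - w) * t - w * s"
      unfolding linear_add[OF lin(1)] linear_scale[OF lin(1)] s_def t_def by (simp add: algebra_simps)
    then have "\<xi> ?X = \<xi> ?Y" using w(3) by simp
    then have "\<eta> ?X < \<eta> ?Y" using l X unfolding below_def by blast
    then have "0 < w * (\<eta> q - \<eta> p) + (1 - w) * (\<eta> q' - \<eta> p')"
      unfolding linear_add[OF lin(2)] linear_scale[OF lin(2)] by (simp add: algebra_simps)
    also have "\<dots> = (t * (\<eta> q - \<eta> p) + s * (\<eta> q' - \<eta> p')) / (s + t)"
      using w(4) by (simp add: w_def add_divide_distrib)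
    finally have "0 < t * (\<eta> q - \<eta> p) + s * (\<eta> q' - \<eta> p')"
      using st by (simp add: zero_less_divide_iff)
    then show "(\<eta> q' - \<eta> p') * (\<xi> q - \<xi> p) < (\<eta> q - \<eta> p) * (\<xi> q' - \<xi> p')"
      by (simp add: s_def t_def algebra_simps)
  qed
next
  assume r: "?r1 \<and> ?r2"
  define D where "D = (\<lambda>(p, q). (\<xi> q - \<xi> p, \<eta> q - \<eta> p)) ` (A \<times> B)"
  have finD: "finite D" unfolding D_def using fin by blast
  \<comment> \<open>A line of slope \<mu> through the origin passes below a left difference iff
    \<mu> exceeds the slope of that difference, and below a right one iff \<mu> is smaller; so
    \<open>L\<close> collects the lower and \<open>U\<close> the upper bounds on \<mu>.\<close>
  define L U where "L = (\<lambda>(x, y). y / x) ` {z \<in> D. fst z < 0}"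
    and "U = (\<lambda>(x, y). y / x) ` {z \<in> D. 0 < fst z}"
  have "l < u" if lu: "l \<in> L" "u \<in> U" for l u
  proof -
    obtain x y x' y' where h: "(x, y) \<in> D" "x < 0" "l = y / x" "(x', y') \<in> D" "0 < x'" "u = y' / x'"
      using lu unfolding L_def U_def by auto
    have "y' * x < y * x'"
      using r h(1,2,4,5) unfolding D_def by auto
    then show ?thesis unfolding h(3,6)
      using h(2,5) by (simp add: neg_divide_less_eq pos_less_divide_eq)
  qed
  moreover have "finite L" "finite U" unfolding L_def U_def using finD by auto
  ultimately obtain \<mu> where \<mu>: "\<And>l. l \<in> L \<Longrightarrow> l < \<mu>" "\<And>u. u \<in> U \<Longrightarrow> \<mu> < u"
    using finite_real_sets_separated by metis
  \<comment> \<open>The line of slope \<open>\<mu>\<close> through the origin separates the differences from the lower vertical half-line.\<close>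
  have D: "\<mu> * x < y" if "(x, y) \<in> D" for x y
  proof -
    consider "x < 0" | "x = 0" | "0 < x" by linarith
    then show ?thesis
    proof cases
      case 1
      then have "y / x < \<mu>" using that \<mu>(1) unfolding L_def by force
      with 1 show ?thesis by (simp add: divide_simps)
    next
      case 2
      with that r show ?thesis by (auto simp: D_def below_def)
    next
      case 3
      then have "\<mu> < y / x" using that \<mu>(2) unfolding U_def by force
      with 3 show ?thesis by (simp add: divide_simps)
    qed
  qed
  define \<phi> where "\<phi> x = \<eta> x - \<mu> * \<xi> x" for x
  have lin\<phi>: "linear \<phi>" unfolding \<phi>_def
    using lin by (auto intro!: linearI simp: linear_add linear_scale algebra_simps)
  have cvx: "convex {x. \<phi> x < c}" "convex {x. c < \<phi> x}" for c
    using convex_linear_vimage[OF lin\<phi>, of "{..<c}"] convex_linear_vimage[OF lin\<phi>, of "{c<..}"]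
    by (simp_all add: vimage_def)
  have 1: "\<phi> p < \<phi> q" if "p \<in> A" "q \<in> B" for p q
  proof -
    have "(\<xi> q - \<xi> p, \<eta> q - \<eta> p) \<in> D" using that unfolding D_def by force
    from D[OF this] show ?thesis by (simp add: \<phi>_def algebra_simps)
  qed
  \<comment> \<open>Open half-spaces are convex, so the strict inequality passes to the hulls, one
    side at a time.\<close>
  have 2: "\<phi> p < \<phi> q" if "p \<in> convex hull A" "q \<in> B" for p q
    using hull_minimal[of A "{x. \<phi> x < \<phi> q}" convex] 1 that cvx by blast
  have 3: "\<phi> p < \<phi> q" if "p \<in> convex hull A" "q \<in> convex hull B" for p q
    using hull_minimal[of B "{x. \<phi> p < \<phi> x}" convex] 2 that cvx by blast
  show ?l unfolding below_def using 3 by (fastforce simp: \<phi>_def)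
qed

text \<open>A linear functional attains its minimum over a segment at an endpoint.\<close>

lemma starts_before_closed_segment:
  fixes a b c d :: "'a::real_vector"
  assumes "linear \<xi>"
  shows "starts_before \<xi> (closed_segment a b) (closed_segment c d) \<longleftrightarrow> starts_before \<xi> {a, b} {c, d}"
proof
  have min: "\<exists>y\<in>{a, b}. \<xi> y \<le> \<xi> x" if x: "x \<in> closed_segment a b" for x a b
  proof (rule ccontr)
    assume "\<not> ?thesis"
    then have "{a, b} \<subseteq> {y. \<xi> x < \<xi> y}" by auto
    moreover have "convex {y. \<xi> x < \<xi> y}"
      using convex_linear_vimage[OF assms, of "{\<xi> x<..}"] by (simp add: vimage_def)
    ultimately have "x \<in> {y. \<xi> x < \<xi> y}"
      using hull_minimal[of "{a, b}"] x unfolding segment_convex_hull by blast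
    then show False by simp
  qed
  show "starts_before \<xi> {a, b} {c, d}" if h: "starts_before \<xi> (closed_segment a b) (closed_segment c d)"
    unfolding starts_before_def
  proof
    fix y assume "y \<in> {c, d}"
    then have "y \<in> closed_segment c d" by auto
    then obtain x where "x \<in> closed_segment a b" "\<xi> x \<le> \<xi> y" using h unfolding starts_before_def by blast
    with min[of x a b] show "\<exists>x\<in>{a, b}. \<xi> x \<le> \<xi> y" by (meson order_trans)
  qed
  show "starts_before \<xi> (closed_segment a b) (closed_segment c d)" if h: "starts_before \<xi> {a, b} {c, d}"
    unfolding starts_before_def
  proof
    fix y assume "y \<in> closed_segment c d"
    then obtain y' where y': "y' \<in> {c, d}" "\<xi> y' \<le> \<xi> y" using min by blast
    then obtain x where "x \<in> {a, b}" "\<xi> x \<le> \<xi> y'" using h unfolding starts_before_def by blast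
    moreover from this(1) have "x \<in> closed_segment a b" by auto
    ultimately show "\<exists>x\<in>closed_segment a b. \<xi> x \<le> \<xi> y" using y'(2) by (meson order_trans)
  qed
qed

text \<open>Reflection exchanges left and right ends, so facts about left ends carry over.\<close>

lemma ends_before_uminus: "ends_before \<xi> A B = starts_before (\<lambda>x. - \<xi> x) B A"
  unfolding starts_before_def ends_before_def by auto

lemma ends_before_closed_segment:
  fixes a b c d :: "'a::real_vector"
  assumes "linear \<xi>"
  shows "ends_before \<xi> (closed_segment a b) (closed_segment c d) \<longleftrightarrow> ends_before \<xi> {a, b} {c, d}"
  unfolding ends_before_uminus
  by (rule starts_before_closed_segment) (use assms in \<open>rule linear_compose_neg\<close>)

text \<open>\<open>below\<close> alone is not transitive, because a vertical line may meet
  \<open>A\<close> and \<open>C\<close> but miss \<open>B\<close>. The projection conditions exclude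
  this: in the shifted and in the nested case alike, a vertical line meeting \<open>A\<close> and
  \<open>C\<close> has points of \<open>B\<close> weakly on either side, hence meets
  \<open>B\<close> by convexity.\<close>

lemma seg_order_trans:
  fixes A B C :: "'a::real_vector set"
  assumes "convex B" "linear \<xi>" "seg_order \<xi> \<eta> q A B" "seg_order \<xi> \<eta> q B C"
  shows "seg_order \<xi> \<eta> q A C"
proof -
  have conn: "\<exists>y\<in>B. \<xi> y = t" if h: "y1 \<in> B" "y2 \<in> B" "\<xi> y1 \<le> t" "t \<le> \<xi> y2" for y1 y2 t
  proof -
    have "convex (\<xi> ` B)" using assms by (simp add: convex_linear_image)
    then have "is_interval (\<xi> ` B)" by (simp add: is_interval_convex_1)
    then have "t \<in> \<xi> ` B" using h mem_is_interval_1_I[of "\<xi> ` B" "\<xi> y1" "\<xi> y2" t] by auto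
    then show ?thesis by blast
  qed
  have s: "starts_before \<xi> A C"
    using assms(3,4) unfolding seg_order_def starts_before_def by (meson order_trans)
  have e: "if q < 2 then ends_before \<xi> A C else ends_before \<xi> C A"
    using assms(3,4) unfolding seg_order_def ends_before_def by (auto split: if_splits) (meson order_trans)+
  have mid: "\<exists>y\<in>B. \<xi> y = \<xi> x" if "x \<in> A" "z \<in> C" "\<xi> x = \<xi> z" for x z
  proof -
    have "starts_before \<xi> B C" "ends_before \<xi> A B \<or> ends_before \<xi> C B"
      using assms(3,4) unfolding seg_order_def by (auto split: if_splits)
    then have "\<exists>y\<in>B. \<xi> y \<le> \<xi> x" "\<exists>y\<in>B. \<xi> x \<le> \<xi> y"
      using that unfolding starts_before_def ends_before_def by metis+
    then show ?thesis using conn by blast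
  qed
  have "if even q then below \<xi> \<eta> A C else below \<xi> \<eta> C A"
  proof -
    have "below \<xi> \<eta> A C" if "below \<xi> \<eta> A B" "below \<xi> \<eta> B C"
      using that mid unfolding below_def by (metis order.strict_trans)
    moreover have "below \<xi> \<eta> C A" if "below \<xi> \<eta> B A" "below \<xi> \<eta> C B"
      using that mid unfolding below_def by (metis order.strict_trans)
    ultimately show ?thesis using assms(3,4) unfolding seg_order_def by presburger
  qed
  with s e show ?thesis unfolding seg_order_def by blast
qed

lemma seg_order_disjoint: "seg_order \<xi> \<eta> q A B \<Longrightarrow> A \<inter> B = {}"
  unfolding seg_order_def below_def by (auto split: if_splits)

text \<open>Left ends, right ends and, by disjointness, vertical positions are each comparable.
  Exchanging \<open>A\<close> and \<open>B\<close> fixes the direction for the left ends; the other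
  two directions are the bits of \<open>q\<close>. Injectivity of (\<xi>, \<eta>) turns disjointness
  into different \<eta>-values on every common vertical line.\<close>

lemma seg_order_comparable:
  fixes A B :: "'a::real_vector set"
  assumes A: "A = closed_segment a b" and B: "B = closed_segment c d"
    and lin: "linear \<xi>" "linear \<eta>"
    and inj: "\<And>x y. x \<in> A \<Longrightarrow> y \<in> B \<Longrightarrow> \<xi> x = \<xi> y \<Longrightarrow> \<eta> x = \<eta> y \<Longrightarrow> x = y"
    and "A \<inter> B = {}"
  obtains q where "q < 4" "seg_order \<xi> \<eta> q A B \<or> seg_order \<xi> \<eta> q B A"
proof -
  have s: "starts_before \<xi> A B \<or> starts_before \<xi> B A"
    unfolding A B starts_before_closed_segment[OF lin(1)] by (auto simp: starts_before_def)
  have e: "ends_before \<xi> A B \<or> ends_before \<xi> B A"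
    unfolding A B ends_before_closed_segment[OF lin(1)] by (auto simp: ends_before_def)
  have b: "below \<xi> \<eta> A B \<or> below \<xi> \<eta> B A"
    by (rule below_or_above) (use assms in auto)
  have *: "\<exists>q<4. seg_order \<xi> \<eta> q A B"
    if "starts_before \<xi> A B" "ends_before \<xi> A B \<or> ends_before \<xi> B A" "below \<xi> \<eta> A B \<or> below \<xi> \<eta> B A" for A B
  proof -
    have "seg_order \<xi> \<eta> 0 A B \<or> seg_order \<xi> \<eta> 1 A B \<or> seg_order \<xi> \<eta> 2 A B \<or> seg_order \<xi> \<eta> 3 A B"
      using that by (auto simp: seg_order_def)
    moreover have "(0::nat) < 4" "(1::nat) < 4" "(2::nat) < 4" "(3::nat) < 4" by simp_all
    ultimately show ?thesis by blast
  qed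
  show ?thesis using that s e b *[of A B] *[of B A] by blast
qed

section \<open>Segments and planes\<close>

text \<open>\<open>s\<close> is the parameter of the orthogonal projection of \<open>x\<close> to
  the line. Computing it removes the existential quantifier from membership.\<close>

lemma mem_closed_segment_iff:
  fixes a b x :: "'a::real_inner"
  assumes "a \<noteq> b"
  defines "s \<equiv> ((x - a) \<bullet> (b - a)) / ((b - a) \<bullet> (b - a))"
  shows "x \<in> closed_segment a b \<longleftrightarrow> 0 \<le> s \<and> s \<le> 1 \<and> x = a + s *\<^sub>R (b - a)"
proof
  assume "x \<in> closed_segment a b"
  then obtain t where t: "0 \<le> t" "t \<le> 1" "x = a + t *\<^sub>R (b - a)"
    by (auto simp: in_segment algebra_simps)
  then have "s = t" using assms(1) by (simp add: s_def)
  with t show "0 \<le> s \<and> s \<le> 1 \<and> x = a + s *\<^sub>R (b - a)" by simp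
next
  assume "0 \<le> s \<and> s \<le> 1 \<and> x = a + s *\<^sub>R (b - a)"
  then show "x \<in> closed_segment a b" by (auto simp: in_segment algebra_simps intro!: exI[of _ s])
qed

text \<open>Equality case of Cauchy-Schwarz: the component of \<open>v\<close> orthogonal to
  \<open>u\<close> has squared length equal to the Gram determinant divided by
  \<open>u \<bullet> u\<close>.\<close>

lemma gram_zero_imp_parallel:
  fixes u v :: "'a::real_inner"
  assumes "u \<noteq> 0" "(u \<bullet> u) * (v \<bullet> v) - (u \<bullet> v) * (u \<bullet> v) = 0"
  shows "v = ((u \<bullet> v) / (u \<bullet> u)) *\<^sub>R u"
proof -
  define c where "c = (u \<bullet> v) / (u \<bullet> u)"
  have c: "c * (u \<bullet> u) = u \<bullet> v" using assms(1) by (simp add: c_def)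
  have "(u \<bullet> u) * ((v - c *\<^sub>R u) \<bullet> (v - c *\<^sub>R u)) = 
      (u \<bullet> u) * (v \<bullet> v) - 2 * (c * (u \<bullet> u)) * (u \<bullet> v) + (c * (u \<bullet> u)) * (c * (u \<bullet> u))"
    by (simp add: inner_diff_left inner_diff_right inner_commute algebra_simps)
  also have "\<dots> = 0" using assms(2) unfolding c by (simp add: algebra_simps)
  finally have "(v - c *\<^sub>R u) \<bullet> (v - c *\<^sub>R u) = 0" using assms(1) by simp
  then show ?thesis by (simp add: c_def)
qed

text \<open>Inner products with \<open>p\<close> and \<open>q\<close> turn the equation into a 2 by
  2 system with the Gram matrix. Denominators stay cleared, so the identities also hold for parallel
  vectors.\<close>

lemma cramer_inner:
  fixes p q w :: "'a::real_inner"
  assumes "w = s *\<^sub>R p + t *\<^sub>R q"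
  shows "(w \<bullet> p) * (q \<bullet> q) - (w \<bullet> q) * (p \<bullet> q) = s * ((p \<bullet> p) * (q \<bullet> q) - (p \<bullet> q) * (p \<bullet> q))"
    and "(w \<bullet> q) * (p \<bullet> p) - (w \<bullet> p) * (p \<bullet> q) = t * ((p \<bullet> p) * (q \<bullet> q) - (p \<bullet> q) * (p \<bullet> q))"
  unfolding assms by (simp_all add: inner_add_left inner_commute[of q p] algebra_simps)

text \<open>
  Cramer's rule for \<open>s *\<^sub>R p - t *\<^sub>R q = w\<close>. For parallel \<open>p\<close> and \<open>q\<close> both values are \<open>0\<close>.
\<close>

definition meeting_params :: "'a::real_inner \<Rightarrow> 'a \<Rightarrow> 'a \<Rightarrow> real \<times> real" where
  "meeting_params p q w =
     (((w \<bullet> p) * (q \<bullet> q) - (w \<bullet> q) * (p \<bullet> q)) / ((p \<bullet> p) * (q \<bullet> q) - (p \<bullet> q) * (p \<bullet> q)),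
      ((w \<bullet> p) * (p \<bullet> q) - (w \<bullet> q) * (p \<bullet> p)) / ((p \<bullet> p) * (q \<bullet> q) - (p \<bullet> q) * (p \<bullet> q)))"

text \<open>In the coordinate on the line in which \<open>a\<close> is \<open>0\<close> and
  \<open>b\<close> is \<open>1\<close>, the other segment is the interval between \<gamma> and
  \<gamma> + \<mu>. If it meets the unit interval and contains neither \<open>0\<close> nor
  \<open>1\<close>, it lies inside, and so does the coordinate \<gamma> of \<open>c\<close>.\<close>

lemma parallel_segments_meet:
  fixes a b c d :: "'a::real_vector"
  assumes "a \<noteq> b" "d - c = \<mu> *\<^sub>R (b - a)" "x \<in> closed_segment a b" "x \<in> closed_segment c d"
  shows "a \<in> closed_segment c d \<or> b \<in> closed_segment c d \<or> c \<in> closed_segment a b"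
proof -
  obtain s where s: "0 \<le> s" "s \<le> 1" "x = a + s *\<^sub>R (b - a)"
    using assms(3) by (auto simp: in_segment algebra_simps)
  obtain t where t: "0 \<le> t" "t \<le> 1" "x = c + t *\<^sub>R (d - c)"
    using assms(4) by (auto simp: in_segment algebra_simps)
  define \<gamma> where "\<gamma> = s - t * \<mu>"
  have line: "a + y *\<^sub>R (b - a) \<in> closed_segment (a + y1 *\<^sub>R (b - a)) (a + y2 *\<^sub>R (b - a))"
    if "y \<in> closed_segment y1 y2" for y y1 y2
  proof -
    have "\<exists>w. 0 \<le> w \<and> w \<le> 1 \<and> y = (1 - w) *\<^sub>R y1 + w *\<^sub>R y2"
      using that[unfolded in_segment] by blast
    then obtain w where w: "0 \<le> w" "w \<le> 1" "y = (1 - w) * y1 + w * y2"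
      unfolding real_scaleR_def by blast
    have "a + y *\<^sub>R D = (1 - w) *\<^sub>R (a + y1 *\<^sub>R D) + w *\<^sub>R (a + y2 *\<^sub>R D)" for D
      unfolding w(3) by (simp add: algebra_simps)
    with w(1,2) show ?thesis unfolding in_segment by blast
  qed
  have c: "c = a + \<gamma> *\<^sub>R (b - a)"
  proof -
    have "c + (t * \<mu>) *\<^sub>R (b - a) = a + s *\<^sub>R (b - a)" using s(3) t(3) unfolding assms(2) by simp
    then have "c = a + s *\<^sub>R (b - a) - (t * \<mu>) *\<^sub>R (b - a)" by (metis add_diff_cancel)
    then show ?thesis unfolding \<gamma>_def by (simp add: algebra_simps)
  qed
  have d: "d = a + (\<gamma> + \<mu>) *\<^sub>R (b - a)"
  proof -
    have "d = c + \<mu> *\<^sub>R (b - a)" using assms(2) by (metis add.commute diff_add_cancel)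
    then show ?thesis unfolding c by (simp add: scaleR_add_left)
  qed
  have "0 \<in> closed_segment \<gamma> (\<gamma> + \<mu>) \<or> 1 \<in> closed_segment \<gamma> (\<gamma> + \<mu>) \<or> \<gamma> \<in> closed_segment 0 1"
  proof -
    \<comment> \<open>Together these say that \<open>t * \<mu>\<close> lies between \<open>0\<close>
      and \<mu>, for either sign of \<mu>.\<close>
    have "t * \<mu> \<le> \<mu> \<or> \<mu> \<le> 0" "t * \<mu> \<ge> \<mu> \<or> \<mu> \<ge> 0" "t * \<mu> \<ge> 0 \<or> \<mu> \<le> 0" "t * \<mu> \<le> 0 \<or> \<mu> \<ge> 0"
      using t(1,2) by (auto simp: mult_left_le_one_le mult_le_cancel_right1 mult_le_0_iff zero_le_mult_iff mult_le_cancel_right2)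
    then show ?thesis using s unfolding \<gamma>_def by (auto simp: closed_segment_eq_real_ivl)
  qed
  then show ?thesis
    using line[of 0 \<gamma> "\<gamma> + \<mu>"] line[of 1 \<gamma> "\<gamma> + \<mu>"] line[of \<gamma> 0 1] unfolding c d by auto
qed

text \<open>For directions that are not parallel, the parameters of a common point are unique and
  given by Cramer's rule; parallel ones are covered by the endpoint clauses. The last equation
  verifies the computed point, so the value produced by a division by zero cannot yield a false
  intersection.\<close>

lemma closed_segments_meet_iff:
  fixes a b c d :: "'a::real_inner"
  assumes "a \<noteq> b" "c \<noteq> d"
  defines "m \<equiv> meeting_params (b - a) (d - c) (c - a)"
  shows "closed_segment a b \<inter> closed_segment c d \<noteq> {} \<longleftrightarrow>
    a \<in> closed_segment c d \<or> b \<in> closed_segment c d \<or> c \<in> closed_segment a b \<or>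
    0 \<le> fst m \<and> fst m \<le> 1 \<and> 0 \<le> snd m \<and> snd m \<le> 1 \<and> a + fst m *\<^sub>R (b - a) = c + snd m *\<^sub>R (d - c)"
    (is "?l \<longleftrightarrow> ?r")
proof
  assume ?l
  then obtain x where x: "x \<in> closed_segment a b" "x \<in> closed_segment c d" by blast
  show ?r
  proof (cases "((b - a) \<bullet> (b - a)) * ((d - c) \<bullet> (d - c)) - ((b - a) \<bullet> (d - c)) * ((b - a) \<bullet> (d - c)) = 0")
    case True
    then show ?thesis
      using parallel_segments_meet[OF assms(1) gram_zero_imp_parallel x] assms(1) by auto
  next
    case False
    obtain s where s: "0 \<le> s" "s \<le> 1" "x = a + s *\<^sub>R (b - a)"
      using x(1) by (auto simp: in_segment algebra_simps)
    obtain t where t: "0 \<le> t" "t \<le> 1" "x = c + t *\<^sub>R (d - c)"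
      using x(2) by (auto simp: in_segment algebra_simps)
    \<comment> \<open>\<open>meeting_params\<close> solves the equation with a minus sign in front
      of the second vector, hence the coefficient \<open>- t\<close>.\<close>
    have w: "c - a = s *\<^sub>R (b - a) + (- t) *\<^sub>R (d - c)"
    proof -
      have "c - a = (c + t *\<^sub>R (d - c)) - a - t *\<^sub>R (d - c)" by simp
      also have "\<dots> = (a + s *\<^sub>R (b - a)) - a - t *\<^sub>R (d - c)" using s(3) t(3) by simp
      finally show ?thesis by simp
    qed
    have "fst m = s" "snd m = t"
      using cramer_inner[OF w] False unfolding m_def meeting_params_def
      by (simp_all add: divide_simps)
    with s t show ?thesis by auto
  qed
next
  assume ?r
  moreover have ?l if "0 \<le> fst m" "fst m \<le> 1" "0 \<le> snd m" "snd m \<le> 1"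
    and e: "a + fst m *\<^sub>R (b - a) = c + snd m *\<^sub>R (d - c)"
  proof -
    have "a + fst m *\<^sub>R (b - a) \<in> closed_segment a b" "c + snd m *\<^sub>R (d - c) \<in> closed_segment c d"
      using that by (auto simp: in_segment algebra_simps)
    with e show ?thesis by auto
  qed
  ultimately show ?l by auto
qed

section \<open>Membership in planes, coordinates on a plane, and piercing\<close>

lemma affine_hull_3_iff:
  "x \<in> affine hull {p, q, r} \<longleftrightarrow> (\<exists>s t. x - p = s *\<^sub>R (q - p) + t *\<^sub>R (r - p))"
  for p q r :: "'a::real_vector"
proof
  assume "x \<in> affine hull {p, q, r}"
  then obtain u v w where e: "x = u *\<^sub>R p + v *\<^sub>R q + w *\<^sub>R r" "u + v + w = 1"
    by (auto simp: affine_hull_3)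
  then have u: "u = 1 - v - w" by simp
  have "x - p = v *\<^sub>R (q - p) + w *\<^sub>R (r - p)" unfolding e(1) u by (simp add: algebra_simps)
  then show "\<exists>s t. x - p = s *\<^sub>R (q - p) + t *\<^sub>R (r - p)" by blast
next
  assume "\<exists>s t. x - p = s *\<^sub>R (q - p) + t *\<^sub>R (r - p)"
  then obtain s t where "x - p = s *\<^sub>R (q - p) + t *\<^sub>R (r - p)" by blast
  then have "x = p + (s *\<^sub>R (q - p) + t *\<^sub>R (r - p))" by (metis add.commute diff_add_cancel)
  then have "x = (1 - s - t) *\<^sub>R p + s *\<^sub>R q + t *\<^sub>R r" by (simp add: algebra_simps)
  moreover have "(1 - s - t) + s + t = 1" by simp
  ultimately show "x \<in> affine hull {p, q, r}" unfolding affine_hull_3 by blast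
qed

text \<open>A vanishing Gram determinant makes the three points collinear; the hull is then already
  spanned by two of them and has dimension at most one.\<close>

lemma plane_gram_nonzero:
  fixes p q r :: "'a::euclidean_space"
  assumes "is_plane (affine hull {p, q, r})"
  shows "((q - p) \<bullet> (q - p)) * ((r - p) \<bullet> (r - p)) - ((q - p) \<bullet> (r - p)) * ((q - p) \<bullet> (r - p)) \<noteq> 0"
proof
  have small: False if "affine hull {p, q, r} = affine hull {y, z}" for y z
  proof -
    have "aff_dim (affine hull {p, q, r}) \<le> int (card {y, z}) - 1"
      unfolding that aff_dim_affine_hull by (rule aff_dim_le_card) simp
    moreover have "card {y, z} \<le> 2" by (simp add: card_insert_if)
    ultimately show False using assms by (simp add: is_plane_def)
  qed
  assume g: "((q - p) \<bullet> (q - p)) * ((r - p) \<bullet> (r - p)) - ((q - p) \<bullet> (r - p)) * ((q - p) \<bullet> (r - p)) = 0"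
  show False
  proof (cases "q = p")
    case True
    then show ?thesis using small[of p r] by (simp add: insert_commute)
  next
    case False
    define c where "c = ((q - p) \<bullet> (r - p)) / ((q - p) \<bullet> (q - p))"
    have "r - p = c *\<^sub>R (q - p)"
      using gram_zero_imp_parallel[OF _ g] False by (simp add: c_def)
    then have "r = (1 - c) *\<^sub>R p + c *\<^sub>R q" by (simp add: algebra_simps)
    then have "r \<in> affine hull {p, q}"
      unfolding affine_hull_2 by (metis (mono_tags, lifting) diff_add_cancel mem_Collect_eq)
    then have "affine hull (insert r {p, q}) = affine hull {p, q}" by (rule hull_redundant)
    then show ?thesis using small[of p q] by (simp add: insert_commute)
  qed
qed

text \<open>The candidate coefficients are those of Cramer's rule, and the equation is multiplied by
  the Gram determinant, so that the test is polynomial in the coordinates. For points spanning a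
  plane the determinant can be divided out again.\<close>

lemma mem_plane_iff:
  fixes p q r x :: "'a::euclidean_space"
  assumes "is_plane (affine hull {p, q, r})"
  defines "u \<equiv> q - p" and "v \<equiv> r - p" and "w \<equiv> x - p"
  shows "x \<in> affine hull {p, q, r} \<longleftrightarrow>
    ((u \<bullet> u) * (v \<bullet> v) - (u \<bullet> v) * (u \<bullet> v)) *\<^sub>R w =
    ((w \<bullet> u) * (v \<bullet> v) - (w \<bullet> v) * (u \<bullet> v)) *\<^sub>R u + ((w \<bullet> v) * (u \<bullet> u) - (w \<bullet> u) * (u \<bullet> v)) *\<^sub>R v"
    (is "_ \<longleftrightarrow> ?g *\<^sub>R w = ?\<alpha> *\<^sub>R u + ?\<beta> *\<^sub>R v")
proof
  assume "x \<in> affine hull {p, q, r}"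
  then obtain s t where w: "w = s *\<^sub>R u + t *\<^sub>R v" unfolding affine_hull_3_iff u_def v_def w_def by blast
  show "?g *\<^sub>R w = ?\<alpha> *\<^sub>R u + ?\<beta> *\<^sub>R v"
    unfolding cramer_inner[OF w] by (simp only: w scaleR_add_right scaleR_scaleR mult.commute)
next
  assume "?g *\<^sub>R w = ?\<alpha> *\<^sub>R u + ?\<beta> *\<^sub>R v"
  moreover have "?g \<noteq> 0" unfolding u_def v_def using plane_gram_nonzero[OF assms(1)] .
  ultimately have "w = (1 / ?g) *\<^sub>R (?\<alpha> *\<^sub>R u + ?\<beta> *\<^sub>R v)"
    by (metis (no_types, lifting) divide_self scaleR_one scaleR_scaleR times_divide_eq_left mult_1)
  then have "w = (?\<alpha> / ?g) *\<^sub>R u + (?\<beta> / ?g) *\<^sub>R v" by (simp add: scaleR_add_right)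
  then show "x \<in> affine hull {p, q, r}" unfolding affine_hull_3_iff u_def v_def w_def by blast
qed

text \<open>The difference of the two points lies in the span of the two directions and is
  orthogonal to both. The two inner products thus serve as coordinates on the plane.\<close>

lemma plane_functionals_inj:
  fixes p q r x y :: "'a::euclidean_space"
  assumes "x \<in> affine hull {p, q, r}" "y \<in> affine hull {p, q, r}"
    and "(q - p) \<bullet> x = (q - p) \<bullet> y" "(r - p) \<bullet> x = (r - p) \<bullet> y"
  shows "x = y"
proof -
  obtain s t s' t' where "x - p = s *\<^sub>R (q - p) + t *\<^sub>R (r - p)" "y - p = s' *\<^sub>R (q - p) + t' *\<^sub>R (r - p)"
    using assms(1,2) unfolding affine_hull_3_iff by blast
  then have "(x - p) - (y - p) = (s - s') *\<^sub>R (q - p) + (t - t') *\<^sub>R (r - p)"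
    by (simp only: scaleR_diff_left) simp
  then have "x - y = (s - s') *\<^sub>R (q - p) + (t - t') *\<^sub>R (r - p)" by simp
  then have "(x - y) \<bullet> (x - y) = (s - s') * ((q - p) \<bullet> (x - y)) + (t - t') * ((r - p) \<bullet> (x - y))"
    by (metis inner_add_left inner_scaleR_left)
  moreover have "(q - p) \<bullet> (x - y) = 0" "(r - p) \<bullet> (x - y) = 0"
    using assms(3,4) by (simp_all add: inner_diff_right)
  ultimately have "(x - y) \<bullet> (x - y) = 0" by (simp only: mult_zero_right add_0)
  then show ?thesis by simp
qed

lemma segment_subset_affine:
  fixes a b :: "'a::real_vector"
  assumes "affine A" "x \<in> closed_segment a b" "y \<in> closed_segment a b" "x \<noteq> y" "x \<in> A" "y \<in> A"
  shows "closed_segment a b \<subseteq> A"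
proof
  fix z assume z: "z \<in> closed_segment a b"
  obtain s t u where p: "x = (1 - s) *\<^sub>R a + s *\<^sub>R b" "y = (1 - t) *\<^sub>R a + t *\<^sub>R b" "z = (1 - u) *\<^sub>R a + u *\<^sub>R b"
    using assms(2,3) z by (auto simp: in_segment)
  then have "s \<noteq> t" using assms(4) by auto
  \<comment> \<open>Affine parameter of \<open>z\<close> on the line with \<open>x\<close> at
    \<open>0\<close> and \<open>y\<close> at \<open>1\<close>.\<close>
  define c where "c = (u - s) / (t - s)"
  have c: "c * (t - s) = u - s" using \<open>s \<noteq> t\<close> by (simp add: c_def)
  have "(1 - c) *\<^sub>R x + c *\<^sub>R y = (1 - (s + c * (t - s))) *\<^sub>R a + (s + c * (t - s)) *\<^sub>R b"
    unfolding p by (simp add: algebra_simps)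
  also have "\<dots> = z" unfolding c p by simp
  finally show "z \<in> A"
    using assms(1,5,6) unfolding affine_def by (metis diff_add_cancel)
qed

text \<open>Pigeonhole: an infinite segment covered by finitely many affine sets has two points in
  one of them, and then lies in it.\<close>

lemma segment_subset_some_affine:
  fixes a b :: "'a::euclidean_space"
  assumes "finite P" "\<And>A. A \<in> P \<Longrightarrow> affine A" "a \<noteq> b" "closed_segment a b \<subseteq> \<Union>P"
  obtains A where "A \<in> P" "closed_segment a b \<subseteq> A"
proof -
  have "infinite (\<Union>A\<in>P. closed_segment a b \<inter> A)"
  proof -
    have "(\<Union>A\<in>P. closed_segment a b \<inter> A) = closed_segment a b" using assms(4) by blast
    moreover have "infinite (closed_segment a b)" using assms(3) by simp
    ultimately show ?thesis by simp
  qed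
  then obtain A where A: "A \<in> P" "infinite (closed_segment a b \<inter> A)" using assms(1) by blast
  obtain x where x: "x \<in> closed_segment a b \<inter> A" using A(2) by (metis ex_in_conv finite.emptyI)
  obtain y where y: "y \<in> closed_segment a b \<inter> A" "y \<noteq> x"
    using infinite_remove[OF A(2), of x] by (metis Diff_iff ex_in_conv finite.emptyI insertCI)
  show ?thesis
    using that[OF A(1)] segment_subset_affine[OF assms(2)[OF A(1)]] x y by blast
qed

text \<open>A segment not contained in an affine set has at most one point in it, so its meeting
  points with \<open>U\<close> and with \<open>V\<close> coincide.\<close>

lemma piercing_segments_meet:
  fixes a b :: "'a::real_vector"
  assumes "affine A" "\<not> closed_segment a b \<subseteq> A" "U \<subseteq> A" "V \<subseteq> A"
    "closed_segment a b \<inter> U \<noteq> {}" "closed_segment a b \<inter> V \<noteq> {}"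
  shows "U \<inter> V \<noteq> {}"
  using assms segment_subset_affine[OF assms(1), of _ a b] by blast

section \<open>Reasoning about programs and tests\<close>

text \<open>
  The natural-number memory is viewed as 18 interleaved arrays: entry \<open>i\<close> of array \<open>c\<close> has address
  \<open>18 * i + code c\<close>, so that the input sizes in cells \<open>0\<close> and \<open>1\<close> are entry \<open>0\<close> of \<open>NSeg\<close> and
  \<open>NPl\<close>. Scalar variables are arrays of which only entry \<open>0\<close> is used.
\<close>

datatype cell = NSeg | NPl | PlI | Ord | Lev | VtxV | VtxU | Flag | Pre | Best | Cur | BestOrd
  | Class | Hit | Height | Pred | Chosen | Out

definition cells :: "cell list" where
  "cells = [NSeg, NPl, PlI, Ord, Lev, VtxV, VtxU, Flag, Pre, Best, Cur, BestOrd,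
     Class, Hit, Height, Pred, Chosen, Out]"

primrec code :: "cell \<Rightarrow> nat" where
  "code NSeg = 0" | "code NPl = 1" | "code PlI = 2" | "code Ord = 3" | "code Lev = 4"
| "code VtxV = 5" | "code VtxU = 6" | "code Flag = 7" | "code Pre = 8" | "code Best = 9"
| "code Cur = 10" | "code BestOrd = 11" | "code Class = 12" | "code Hit = 13"
| "code Height = 14" | "code Pred = 15" | "code Chosen = 16" | "code Out = 17"

lemma code_less: "code c < 18"
  by (cases c) simp_all

lemma cells_nth_code: "cells ! code c = c"
  by (cases c) (simp_all add: cells_def)

lemma code_cells_nth: "r < 18 \<Longrightarrow> code (cells ! r) = r"
proof -
  have "\<forall>r\<in>set [0..<18]. code (cells ! r) = r" by code_simp
  then show "r < 18 \<Longrightarrow> code (cells ! r) = r" by simp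
qed

type_synonym state = "cell \<Rightarrow> nat \<Rightarrow> nat"

definition mem :: "state \<Rightarrow> nat \<Rightarrow> nat" where
  "mem a x = a (cells ! (x mod 18)) (x div 18)"

lemma mem_fetch [simp]: "mem a (18 * i + code c) = a c i"
  using code_less[of c] by (simp add: mem_def cells_nth_code)

text \<open>Quotient and remainder by 18 recover entry and array from an address, so a store never
  touches another array.\<close>

lemma mem_update: "(mem a)(18 * i + code c := y) = mem (a(c := (a c)(i := y)))"
proof
  fix x
  have "x = 18 * i + code c \<longleftrightarrow> cells ! (x mod 18) = c \<and> x div 18 = i"
  proof
    assume "cells ! (x mod 18) = c \<and> x div 18 = i"
    then have "x mod 18 = code c" "x div 18 = i" using code_cells_nth[of "x mod 18"] by auto
    then show "x = 18 * i + code c" using div_mult_mod_eq[of x 18] by simp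
  qed (use code_less[of c] in \<open>simp add: cells_nth_code\<close>)
  then show "((mem a)(18 * i + code c := y)) x = mem (a(c := (a c)(i := y))) x"
    unfolding mem_def by auto
qed

text \<open>Natural-number expressions have no product. Multiplication by a constant is unrolled
  into additions when the program is built; the factors used are fixed or depend on the dimension
  only.\<close>

primrec nmul :: "nat \<Rightarrow> nexp \<Rightarrow> nexp" where
  "nmul 0 e = NLit 0"
| "nmul (Suc c) e = NAdd e (nmul c e)"

lemma nval_nmul [simp]: "nval (nmul c e) m = c * nval e m"
  by (induction c) simp_all

definition addr :: "cell \<Rightarrow> nexp \<Rightarrow> nexp" where
  "addr c i = NAdd (nmul 18 i) (NLit (code c))"

definition At :: "cell \<Rightarrow> nexp \<Rightarrow> nexp" where
  "At c i = NCell (addr c i)"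

abbreviation Var :: "cell \<Rightarrow> nexp" where
  "Var c \<equiv> At c (NLit 0)"

definition put :: "cell \<Rightarrow> nexp \<Rightarrow> nexp \<Rightarrow> com" where
  "put c i e = NStore (addr c i) e"

lemma nval_At [simp]: "nval (At c i) (mem a, R) = a c (nval i (mem a, R))"
  by (simp add: At_def addr_def)

text \<open>Total correctness with a time bound \<open>t\<close> and a frame: only arrays in
  \<open>X\<close> may change, and the real memory \<open>R\<close>, which holds the input, stays
  fixed. The witness is a state, so the final memory again has the interleaved form.\<close>

definition wp :: "(nat \<Rightarrow> real) \<Rightarrow> cell set \<Rightarrow> com \<Rightarrow> nat \<Rightarrow> (state \<Rightarrow> bool) \<Rightarrow> state \<Rightarrow> bool" where
  "wp R X c t Q a \<longleftrightarrow>
     (\<exists>a' t'. t' \<le> t \<and> runs c (mem a, R) t' (mem a', R) \<and> (\<forall>x. x \<notin> X \<longrightarrow> a' x = a x) \<and> Q a')"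

lemma wp_Skip: "1 \<le> t \<Longrightarrow> Q a \<Longrightarrow> wp R X Skip t Q a"
  unfolding wp_def using runs.Skip by blast

lemma wp_put:
  assumes "1 \<le> t" "c \<in> X" "Q (a(c := (a c)(nval i (mem a, R) := nval e (mem a, R))))"
  shows "wp R X (put c i e) t Q a"
proof -
  have "runs (put c i e) (mem a, R) 1 (mem (a(c := (a c)(nval i (mem a, R) := nval e (mem a, R)))), R)"
    using runs.NStore[of "addr c i" e "(mem a, R)"] by (simp add: put_def addr_def mem_update)
  then show ?thesis unfolding wp_def using assms by (metis fun_upd_other)
qed

lemma wp_Seq: "wp R X c t (wp R X c' t' Q) a \<Longrightarrow> wp R X (Seq c c') (t + t') Q a"
  unfolding wp_def by (metis add_mono runs.Seq)

lemma wp_Cond: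
  assumes "bval b (mem a, R) \<Longrightarrow> wp R X c t Q a" "\<not> bval b (mem a, R) \<Longrightarrow> wp R X c' t Q a"
  shows "wp R X (Cond b c c') (Suc t) Q a"
proof (cases "bval b (mem a, R)")
  case True
  then show ?thesis using assms(1) unfolding wp_def by (meson Suc_le_mono runs.CondTrue)
next
  case False
  then show ?thesis using assms(2) unfolding wp_def by (meson Suc_le_mono runs.CondFalse)
qed

text \<open>The new postcondition may use that arrays outside \<open>X\<close> are unchanged; this
  is how facts about untouched arrays pass from one piece of program to the next.\<close>

lemma wp_weaken:
  assumes "wp R X c t Q a" "X \<subseteq> Y" "t \<le> t'"
    and "\<And>a'. (\<And>x. x \<notin> X \<Longrightarrow> a' x = a x) \<Longrightarrow> Q a' \<Longrightarrow> Q' a'"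
  shows "wp R Y c t' Q' a"
  using assms unfolding wp_def by (meson order_trans subsetD)

definition For :: "cell \<Rightarrow> nexp \<Rightarrow> com \<Rightarrow> com" where
  "For x e c = Seq (put x (NLit 0) (NLit 0))
     (While (NLess (Var x) e) (Seq c (put x (NLit 0) (NAdd (Var x) (NLit 1)))))"

text \<open>Each round costs the body, one test and one increment; initialisation and the failing
  test add two. The number of rounds \<open>N\<close> is replaced by a common bound
  \<open>M\<close>, so that running times depend on \<open>M\<close> only. \<open>stable\<close>
  keeps the invariant independent of the counter.\<close>

lemma wp_For_invariant:
  assumes x: "x \<in> X"
    and bound: "\<And>a'. (\<And>y. y \<notin> X \<Longrightarrow> a' y = a y) \<Longrightarrow> nval e (mem a', R) = N"
    and M: "N \<le> M"
    and init: "I 0 a"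
    and stable: "\<And>v a' z. I v a' \<Longrightarrow> I v (a'(x := z))"
    and body: "\<And>v a'. v < N \<Longrightarrow> (\<And>y. y \<notin> X \<Longrightarrow> a' y = a y) \<Longrightarrow> a' x 0 = v \<Longrightarrow> I v a' \<Longrightarrow>
      wp R X c t (\<lambda>a''. a'' x 0 = v \<and> I (Suc v) a'') a'"
  shows "wp R X (For x e c) (M * (t + 2) + 2) (I N) a"
proof -
  let ?c = "Seq c (put x (NLit 0) (NAdd (Var x) (NLit 1)))"
  let ?W = "While (NLess (Var x) e) ?c"
  have loop: "wp R X ?W ((N - v) * (t + 2) + 1) (I N) a'"
    if "v \<le> N" "\<And>y. y \<notin> X \<Longrightarrow> a' y = a y" "a' x 0 = v" "I v a'" for v a'
    using that
  proof (induction "N - v" arbitrary: v a')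
    case 0
    then have "v = N" by simp
    with 0 have "\<not> bval (NLess (Var x) e) (mem a', R)" by (simp add: bound)
    from runs.WhileFalse[OF this] show ?case
      unfolding wp_def using 0 \<open>v = N\<close> by (metis add_leE diff_self_eq_0 le_refl mult_0 plus_nat.add_0)
  next
    case (Suc D)
    then have v: "v < N" by simp
    with Suc have b: "bval (NLess (Var x) e) (mem a', R)" by (simp add: bound)
    have "wp R X ?c (t + 1) (\<lambda>a''. a'' x 0 = Suc v \<and> I (Suc v) a'') a'"
    proof (rule wp_Seq, rule wp_weaken[OF body[OF v Suc.prems(2-4)]])
      fix a1 assume "a1 x 0 = v \<and> I (Suc v) a1"
      then show "wp R X (put x (NLit 0) (NAdd (Var x) (NLit 1))) 1 (\<lambda>a''. a'' x 0 = Suc v \<and> I (Suc v) a'') a1"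
        by (intro wp_put[OF order_refl x]) (simp add: stable)
    qed auto
    then obtain a1 t1 where 1: "t1 \<le> t + 1" "runs ?c (mem a', R) t1 (mem a1, R)"
      "\<And>y. y \<notin> X \<Longrightarrow> a1 y = a' y" "a1 x 0 = Suc v" "I (Suc v) a1"
      unfolding wp_def by blast
    have "wp R X ?W ((N - Suc v) * (t + 2) + 1) (I N) a1"
      using Suc.hyps(1)[of "Suc v" a1] Suc.hyps(2) Suc.prems(2) 1 v by simp
    then obtain a2 t2 where 2: "t2 \<le> (N - Suc v) * (t + 2) + 1" "runs ?W (mem a1, R) t2 (mem a2, R)"
      "\<And>y. y \<notin> X \<Longrightarrow> a2 y = a1 y" "I N a2"
      unfolding wp_def by blast
    have "N - v = Suc (N - Suc v)" using v by simp
    then have "Suc (t1 + t2) \<le> (N - v) * (t + 2) + 1" using 1(1) 2(1) by simp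
    moreover have "runs ?W (mem a', R) (Suc (t1 + t2)) (mem a2, R)"
      using runs.WhileTrue[OF b 1(2) 2(2)] .
    ultimately show ?case unfolding wp_def using 1(3) 2(3,4) by metis
  qed
  have "wp R X (For x e c) (1 + (N * (t + 2) + 1)) (I N) a"
    unfolding For_def
  proof (rule wp_Seq, rule wp_put[OF order_refl x])
    have frame: "\<And>y. y \<notin> X \<Longrightarrow> (a(x := (a x)(0 := 0))) y = a y" using x by auto
    have "I 0 (a(x := (a x)(0 := 0)))" using stable init by blast
    then show "wp R X ?W (N * (t + 2) + 1) (I N)
      (a(x := (a x)(nval (NLit 0) (mem a, R) := nval (NLit 0) (mem a, R))))"
      using loop[of 0 "a(x := (a x)(0 := 0))", OF _ frame] by simp
  qed
  moreover have "1 + (N * (t + 2) + 1) \<le> M * (t + 2) + 2" using mult_le_mono1[OF M, of "t + 2"] by linarith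
  ultimately show ?thesis by (rule wp_weaken[OF _ subset_refl])
qed

lemma wp_For:
  assumes "x \<in> X" "\<And>a'. (\<And>y. y \<notin> X \<Longrightarrow> a' y = a y) \<Longrightarrow> nval e (mem a', R) = N" "N \<le> M"
    "I 0 a" "\<And>v a' z. I v a' \<Longrightarrow> I v (a'(x := z))"
    "\<And>v a'. v < N \<Longrightarrow> (\<And>y. y \<notin> X \<Longrightarrow> a' y = a y) \<Longrightarrow> a' x 0 = v \<Longrightarrow> I v a' \<Longrightarrow>
      wp R X c t (\<lambda>a''. a'' x 0 = v \<and> I (Suc v) a'') a'"
    "\<And>a'. (\<And>y. y \<notin> X \<Longrightarrow> a' y = a y) \<Longrightarrow> I N a' \<Longrightarrow> Q a'"
  shows "wp R X (For x e c) (M * (t + 2) + 2) Q a"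
  by (rule wp_weaken[OF wp_For_invariant[where I = I, OF assms(1-6)] order_refl order_refl assms(7)])

section \<open>Derived tests, vector expressions and geometric predicates\<close>

definition BOr :: "bexp \<Rightarrow> bexp \<Rightarrow> bexp" where
  "BOr b b' = BNot (BAnd (BNot b) (BNot b'))"

definition BAll :: "bexp list \<Rightarrow> bexp" where
  "BAll bs = foldr BAnd bs (NLess (NLit 0) (NLit 1))"

definition NEq :: "nexp \<Rightarrow> nexp \<Rightarrow> bexp" where
  "NEq e e' = BAnd (BNot (NLess e e')) (BNot (NLess e' e))"

definition RLe :: "rexp \<Rightarrow> rexp \<Rightarrow> bexp" where
  "RLe e e' = BNot (RLess e' e)"

definition REq :: "rexp \<Rightarrow> rexp \<Rightarrow> bexp" where
  "REq e e' = BAnd (RLe e e') (RLe e' e)"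

lemma bval_BOr [simp]: "bval (BOr b b') m \<longleftrightarrow> bval b m \<or> bval b' m"
  by (simp add: BOr_def)

lemma bval_BAll [simp]: "bval (BAll bs) m \<longleftrightarrow> (\<forall>b\<in>set bs. bval b m)"
  unfolding BAll_def by (induction bs) simp_all

lemma bval_NEq [simp]: "bval (NEq e e') m \<longleftrightarrow> nval e m = nval e' m"
  by (auto simp: NEq_def)

lemma bval_RLe [simp]: "bval (RLe e e') m \<longleftrightarrow> rval e m \<le> rval e' m"
  by (simp add: RLe_def not_less)

lemma bval_REq [simp]: "bval (REq e e') m \<longleftrightarrow> rval e m = rval e' m"
  by (auto simp: REq_def)

text \<open>One real expression for each coordinate. Loops over coordinates are thereby unrolled
  when the program is built, whose size depends on the dimension.\<close>

type_synonym vexp = "nat \<Rightarrow> rexp"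

definition denotes :: "vexp \<Rightarrow> memory \<Rightarrow> real^'n \<Rightarrow> bool" where
  "denotes X m x \<longleftrightarrow> (\<forall>j<CARD('n). rval (X j) m = x $ from_nat_into UNIV j)"

definition VAdd :: "vexp \<Rightarrow> vexp \<Rightarrow> vexp" where
  "VAdd X Y = (\<lambda>j. RAdd (X j) (Y j))"

definition VSub :: "vexp \<Rightarrow> vexp \<Rightarrow> vexp" where
  "VSub X Y = (\<lambda>j. RSub (X j) (Y j))"

definition VScale :: "rexp \<Rightarrow> vexp \<Rightarrow> vexp" where
  "VScale e X = (\<lambda>j. RMul e (X j))"

definition VDot :: "nat \<Rightarrow> vexp \<Rightarrow> vexp \<Rightarrow> rexp" where
  "VDot d X Y = foldr (\<lambda>j e. RAdd (RMul (X j) (Y j)) e) [0..<d] (RLit 0)"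

definition VEq :: "nat \<Rightarrow> vexp \<Rightarrow> vexp \<Rightarrow> bexp" where
  "VEq d X Y = BAll (map (\<lambda>j. REq (X j) (Y j)) [0..<d])"

lemma denotes_VAdd: "denotes X m x \<Longrightarrow> denotes Y m y \<Longrightarrow> denotes (VAdd X Y) m (x + y)"
  by (simp add: denotes_def VAdd_def)

lemma denotes_VSub: "denotes X m x \<Longrightarrow> denotes Y m y \<Longrightarrow> denotes (VSub X Y) m (x - y)"
  by (simp add: denotes_def VSub_def)

lemma denotes_VScale: "rval e m = c \<Longrightarrow> denotes X m x \<Longrightarrow> denotes (VScale e X) m (c *\<^sub>R x)"
  by (simp add: denotes_def VScale_def)

lemma bij_betw_index: "bij_betw (from_nat_into (UNIV :: 'n::finite set)) {..<CARD('n)} UNIV"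
  using bij_betw_from_nat_into_finite[of "UNIV :: 'n set"] by simp

lemma rval_VDot:
  fixes x y :: "real^'n"
  assumes "denotes X m x" "denotes Y m y"
  shows "rval (VDot CARD('n) X Y) m = x \<bullet> y"
proof -
  have "rval (foldr (\<lambda>j e. RAdd (RMul (X j) (Y j)) e) js (RLit 0)) m =
    sum_list (map (\<lambda>j. rval (X j) m * rval (Y j) m) js)" for js
    by (induction js) simp_all
  then have "rval (VDot CARD('n) X Y) m = (\<Sum>j<CARD('n). rval (X j) m * rval (Y j) m)"
    by (simp add: VDot_def interv_sum_list_conv_sum_set_nat atLeast0LessThan)
  also have "\<dots> = (\<Sum>j<CARD('n). x $ from_nat_into UNIV j * y $ from_nat_into UNIV j)"
    using assms by (intro sum.cong) (auto simp: denotes_def)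
  also have "\<dots> = (\<Sum>i\<in>UNIV. x $ i * y $ i)"
    by (rule sum.reindex_bij_betw[OF bij_betw_index])
  finally show ?thesis by (simp add: inner_vec_def)
qed

lemma bval_VEq:
  fixes x y :: "real^'n"
  assumes "denotes X m x" "denotes Y m y"
  shows "bval (VEq CARD('n) X Y) m \<longleftrightarrow> x = y"
proof -
  have "bval (VEq CARD('n) X Y) m \<longleftrightarrow>
      (\<forall>j<CARD('n). x $ from_nat_into UNIV j = y $ from_nat_into UNIV j)"
    using assms by (auto simp: VEq_def denotes_def)
  also have "\<dots> \<longleftrightarrow> (\<forall>i\<in>from_nat_into UNIV ` {..<CARD('n)}. x $ i = y $ i)"
    by auto
  also have "\<dots> \<longleftrightarrow> x = y"
    using bij_betw_index[where 'n = 'n] by (simp add: bij_betw_def vec_eq_iff)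
  finally show ?thesis .
qed

definition OnSegment :: "nat \<Rightarrow> vexp \<Rightarrow> vexp \<Rightarrow> vexp \<Rightarrow> bexp" where
  "OnSegment d X A B =
     (let D = VSub B A; s = RDiv (VDot d (VSub X A) D) (VDot d D D)
      in BAll [RLe (RLit 0) s, RLe s (RLit 1), VEq d X (VAdd A (VScale s D))])"

lemma bval_OnSegment:
  fixes x a b :: "real^'n"
  assumes "denotes X m x" "denotes A m a" "denotes B m b" "a \<noteq> b"
  shows "bval (OnSegment CARD('n) X A B) m \<longleftrightarrow> x \<in> closed_segment a b"
proof -
  define D where "D = VSub B A"
  define s where "s = RDiv (VDot CARD('n) (VSub X A) D) (VDot CARD('n) D D)"
  have D: "denotes D m (b - a)" unfolding D_def by (intro denotes_VSub assms)
  have s: "rval s m = ((x - a) \<bullet> (b - a)) / ((b - a) \<bullet> (b - a))"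
    unfolding s_def by (simp add: rval_VDot[OF D D] rval_VDot[OF denotes_VSub[OF assms(1,2)] D])
  have "denotes (VAdd A (VScale s D)) m (a + (((x - a) \<bullet> (b - a)) / ((b - a) \<bullet> (b - a))) *\<^sub>R (b - a))"
    by (intro denotes_VAdd denotes_VScale s D assms)
  note e = bval_VEq[OF assms(1) this]
  show ?thesis
    unfolding OnSegment_def Let_def D_def[symmetric] s_def[symmetric] mem_closed_segment_iff[OF assms(4)]
    by (simp add: e s)
qed

text \<open>
  If the segments meet and no endpoint of \<open>A B\<close> lies on \<open>C D\<close>, then either they are parallel and \<open>C\<close>
  lies on \<open>A B\<close>, or the point found by Cramer's rule lies on both.
\<close>

definition SegmentsMeet :: "nat \<Rightarrow> vexp \<Rightarrow> vexp \<Rightarrow> vexp \<Rightarrow> vexp \<Rightarrow> bexp" where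
  "SegmentsMeet d A B C D =
     (let p = VSub B A; q = VSub D C; w = VSub C A;
          g = RSub (RMul (VDot d p p) (VDot d q q)) (RMul (VDot d p q) (VDot d p q));
          s = RDiv (RSub (RMul (VDot d w p) (VDot d q q)) (RMul (VDot d w q) (VDot d p q))) g;
          t = RDiv (RSub (RMul (VDot d w p) (VDot d p q)) (RMul (VDot d w q) (VDot d p p))) g
      in BOr (OnSegment d A C D) (BOr (OnSegment d B C D) (BOr (OnSegment d C A B)
         (BAll [RLe (RLit 0) s, RLe s (RLit 1), RLe (RLit 0) t, RLe t (RLit 1),
            VEq d (VAdd A (VScale s p)) (VAdd C (VScale t q))]))))"

lemma bval_SegmentsMeet:
  fixes a b c e :: "real^'n"
  assumes "denotes A m a" "denotes B m b" "denotes C m c" "denotes E m e" "a \<noteq> b" "c \<noteq> e"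
  shows "bval (SegmentsMeet CARD('n) A B C E) m \<longleftrightarrow> closed_segment a b \<inter> closed_segment c e \<noteq> {}"
proof -
  let ?d = "CARD('n)"
  define p q w where "p = VSub B A" and "q = VSub E C" and "w = VSub C A"
  have d: "denotes p m (b - a)" "denotes q m (e - c)" "denotes w m (c - a)"
    unfolding p_def q_def w_def by (intro denotes_VSub assms)+
  define g where "g = RSub (RMul (VDot ?d p p) (VDot ?d q q)) (RMul (VDot ?d p q) (VDot ?d p q))"
  define s where "s = RDiv (RSub (RMul (VDot ?d w p) (VDot ?d q q)) (RMul (VDot ?d w q) (VDot ?d p q))) g"
  define t where "t = RDiv (RSub (RMul (VDot ?d w p) (VDot ?d p q)) (RMul (VDot ?d w q) (VDot ?d p p))) g"
  define S T where "S = fst (meeting_params (b - a) (e - c) (c - a))"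
    and "T = snd (meeting_params (b - a) (e - c) (c - a))"
  have st: "rval s m = S" "rval t m = T"
    unfolding s_def t_def g_def S_def T_def meeting_params_def
    by (simp_all add: rval_VDot[OF d(1) d(1)] rval_VDot[OF d(1) d(2)] rval_VDot[OF d(2) d(2)]
      rval_VDot[OF d(3) d(1)] rval_VDot[OF d(3) d(2)])
  have "denotes (VAdd A (VScale s p)) m (a + S *\<^sub>R (b - a))"
    "denotes (VAdd C (VScale t q)) m (c + T *\<^sub>R (e - c))"
    by (intro denotes_VAdd denotes_VScale st d assms)+
  note eq = bval_VEq[OF this]
  note on = bval_OnSegment[OF assms(1,3,4,6)] bval_OnSegment[OF assms(2,3,4,6)] bval_OnSegment[OF assms(3,1,2,5)]
  show ?thesis
    unfolding SegmentsMeet_def Let_def p_def[symmetric] q_def[symmetric] w_def[symmetric]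
      g_def[symmetric] s_def[symmetric] t_def[symmetric] closed_segments_meet_iff[OF assms(5,6)]
      S_def[symmetric] T_def[symmetric]
    by (simp add: on eq st)
qed

definition OnPlane :: "nat \<Rightarrow> vexp \<Rightarrow> vexp \<Rightarrow> vexp \<Rightarrow> vexp \<Rightarrow> bexp" where
  "OnPlane d X P Q R =
     (let u = VSub Q P; v = VSub R P; w = VSub X P;
          g = RSub (RMul (VDot d u u) (VDot d v v)) (RMul (VDot d u v) (VDot d u v));
          \<alpha> = RSub (RMul (VDot d w u) (VDot d v v)) (RMul (VDot d w v) (VDot d u v));
          \<beta> = RSub (RMul (VDot d w v) (VDot d u u)) (RMul (VDot d w u) (VDot d u v))
      in VEq d (VScale g w) (VAdd (VScale \<alpha> u) (VScale \<beta> v)))"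

lemma bval_OnPlane:
  fixes x p q r :: "real^'n"
  assumes "denotes X m x" "denotes P m p" "denotes Q m q" "denotes R m r"
    and "is_plane (affine hull {p, q, r})"
  shows "bval (OnPlane CARD('n) X P Q R) m \<longleftrightarrow> x \<in> affine hull {p, q, r}"
proof -
  let ?d = "CARD('n)"
  define u v w where "u = VSub Q P" and "v = VSub R P" and "w = VSub X P"
  have d: "denotes u m (q - p)" "denotes v m (r - p)" "denotes w m (x - p)"
    unfolding u_def v_def w_def by (intro denotes_VSub assms)+
  note dots = rval_VDot[OF d(1) d(1)] rval_VDot[OF d(1) d(2)] rval_VDot[OF d(2) d(2)]
    rval_VDot[OF d(3) d(1)] rval_VDot[OF d(3) d(2)]
  show ?thesis
    unfolding OnPlane_def Let_def u_def[symmetric] v_def[symmetric] w_def[symmetric] mem_plane_iff[OF assms(5)]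
    by (rule bval_VEq; intro denotes_VAdd denotes_VScale d) (simp_all add: dots)
qed

text \<open>An existential quantifier over endpoints becomes the negation of a conjunction of
  reversed strict comparisons.\<close>

definition StartsBefore :: "(vexp \<Rightarrow> rexp) \<Rightarrow> vexp list \<Rightarrow> vexp list \<Rightarrow> bexp" where
  "StartsBefore x As Bs = BAll (map (\<lambda>q. BNot (BAll (map (\<lambda>p. RLess (x q) (x p)) As))) Bs)"

definition EndsBefore :: "(vexp \<Rightarrow> rexp) \<Rightarrow> vexp list \<Rightarrow> vexp list \<Rightarrow> bexp" where
  "EndsBefore x As Bs = BAll (map (\<lambda>p. BNot (BAll (map (\<lambda>q. RLess (x q) (x p)) Bs))) As)"

definition Below :: "(vexp \<Rightarrow> rexp) \<Rightarrow> (vexp \<Rightarrow> rexp) \<Rightarrow> vexp list \<Rightarrow> vexp list \<Rightarrow> bexp" where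
  "Below x y As Bs =
     BAll (map (\<lambda>p. BAll (map (\<lambda>q. BAnd (BOr (BNot (REq (x p) (x q))) (RLess (y p) (y q)))
       (BAll (map (\<lambda>p'. BAll (map (\<lambda>q'.
          BOr (BNot (RLess (x q) (x p))) (BOr (BNot (RLess (x p') (x q')))
            (RLess (RMul (RSub (y q') (y p')) (RSub (x q) (x p)))
                   (RMul (RSub (y q) (y p)) (RSub (x q') (x p')))))) Bs)) As))) Bs)) As)"

definition SegOrder :: "(vexp \<Rightarrow> rexp) \<Rightarrow> (vexp \<Rightarrow> rexp) \<Rightarrow> nat \<Rightarrow> vexp list \<Rightarrow> vexp list \<Rightarrow> bexp" where
  "SegOrder x y q As Bs =
     BAll [StartsBefore x As Bs,
       if q < 2 then EndsBefore x As Bs else EndsBefore x Bs As,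
       if even q then Below x y As Bs else Below x y Bs As]"

lemma bval_SegOrder:
  fixes a b c e :: "'a::real_vector"
  assumes lin: "linear \<xi>" "linear \<eta>"
    and x: "rval (x A) m = \<xi> a" "rval (x B) m = \<xi> b" "rval (x C) m = \<xi> c" "rval (x E) m = \<xi> e"
    and y: "rval (y A) m = \<eta> a" "rval (y B) m = \<eta> b" "rval (y C) m = \<eta> c" "rval (y E) m = \<eta> e"
  shows "bval (SegOrder x y q [A, B] [C, E]) m \<longleftrightarrow> seg_order \<xi> \<eta> q (closed_segment a b) (closed_segment c e)"
proof -
  \<comment> \<open>Stated for arbitrary endpoints because odd \<open>q\<close> uses it with the two
    segments exchanged.\<close>
  have below: "bval (Below x y [A, B] [C, E]) m \<longleftrightarrow> below \<xi> \<eta> (closed_segment a b) (closed_segment c e)"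
    if "rval (x A) m = \<xi> a" "rval (x B) m = \<xi> b" "rval (x C) m = \<xi> c" "rval (x E) m = \<xi> e"
       "rval (y A) m = \<eta> a" "rval (y B) m = \<eta> b" "rval (y C) m = \<eta> c" "rval (y E) m = \<eta> e"
     for A B C E a b c e
    unfolding segment_convex_hull
    by (subst below_convex_hull_iff[OF _ _ lin]) (simp_all add: Below_def below_def that, argo)
  have ends: "bval (EndsBefore x [A, B] [C, E]) m \<longleftrightarrow> ends_before \<xi> (closed_segment a b) (closed_segment c e)"
    if "rval (x A) m = \<xi> a" "rval (x B) m = \<xi> b" "rval (x C) m = \<xi> c" "rval (x E) m = \<xi> e"
     for A B C E a b c e
    unfolding ends_before_closed_segment[OF lin(1)] by (auto simp: EndsBefore_def ends_before_def that)
  have starts: "bval (StartsBefore x [A, B] [C, E]) m \<longleftrightarrow> starts_before \<xi> (closed_segment a b) (closed_segment c e)"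
    unfolding starts_before_closed_segment[OF lin(1)] by (auto simp: StartsBefore_def starts_before_def x)
  show ?thesis
    unfolding SegOrder_def seg_order_def
    by (simp add: below[OF x y] below[OF x(3,4,1,2) y(3,4,1,2)] ends[OF x] ends[OF x(3,4,1,2)] starts)
qed

lemma nth_concat_blocks:
  assumes "\<And>x. x \<in> set xs \<Longrightarrow> length (f x) = L" "i < length xs" "j < L"
  shows "concat (map f xs) ! (L * i + j) = f (xs ! i) ! j"
  using assms
proof (induction xs arbitrary: i)
  case (Cons x xs)
  then show ?case by (cases i) (simp_all add: nth_append add.assoc)
qed simp

lemma length_concat_blocks:
  assumes "\<And>x. x \<in> set xs \<Longrightarrow> length (f x) = L"
  shows "length (concat (map f xs)) = L * length xs"
  using assms by (induction xs) simp_all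

section \<open>Heights and the number of colors\<close>

text \<open>
  \<open>height_le r W l v\<close>: every chain of \<open>r\<close> in \<open>W\<close> that ends in \<open>v\<close> has at most \<open>l\<close> elements.
\<close>

primrec height_le :: "('a \<Rightarrow> 'a \<Rightarrow> bool) \<Rightarrow> 'a set \<Rightarrow> nat \<Rightarrow> 'a \<Rightarrow> bool" where
  "height_le r W 0 v \<longleftrightarrow> False"
| "height_le r W (Suc l) v \<longleftrightarrow> (\<forall>u\<in>W. r u v \<longrightarrow> height_le r W l u)"

lemma height_le_Suc: "height_le r W l v \<Longrightarrow> height_le r W (Suc l) v"
  by (induction l arbitrary: v) auto

lemma height_le_mono: "l \<le> l' \<Longrightarrow> height_le r W l v \<Longrightarrow> height_le r W l' v"
  by (induction rule: dec_induct) (auto intro: height_le_Suc simp del: height_le.simps)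

text \<open>Induction on the number of predecessors of \<open>v\<close>: by transitivity and
  irreflexivity, a predecessor of \<open>v\<close> has strictly fewer.\<close>

lemma height_le_card:
  assumes "finite W" and trans: "\<And>x y z. x \<in> W \<Longrightarrow> y \<in> W \<Longrightarrow> z \<in> W \<Longrightarrow> r x y \<Longrightarrow> r y z \<Longrightarrow> r x z"
    and irrefl: "\<And>x. x \<in> W \<Longrightarrow> \<not> r x x" and "v \<in> W"
  shows "height_le r W (Suc (card {u \<in> W. r u v})) v"
  using \<open>v \<in> W\<close>
proof (induction "card {u \<in> W. r u v}" arbitrary: v rule: less_induct)
  case less
  show ?case unfolding height_le.simps
  proof (intro ballI impI)
    fix u assume u: "u \<in> W" "r u v"
    have "{x \<in> W. r x u} \<subset> {x \<in> W. r x v}"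
      using u trans irrefl less.prems by blast
    then have c: "card {x \<in> W. r x u} < card {x \<in> W. r x v}"
      using assms(1) by (simp add: psubset_card_mono)
    from less.hyps[OF c u(1)] c show "height_le r W (card {x \<in> W. r x v}) u"
      by (metis Suc_leI height_le_mono)
  qed
qed

text \<open>The last property is the recursion for heights without maxima: it says when a segment
  may receive height \<open>Suc l\<close> once all heights up to \<open>l\<close> are known. The
  bound \<open>card W\<close> holds because \<open>v\<close> is not among its own
  predecessors.\<close>

lemma height_function_exists:
  assumes "finite W" and "\<And>x y z. x \<in> W \<Longrightarrow> y \<in> W \<Longrightarrow> z \<in> W \<Longrightarrow> r x y \<Longrightarrow> r y z \<Longrightarrow> r x z"
    and "\<And>x. x \<in> W \<Longrightarrow> \<not> r x x"
  obtains h :: "'a \<Rightarrow> nat" where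
    "\<And>v. v \<in> W \<Longrightarrow> 0 < h v" "\<And>v. v \<in> W \<Longrightarrow> h v \<le> card W"
    "\<And>v l. v \<in> W \<Longrightarrow> h v \<le> Suc l \<longleftrightarrow> (\<forall>u\<in>W. r u v \<longrightarrow> h u \<le> l)"
proof
  define h where "h v = (LEAST l. height_le r W l v)" for v
  have card: "height_le r W (card W) v" if v: "v \<in> W" for v
  proof -
    have "{u \<in> W. r u v} \<subset> W" using v assms(3) by blast
    then have "Suc (card {u \<in> W. r u v}) \<le> card W" using assms(1) by (simp add: Suc_leI psubset_card_mono)
    moreover have "height_le r W (Suc (card {u \<in> W. r u v})) v"
      by (rule height_le_card[OF assms(1) _ assms(3) v]) (use assms(2) in blast)
    ultimately show ?thesis by (rule height_le_mono)
  qed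
  have h: "h v \<le> l \<longleftrightarrow> height_le r W l v" if "v \<in> W" for v l
    unfolding h_def using card[OF that] by (meson LeastI Least_le height_le_mono)
  show "0 < h v" if "v \<in> W" for v
    using h[OF that, of 0] by simp
  show "h v \<le> card W" if "v \<in> W" for v
    using h[OF that] card[OF that] by simp
  show "h v \<le> Suc l \<longleftrightarrow> (\<forall>u\<in>W. r u v \<longrightarrow> h u \<le> l)" if "v \<in> W" for v l
    using h that by simp
qed

lemma sum_power4_le: "finite A \<Longrightarrow> (\<Sum>i\<in>A. (m i :: nat) ^ 4) \<le> (\<Sum>i\<in>A. m i) ^ 4"
proof (induction A rule: finite_induct)
  case (insert i A)
  have "x ^ 4 + y ^ 4 \<le> (x + y) ^ 4" for x y :: nat
    by (simp add: eval_nat_numeral algebra_simps)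
  then have "m i ^ 4 + (\<Sum>i\<in>A. m i) ^ 4 \<le> (m i + (\<Sum>i\<in>A. m i)) ^ 4" .
  with insert show ?case by simp
qed simp

text \<open>\<open>A\<close> holds the signatures of hit segments, given by class and hitting
  segment; class \<open>0\<close> is missing, since the hitting segment has a smaller class.
  \<open>B\<close> holds those of unhit segments, \<open>m i ^ 4\<close> for class \<open>i\<close>.
  The \<open>m i\<close> add up to at most \<open>card Z\<close>, and fourth powers are
  superadditive.\<close>

lemma card_signatures_le:
  fixes cl hit :: "nat \<Rightarrow> nat" and h :: "nat \<Rightarrow> nat \<Rightarrow> nat"
  assumes "finite Z" "\<And>v. v < n \<Longrightarrow> cl v < k"
    and hit: "\<And>v t. v < n \<Longrightarrow> hit v = Suc t \<Longrightarrow> t \<in> Z \<and> cl t < cl v \<and> (\<forall>q<4. h v q = 0)"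
    and unhit: "\<And>v q. v < n \<Longrightarrow> hit v = 0 \<Longrightarrow> q < 4 \<Longrightarrow> 0 < h v q \<and> h v q \<le> card {x \<in> Z. cl x = cl v}"
  shows "card ((\<lambda>v. (cl v, hit v, h v 0, h v 1, h v 2, h v 3)) ` {..<n}) \<le> (k - 1) * card Z + card Z ^ 4"
proof -
  define m where "m i = card {x \<in> Z. cl x = i}" for i
  define D where "D i = {1..m i}" for i
  define A where "A = (\<lambda>(i, t). (i, Suc t, 0::nat, 0::nat, 0::nat, 0::nat)) ` ({1..<k} \<times> Z)"
  define B where "B = (\<Union>i<k. (\<lambda>(a, b, c, d). (i, 0::nat, a, b, c, d)) ` (D i \<times> D i \<times> D i \<times> D i))"
  have "(cl v, hit v, h v 0, h v 1, h v 2, h v 3) \<in> A \<union> B" if v: "v < n" for v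
  proof (cases "hit v")
    case 0
    have "h v q \<in> D (cl v)" if "q < 4" for q
      using unhit[OF v 0 that] by (simp add: D_def m_def)
    then have "(h v 0, h v 1, h v 2, h v 3) \<in> D (cl v) \<times> D (cl v) \<times> D (cl v) \<times> D (cl v)" by simp
    then show ?thesis using assms(2)[OF v] unfolding B_def 0 by force
  next
    case (Suc t)
    have z: "h v 0 = 0" "h v 1 = 0" "h v 2 = 0" "h v 3 = 0" using hit[OF v Suc] by simp_all
    have "(cl v, t) \<in> {1..<k} \<times> Z" using hit[OF v Suc] assms(2)[OF v] by auto
    then show ?thesis unfolding A_def Suc z by force
  qed
  then have "(\<lambda>v. (cl v, hit v, h v 0, h v 1, h v 2, h v 3)) ` {..<n} \<subseteq> A \<union> B" by blast
  moreover have "finite A" "finite B" unfolding A_def B_def D_def using assms(1) by auto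
  ultimately have "card ((\<lambda>v. (cl v, hit v, h v 0, h v 1, h v 2, h v 3)) ` {..<n}) \<le> card A + card B"
    by (meson card_Un_le card_mono finite_UnI order_trans)
  also have "card A \<le> (k - 1) * card Z"
    unfolding A_def using card_image_le[of "{1..<k} \<times> Z"] assms(1) by (simp add: card_cartesian_product)
  also have "card B \<le> card Z ^ 4"
  proof -
    have "card B \<le> (\<Sum>i<k. card ((\<lambda>(a, b, c, d). (i, 0::nat, a, b, c, d)) ` (D i \<times> D i \<times> D i \<times> D i)))"
      unfolding B_def by (rule card_UN_le) simp
    also have "\<dots> \<le> (\<Sum>i<k. m i ^ 4)"
    proof (rule sum_mono)
      fix i
      have "card (D i \<times> D i \<times> D i \<times> D i) = m i ^ 4"
        by (simp add: card_cartesian_product D_def power4_eq_xxxx)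
      then show "card ((\<lambda>(a, b, c, d). (i, 0::nat, a, b, c, d)) ` (D i \<times> D i \<times> D i \<times> D i)) \<le> m i ^ 4"
        using card_image_le[of "D i \<times> D i \<times> D i \<times> D i"] by (simp add: D_def)
    qed
    also have "\<dots> \<le> (\<Sum>i<k. m i) ^ 4" by (rule sum_power4_le) simp
    also have "(\<Sum>i<k. m i) = card (\<Union>i<k. {x \<in> Z. cl x = i})"
      unfolding m_def by (rule card_UN_disjoint[symmetric]) (use assms(1) in auto)
    also have "\<dots> ^ 4 \<le> card Z ^ 4"
      by (intro power_mono card_mono) (use assms(1) in auto)
    finally show ?thesis .
  qed
  finally show ?thesis by simp
qed

section \<open>The coloring program\<close>

abbreviation Row :: "nexp \<Rightarrow> nexp \<Rightarrow> nexp" where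
  "Row v q \<equiv> NAdd (nmul 4 v) q"

text \<open>Planes are tried in ascending order and later ones overwrite earlier ones, so the last
  plane containing a segment determines its class.\<close>

definition classify :: "bexp \<Rightarrow> com" where
  "classify inB = For PlI (Var NPl) (For VtxV (Var NSeg)
     (Cond inB (put Class (Var VtxV) (Var PlI)) Skip))"

text \<open>
  \<open>Hit\<close> holds \<open>t + 1\<close> for a chosen segment \<open>t\<close> of an earlier class that is met, and \<open>0\<close> if there is none.
\<close>

definition find_hits :: "bexp \<Rightarrow> com" where
  "find_hits meetB = For VtxV (Var NSeg) (Cond (NEq (At Class (Var VtxV)) (Var PlI))
     (For VtxU (Var NSeg)
       (Cond (BAnd (NLess (NLit 0) (At Chosen (Var VtxU))) meetB)
         (put Hit (Var VtxV) (NAdd (Var VtxU) (NLit 1))) Skip))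
     Skip)"

definition Active :: "cell \<Rightarrow> bexp" where
  "Active x = BAnd (NEq (At Class (Var x)) (Var PlI)) (NEq (At Hit (Var x)) (NLit 0))"

text \<open>
  With heights up to \<open>Lev\<close> assigned, \<open>Flag\<close> stays nonzero iff all predecessors of the current
  segment have a height, that is, iff its own height is at most \<open>Lev + 1\<close>. \<open>Pre\<close> is a predecessor of
  height \<open>Lev\<close>.
\<close>

definition scan :: "bexp \<Rightarrow> com" where
  "scan relB = Seq (put Flag (NLit 0) (NLit 1)) (For VtxU (Var NSeg)
     (Cond (BAnd (Active VtxU) relB)
       (Cond (BAnd (NLess (NLit 0) (At Height (Row (Var VtxU) (Var Ord))))
                   (BNot (NLess (Var Lev) (At Height (Row (Var VtxU) (Var Ord))))))
         (Cond (NEq (At Height (Row (Var VtxU) (Var Ord))) (Var Lev)) (put Pre (NLit 0) (Var VtxU)) Skip)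
         (put Flag (NLit 0) (NLit 0)))
       Skip))"

text \<open>\<open>Best\<close> is a running maximum over all four orders, with \<open>Cur\<close>
  and \<open>BestOrd\<close> recording where it is attained. Taking the longest chain over the four
  orders is what bounds every height by its length.\<close>

definition label :: com where
  "label = Seq (put Height (Row (Var VtxV) (Var Ord)) (NAdd (Var Lev) (NLit 1)))
     (Seq (put Pred (Row (Var VtxV) (Var Ord)) (Var Pre))
       (Cond (NLess (Var Best) (NAdd (Var Lev) (NLit 1)))
         (Seq (put Best (NLit 0) (NAdd (Var Lev) (NLit 1)))
           (Seq (put Cur (NLit 0) (Var VtxV)) (put BestOrd (NLit 0) (Var Ord))))
         Skip))"

definition try_label :: "bexp \<Rightarrow> com" where
  "try_label relB =
     Cond (BAnd (Active VtxV) (NEq (At Height (Row (Var VtxV) (Var Ord))) (NLit 0)))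
       (Seq (scan relB) (Cond (NLess (NLit 0) (Var Flag)) label Skip)) Skip"

text \<open>No chain has more than \<open>n\<close> elements, so \<open>n\<close> levels label every
  active segment.\<close>

definition heights :: "bexp \<Rightarrow> com" where
  "heights relB = For Ord (NLit 4) (For Lev (Var NSeg) (For VtxV (Var NSeg) (try_label relB)))"

definition extract_chain :: com where
  "extract_chain = For Lev (Var Best)
     (Seq (put Chosen (Var Cur) (NLit 1))
          (put Cur (NLit 0) (At Pred (Row (Var Cur) (Var BestOrd)))))"

definition process_class :: "bexp \<Rightarrow> bexp \<Rightarrow> com" where
  "process_class meetB relB = Seq (find_hits meetB) (Seq (put Best (NLit 0) (NLit 0))
     (Seq (heights relB) extract_chain))"

definition SameColor :: bexp where
  "SameColor = BAll (NEq (At Class (Var VtxU)) (At Class (Var VtxV)) #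
     NEq (At Hit (Var VtxU)) (At Hit (Var VtxV)) #
     map (\<lambda>q. NEq (At Height (Row (Var VtxU) (NLit q))) (At Height (Row (Var VtxV) (NLit q)))) [0, 1, 2, 3])"

text \<open>\<open>Out\<close> stores colors shifted by one, with zero for undecided. Together with
  the ascending inner loop, the test for zero makes the color the least index with the same
  signature.\<close>

definition choose_colors :: com where
  "choose_colors = For VtxV (Var NSeg) (For VtxU (Var NSeg)
     (Cond (BAnd (NEq (At Out (Var VtxV)) (NLit 0)) SameColor)
       (put Out (Var VtxV) (NAdd (Var VtxU) (NLit 1))) Skip))"

definition copy_chosen :: com where
  "copy_chosen = For VtxV (Var NSeg)
     (put Out (NAdd (Var NSeg) (Var VtxV)) (NAdd (At Chosen (Var VtxV)) (NLit 1)))"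

text \<open>The time bounds keep the shape in which the rules for \<open>For\<close>,
  \<open>Cond\<close> and \<open>Seq\<close> produce them, so that these rules apply without
  arithmetic. All are polynomial in the bound \<open>M\<close> on the loop lengths.\<close>

definition time_classify :: "nat \<Rightarrow> nat" where
  "time_classify M = M * ((M * (Suc 1 + 2) + 2) + 2) + 2"

definition time_find_hits :: "nat \<Rightarrow> nat" where
  "time_find_hits M = M * (Suc (M * (Suc 1 + 2) + 2) + 2) + 2"

definition time_scan :: "nat \<Rightarrow> nat" where
  "time_scan M = 1 + (M * (Suc (Suc (Suc 1)) + 2) + 2)"

definition time_label :: nat where
  "time_label = 1 + (1 + Suc (1 + (1 + 1)))"

definition time_try_label :: "nat \<Rightarrow> nat" where
  "time_try_label M = Suc (time_scan M + Suc time_label)"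

definition time_heights :: "nat \<Rightarrow> nat" where
  "time_heights M = M * ((M * ((M * (time_try_label M + 2) + 2) + 2) + 2) + 2) + 2"

definition time_extract_chain :: "nat \<Rightarrow> nat" where
  "time_extract_chain M = M * ((1 + 1) + 2) + 2"

definition time_process_class :: "nat \<Rightarrow> nat" where
  "time_process_class M = time_find_hits M + (1 + (time_heights M + time_extract_chain M))"

lemma Row_eq_iff: "q < 4 \<Longrightarrow> q' < 4 \<Longrightarrow> 4 * v + q = 4 * v' + q' \<longleftrightarrow> v = v' \<and> q = q'" for v v' q q' :: nat
  by presburger

primrec last_index :: "(nat \<Rightarrow> 'a \<Rightarrow> bool) \<Rightarrow> nat \<Rightarrow> 'a \<Rightarrow> nat" where
  "last_index P 0 v = 0"
| "last_index P (Suc i) v = (if P i v then i else last_index P i v)"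

lemma last_index:
  assumes "P j v" "j < i"
  shows "P (last_index P i v) v" "last_index P i v < i" "j \<le> last_index P i v"
  using assms by (induction i) (auto simp: less_Suc_eq)

text \<open>The interface between geometry and combinatorics: the tests have to be right only when
  the counters are in range, and the remaining assumptions are all that the coloring argument uses
  about planes, intersections and the four orders. \<open>four_le\<close> lets \<open>M\<close>
  bound the loop over the orders as well.\<close>

locale segment_program =
  fixes R :: "nat \<Rightarrow> real" and n k M :: nat and inB meetB relB :: bexp
    and inP :: "nat \<Rightarrow> nat \<Rightarrow> bool" and meets :: "nat \<Rightarrow> nat \<Rightarrow> bool"
    and rel :: "nat \<Rightarrow> nat \<Rightarrow> nat \<Rightarrow> nat \<Rightarrow> bool"
  assumes n_le: "n \<le> M" and k_le: "k \<le> M" and four_le: "4 \<le> M"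
    and inB: "\<And>a. a NSeg 0 = n \<Longrightarrow> a NPl 0 = k \<Longrightarrow> a PlI 0 < k \<Longrightarrow> a VtxV 0 < n \<Longrightarrow>
      bval inB (mem a, R) = inP (a PlI 0) (a VtxV 0)"
    and meetB: "\<And>a. a NSeg 0 = n \<Longrightarrow> a NPl 0 = k \<Longrightarrow> a VtxU 0 < n \<Longrightarrow> a VtxV 0 < n \<Longrightarrow>
      bval meetB (mem a, R) = meets (a VtxU 0) (a VtxV 0)"
    and relB: "\<And>a. a NSeg 0 = n \<Longrightarrow> a NPl 0 = k \<Longrightarrow> a PlI 0 < k \<Longrightarrow> a Ord 0 < 4 \<Longrightarrow> a VtxU 0 < n \<Longrightarrow>
      a VtxV 0 < n \<Longrightarrow> bval relB (mem a, R) = rel (a PlI 0) (a Ord 0) (a VtxU 0) (a VtxV 0)"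
    and covered: "\<And>v. v < n \<Longrightarrow> \<exists>i<k. inP i v"
    and meets_sym: "\<And>u v. meets u v \<Longrightarrow> meets v u"
    and piercing: "\<And>i t u v. t < n \<Longrightarrow> u < n \<Longrightarrow> v < n \<Longrightarrow> i < k \<Longrightarrow> inP i u \<Longrightarrow> inP i v \<Longrightarrow> \<not> inP i t \<Longrightarrow>
      meets t u \<Longrightarrow> meets t v \<Longrightarrow> meets u v"
    and rel_trans: "\<And>i q u v w. u < n \<Longrightarrow> v < n \<Longrightarrow> w < n \<Longrightarrow> rel i q u v \<Longrightarrow> rel i q v w \<Longrightarrow> rel i q u w"
    and rel_irrefl: "\<And>i q u. u < n \<Longrightarrow> \<not> rel i q u u"
    and rel_disjoint: "\<And>i q u v. u < n \<Longrightarrow> v < n \<Longrightarrow> rel i q u v \<Longrightarrow> \<not> meets u v"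
    and rel_comparable: "\<And>i u v. i < k \<Longrightarrow> u < n \<Longrightarrow> v < n \<Longrightarrow> inP i u \<Longrightarrow> inP i v \<Longrightarrow> \<not> meets u v \<Longrightarrow>
      \<exists>q<4. rel i q u v \<or> rel i q v u"
begin

abbreviation cl :: "nat \<Rightarrow> nat" where
  "cl v \<equiv> last_index inP k v"

lemma cl: "v < n \<Longrightarrow> cl v < k" "v < n \<Longrightarrow> inP (cl v) v" "v < n \<Longrightarrow> inP j v \<Longrightarrow> j < k \<Longrightarrow> j \<le> cl v"
  using covered last_index[of inP _ v k] by blast+

lemma wp_classify:
  assumes a: "a NSeg 0 = n" "a NPl 0 = k" "\<forall>v<n. a Class v = 0"
  shows "wp R {PlI, VtxV, Class} (classify inB) (time_classify M) (\<lambda>a'. \<forall>v<n. a' Class v = cl v) a"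
proof -
  have inner: "wp R {VtxV, Class} (For VtxV (Var NSeg) (Cond inB (put Class (Var VtxV) (Var PlI)) Skip))
      (M * (Suc 1 + 2) + 2) (\<lambda>a'. \<forall>v<n. a' Class v = last_index inP (Suc i) v) a"
    if a: "a NSeg 0 = n" "a NPl 0 = k" "a PlI 0 = i" "i < k" "\<forall>v<n. a Class v = last_index inP i v" for a i
  proof (rule wp_For[where N = n and
        I = "\<lambda>w a'. \<forall>v<n. a' Class v = last_index inP (if v < w then Suc i else i) v"])
    fix v a' assume v: "v < n" and fr: "\<And>y. y \<notin> {VtxV, Class} \<Longrightarrow> a' y = a y" and "a' VtxV 0 = v"
      and I: "\<forall>x<n. a' Class x = last_index inP (if x < v then Suc i else i) x"
    moreover have "bval inB (mem a', R) = inP i v" using a v \<open>a' VtxV 0 = v\<close> by (subst inB) (simp_all add: fr)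
    ultimately show "wp R {VtxV, Class} (Cond inB (put Class (Var VtxV) (Var PlI)) Skip) (Suc 1)
        (\<lambda>a''. a'' VtxV 0 = v \<and> (\<forall>x<n. a'' Class x = last_index inP (if x < Suc v then Suc i else i) x)) a'"
      using a by (intro wp_Cond wp_put wp_Skip) (auto simp: less_Suc_eq fr)
  qed (use a n_le in auto)
  show ?thesis unfolding classify_def time_classify_def
  proof (rule wp_For[where N = k and I = "\<lambda>i a'. \<forall>v<n. a' Class v = last_index inP i v"])
    fix i a' assume i: "i < k" and fr: "\<And>y. y \<notin> {PlI, VtxV, Class} \<Longrightarrow> a' y = a y" and "a' PlI 0 = i"
      and I: "\<forall>v<n. a' Class v = last_index inP i v"
    show "wp R {PlI, VtxV, Class} (For VtxV (Var NSeg) (Cond inB (put Class (Var VtxV) (Var PlI)) Skip))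
        (M * (Suc 1 + 2) + 2) (\<lambda>a''. a'' PlI 0 = i \<and> (\<forall>v<n. a'' Class v = last_index inP (Suc i) v)) a'"
      by (rule wp_weaken[OF inner[of a' i]]) (use a i I \<open>a' PlI 0 = i\<close> fr in auto)
  qed (use a k_le in auto)
qed

definition hit_ok :: "(nat \<Rightarrow> nat) \<Rightarrow> nat \<Rightarrow> nat \<Rightarrow> nat \<Rightarrow> bool" where
  "hit_ok Z w h v \<longleftrightarrow> (h = 0 \<longrightarrow> (\<forall>t<w. Z t \<noteq> 0 \<longrightarrow> \<not> meets t v)) \<and> (\<forall>t. h = Suc t \<longrightarrow> Z t \<noteq> 0 \<and> meets t v)"

text \<open>An entry is written only when a chosen segment is met, so the zero that means unhit must
  be present beforehand.\<close>

lemma wp_find_hits: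
  assumes a: "a NSeg 0 = n" "a NPl 0 = k" "a PlI 0 = i"
    and cls: "\<forall>v<n. a Class v = cl v" and hit: "\<forall>v<n. cl v = i \<longrightarrow> a Hit v = 0"
  shows "wp R {VtxV, VtxU, Hit} (find_hits meetB) (time_find_hits M)
    (\<lambda>a'. \<forall>v<n. if cl v = i then hit_ok (a Chosen) n (a' Hit v) v else a' Hit v = a Hit v) a"
proof -
  let ?c = "Cond (BAnd (NLess (NLit 0) (At Chosen (Var VtxU))) meetB)
    (put Hit (Var VtxV) (NAdd (Var VtxU) (NLit 1))) Skip"
  have inner: "wp R {VtxU, Hit} (For VtxU (Var NSeg) ?c) (M * (Suc 1 + 2) + 2)
      (\<lambda>a'. hit_ok (a Chosen) n (a' Hit v) v \<and> (\<forall>x. x \<noteq> v \<longrightarrow> a' Hit x = a Hit x)) a"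
    if a: "a NSeg 0 = n" "a NPl 0 = k" "a VtxV 0 = v" "v < n" "a Hit v = 0" for a v
  proof (rule wp_For[where N = n and
        I = "\<lambda>w a'. hit_ok (a Chosen) w (a' Hit v) v \<and> (\<forall>x. x \<noteq> v \<longrightarrow> a' Hit x = a Hit x)"])
    fix u a' assume u: "u < n" and fr: "\<And>y. y \<notin> {VtxU, Hit} \<Longrightarrow> a' y = a y" and "a' VtxU 0 = u"
      and I: "hit_ok (a Chosen) u (a' Hit v) v \<and> (\<forall>x. x \<noteq> v \<longrightarrow> a' Hit x = a Hit x)"
    moreover have "bval meetB (mem a', R) = meets u v"
      using a u \<open>a' VtxU 0 = u\<close> by (subst meetB) (simp_all add: fr)
    ultimately show "wp R {VtxU, Hit} ?c (Suc 1)
        (\<lambda>a''. a'' VtxU 0 = u \<and> hit_ok (a Chosen) (Suc u) (a'' Hit v) v \<and> (\<forall>x. x \<noteq> v \<longrightarrow> a'' Hit x = a Hit x)) a'"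
      using a by (intro wp_Cond wp_put wp_Skip) (auto simp: less_Suc_eq fr hit_ok_def)
  qed (use a n_le in \<open>auto simp: hit_ok_def\<close>)
  show ?thesis unfolding find_hits_def time_find_hits_def
  proof (rule wp_For[where N = n and I = "\<lambda>w a'. \<forall>v<n. if cl v = i \<and> v < w
        then hit_ok (a Chosen) n (a' Hit v) v else a' Hit v = a Hit v"])
    fix v a' assume v: "v < n" and fr: "\<And>y. y \<notin> {VtxV, VtxU, Hit} \<Longrightarrow> a' y = a y" and "a' VtxV 0 = v"
      and I: "\<forall>x<n. if cl x = i \<and> x < v then hit_ok (a Chosen) n (a' Hit x) x else a' Hit x = a Hit x"
    show "wp R {VtxV, VtxU, Hit} (Cond (NEq (At Class (Var VtxV)) (Var PlI)) (For VtxU (Var NSeg) ?c) Skip)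
        (Suc (M * (Suc 1 + 2) + 2)) (\<lambda>a''. a'' VtxV 0 = v \<and>
          (\<forall>x<n. if cl x = i \<and> x < Suc v then hit_ok (a Chosen) n (a'' Hit x) x else a'' Hit x = a Hit x)) a'"
    proof (rule wp_Cond)
      assume "bval (NEq (At Class (Var VtxV)) (Var PlI)) (mem a', R)"
      then have c: "cl v = i" using a cls v \<open>a' VtxV 0 = v\<close> by (simp add: fr)
      then have h: "a' Hit v = 0" using I hit v by auto
      show "wp R {VtxV, VtxU, Hit} (For VtxU (Var NSeg) ?c) (M * (Suc 1 + 2) + 2)
        (\<lambda>a''. a'' VtxV 0 = v \<and>
          (\<forall>x<n. if cl x = i \<and> x < Suc v then hit_ok (a Chosen) n (a'' Hit x) x else a'' Hit x = a Hit x)) a'"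
      proof (rule wp_weaken[OF inner[of a' v]])
        fix a'' assume fr': "\<And>x. x \<notin> {VtxU, Hit} \<Longrightarrow> a'' x = a' x"
          and Q: "hit_ok (a' Chosen) n (a'' Hit v) v \<and> (\<forall>x. x \<noteq> v \<longrightarrow> a'' Hit x = a' Hit x)"
        have "if cl x = i \<and> x < Suc v then hit_ok (a Chosen) n (a'' Hit x) x else a'' Hit x = a Hit x"
          if "x < n" for x
          using Q I c that fr[of Chosen] by (cases "x = v") (auto simp: less_Suc_eq)
        then show "a'' VtxV 0 = v \<and> (\<forall>x<n. if cl x = i \<and> x < Suc v then hit_ok (a Chosen) n (a'' Hit x) x
            else a'' Hit x = a Hit x)"
          using fr'[of VtxV] \<open>a' VtxV 0 = v\<close> by simp
      qed (use a v h \<open>a' VtxV 0 = v\<close> in \<open>auto simp: fr\<close>)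
    next
      assume "\<not> bval (NEq (At Class (Var VtxV)) (Var PlI)) (mem a', R)"
      then have "cl v \<noteq> i" using a cls v \<open>a' VtxV 0 = v\<close> by (simp add: fr)
      then have "if cl x = i \<and> x < Suc v then hit_ok (a Chosen) n (a' Hit x) x else a' Hit x = a Hit x"
        if "x < n" for x
        using I that by (cases "x = v") (auto simp: less_Suc_eq)
      then show "wp R {VtxV, VtxU, Hit} Skip (M * (Suc 1 + 2) + 2)
        (\<lambda>a''. a'' VtxV 0 = v \<and>
          (\<forall>x<n. if cl x = i \<and> x < Suc v then hit_ok (a Chosen) n (a'' Hit x) x else a'' Hit x = a Hit x)) a'"
        using \<open>a' VtxV 0 = v\<close> by (intro wp_Skip) simp_all
    qed
  qed (use a n_le in auto)
qed

section \<open>Computing heights and a longest chain within one class\<close>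

definition active :: "state \<Rightarrow> nat \<Rightarrow> nat set" where
  "active a i = {v. v < n \<and> a Class v = i \<and> a Hit v = 0}"

text \<open>The claim on \<open>Pre\<close> is conditional, because \<open>Pre\<close> keeps an
  older value if no predecessor has height \<open>L\<close>; this happens for \<open>L = 0\<close>,
  where no predecessor is wanted.\<close>

lemma wp_scan:
  assumes a: "a NSeg 0 = n" "a NPl 0 = k" "a PlI 0 = i" "i < k" "a Ord 0 = q" "q < 4" "a VtxV 0 = v" "v < n"
    "a Lev 0 = L"
  defines "W \<equiv> active a i" and "H \<equiv> \<lambda>u. a Height (4 * u + q)"
  shows "wp R {VtxU, Flag, Pre} (scan relB) (time_scan M) (\<lambda>a'.
    (a' Flag 0 \<noteq> 0 \<longleftrightarrow> (\<forall>u\<in>W. rel i q u v \<longrightarrow> 0 < H u \<and> H u \<le> L)) \<and>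
    ((\<exists>u\<in>W. rel i q u v \<and> 0 < H u \<and> H u = L) \<longrightarrow>
      a' Pre 0 \<in> W \<and> rel i q (a' Pre 0) v \<and> H (a' Pre 0) = L)) a"
  unfolding scan_def time_scan_def
proof (rule wp_Seq, rule wp_put)
  let ?a = "a(Flag := (a Flag)(nval (NLit 0) (mem a, R) := nval (NLit 1) (mem a, R)))"
  let ?I = "\<lambda>w a'. (a' Flag 0 \<noteq> 0 \<longleftrightarrow> (\<forall>u\<in>W. u < w \<longrightarrow> rel i q u v \<longrightarrow> 0 < H u \<and> H u \<le> L)) \<and>
      ((\<exists>u\<in>W. u < w \<and> rel i q u v \<and> 0 < H u \<and> H u = L) \<longrightarrow>
        a' Pre 0 \<in> W \<and> rel i q (a' Pre 0) v \<and> H (a' Pre 0) = L)"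
  let ?c = "Cond (BAnd (Active VtxU) relB)
       (Cond (BAnd (NLess (NLit 0) (At Height (Row (Var VtxU) (Var Ord))))
                   (BNot (NLess (Var Lev) (At Height (Row (Var VtxU) (Var Ord))))))
         (Cond (NEq (At Height (Row (Var VtxU) (Var Ord))) (Var Lev)) (put Pre (NLit 0) (Var VtxU)) Skip)
         (put Flag (NLit 0) (NLit 0)))
       Skip"
  show "wp R {VtxU, Flag, Pre} (For VtxU (Var NSeg) ?c) (M * (Suc (Suc (Suc 1)) + 2) + 2) (\<lambda>a'.
    (a' Flag 0 \<noteq> 0 \<longleftrightarrow> (\<forall>u\<in>W. rel i q u v \<longrightarrow> 0 < H u \<and> H u \<le> L)) \<and>
    ((\<exists>u\<in>W. rel i q u v \<and> 0 < H u \<and> H u = L) \<longrightarrow>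
      a' Pre 0 \<in> W \<and> rel i q (a' Pre 0) v \<and> H (a' Pre 0) = L)) ?a"
  proof (rule wp_For[where N = n and I = ?I])
    fix u a' assume u: "u < n" and fr: "\<And>y. y \<notin> {VtxU, Flag, Pre} \<Longrightarrow> a' y = ?a y" and au: "a' VtxU 0 = u"
      and I: "?I u a'"
    have r: "bval relB (mem a', R) = rel i q u v"
      using a u au by (subst relB) (simp_all add: fr)
    have W: "a' Class u = i \<and> a' Hit u = 0 \<longleftrightarrow> u \<in> W"
      using u by (simp add: W_def active_def fr)
    have H: "a' Height (4 * u + q) = H u" by (simp add: H_def fr)
    show "wp R {VtxU, Flag, Pre} ?c (Suc (Suc (Suc 1))) (\<lambda>a''. a'' VtxU 0 = u \<and> ?I (Suc u) a'') a'"
    proof (rule wp_Cond)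
      assume "bval (BAnd (Active VtxU) relB) (mem a', R)"
      then have u': "u \<in> W" "rel i q u v" using W r a au by (auto simp: Active_def fr)
      show "wp R {VtxU, Flag, Pre} (Cond (BAnd (NLess (NLit 0) (At Height (Row (Var VtxU) (Var Ord))))
                   (BNot (NLess (Var Lev) (At Height (Row (Var VtxU) (Var Ord))))))
         (Cond (NEq (At Height (Row (Var VtxU) (Var Ord))) (Var Lev)) (put Pre (NLit 0) (Var VtxU)) Skip)
         (put Flag (NLit 0) (NLit 0))) (Suc (Suc 1)) (\<lambda>a''. a'' VtxU 0 = u \<and> ?I (Suc u) a'') a'"
      proof (intro wp_Cond wp_put wp_Skip)
      qed (use u' I H a au in \<open>auto simp: less_Suc_eq fr\<close>)
    next
      assume "\<not> bval (BAnd (Active VtxU) relB) (mem a', R)"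
      then have "\<not> (u \<in> W \<and> rel i q u v)" using W r a au by (auto simp: Active_def fr)
      then show "wp R {VtxU, Flag, Pre} Skip (Suc (Suc 1)) (\<lambda>a''. a'' VtxU 0 = u \<and> ?I (Suc u) a'') a'"
        using I au by (intro wp_Skip) (auto simp: less_Suc_eq)
    qed
  next
    fix a' assume "?I n a'"
    then show "(a' Flag 0 \<noteq> 0 \<longleftrightarrow> (\<forall>u\<in>W. rel i q u v \<longrightarrow> 0 < H u \<and> H u \<le> L)) \<and>
      ((\<exists>u\<in>W. rel i q u v \<and> 0 < H u \<and> H u = L) \<longrightarrow>
        a' Pre 0 \<in> W \<and> rel i q (a' Pre 0) v \<and> H (a' Pre 0) = L)"
      unfolding W_def active_def by blast
  qed (use a n_le in auto)
qed auto

text \<open>\<open>ht\<close> occurs in specifications only: it gives the true heights with which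
  the program state is compared. The bound \<open>n\<close> limits the number of levels.\<close>

definition heights_ok :: "nat \<Rightarrow> nat set \<Rightarrow> (nat \<Rightarrow> nat \<Rightarrow> nat) \<Rightarrow> bool" where
  "heights_ok i W ht \<longleftrightarrow> (\<forall>q<4. \<forall>v\<in>W. 0 < ht q v \<and> ht q v \<le> n \<and>
     (\<forall>l. ht q v \<le> Suc l \<longleftrightarrow> (\<forall>u\<in>W. rel i q u v \<longrightarrow> ht q u \<le> l)))"

lemma heights_ok_exists:
  assumes "W \<subseteq> {..<n}"
  obtains ht where "heights_ok i W ht"
proof -
  have fin: "finite W" using assms finite_subset by blast
  have c: "card W \<le> n" using card_mono[OF _ assms] by simp
  have "\<exists>h. \<forall>v\<in>W. 0 < h v \<and> h v \<le> n \<and> (\<forall>l. h v \<le> Suc l \<longleftrightarrow> (\<forall>u\<in>W. rel i q u v \<longrightarrow> h u \<le> l))" for q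
  proof -
    have trans: "rel i q x z" if "x \<in> W" "y \<in> W" "z \<in> W" "rel i q x y" "rel i q y z" for x y z
      using rel_trans[of x y z] that assms by blast
    have irrefl: "\<not> rel i q x x" if "x \<in> W" for x
      using rel_irrefl that assms by blast
    show ?thesis
    proof (rule height_function_exists[OF fin, of "rel i q", OF trans irrefl])
      fix h assume h: "\<And>v. v \<in> W \<Longrightarrow> 0 < h v" "\<And>v. v \<in> W \<Longrightarrow> h v \<le> card W"
        "\<And>v l. v \<in> W \<Longrightarrow> h v \<le> Suc l \<longleftrightarrow> (\<forall>u\<in>W. rel i q u v \<longrightarrow> h u \<le> l)"
      have "h v \<le> n" if "v \<in> W" for v using h(2)[OF that] c by simp
      with h(1,3) show ?thesis by blast
    qed
  qed
  then have "\<exists>ht. \<forall>q. \<forall>v\<in>W. 0 < ht q v \<and> ht q v \<le> n \<and>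
      (\<forall>l. ht q v \<le> Suc l \<longleftrightarrow> (\<forall>u\<in>W. rel i q u v \<longrightarrow> ht q u \<le> l))"
    by (intro choice allI)
  then show ?thesis using that unfolding heights_ok_def by blast
qed

text \<open>\<open>Lab\<close> tells which pairs of order and segment have been labelled. Heights
  outside \<open>W\<close> are pinned to a snapshot \<open>H0\<close>, so that finished classes
  survive. Predecessor links are demanded only above height one, where the walk along the chain
  follows them.\<close>

definition labelled :: "nat \<Rightarrow> nat set \<Rightarrow> (nat \<Rightarrow> nat \<Rightarrow> nat) \<Rightarrow> (nat \<Rightarrow> nat) \<Rightarrow> (nat \<Rightarrow> nat \<Rightarrow> bool) \<Rightarrow> state \<Rightarrow> bool" where
  "labelled i W ht H0 Lab a \<longleftrightarrow>
     (\<forall>v<n. v \<notin> W \<longrightarrow> (\<forall>q<4. a Height (4 * v + q) = H0 (4 * v + q))) \<and>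
     (\<forall>v\<in>W. \<forall>q<4. a Height (4 * v + q) = (if Lab q v then ht q v else 0)) \<and>
     (\<forall>v\<in>W. \<forall>q<4. Lab q v \<longrightarrow> 1 < ht q v \<longrightarrow> a Pred (4 * v + q) \<in> W \<and>
        rel i q (a Pred (4 * v + q)) v \<and> Suc (ht q (a Pred (4 * v + q))) = ht q v) \<and>
     (\<forall>v\<in>W. \<forall>q<4. Lab q v \<longrightarrow> ht q v \<le> a Best 0) \<and>
     (0 < a Best 0 \<longrightarrow> a Cur 0 \<in> W \<and> a BestOrd 0 < 4 \<and> Lab (a BestOrd 0) (a Cur 0) \<and>
        ht (a BestOrd 0) (a Cur 0) = a Best 0)"

text \<open>\<open>Lab\<close> matters only on \<open>W\<close> and for orders below
  \<open>4\<close>; this identifies the descriptions of progress at the end of one loop and at the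
  start of the next.\<close>

lemma labelled_cong:
  assumes "\<And>q v. q < 4 \<Longrightarrow> v \<in> W \<Longrightarrow> Lab q v \<longleftrightarrow> Lab' q v"
    and "\<And>c. c \<in> {Height, Pred, Best, Cur, BestOrd} \<Longrightarrow> a' c = a c"
  shows "labelled i W ht H0 Lab a \<longleftrightarrow> labelled i W ht H0 Lab' a'"
  unfolding labelled_def using assms by (simp cong: conj_cong)

lemma labelled_insert:
  assumes lab: "labelled i W ht H0 Lab a" and v: "v \<in> W" "v < n" "q < 4" and ht: "ht q v = Suc L"
    and pre: "0 < L \<Longrightarrow> p \<in> W \<and> rel i q p v \<and> ht q p = L"
    and H: "a' Height = (a Height)(4 * v + q := Suc L)" and P: "a' Pred = (a Pred)(4 * v + q := p)"
    and B: "if a Best 0 < Suc L then a' Best 0 = Suc L \<and> a' Cur 0 = v \<and> a' BestOrd 0 = q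
      else a' Best 0 = a Best 0 \<and> a' Cur 0 = a Cur 0 \<and> a' BestOrd 0 = a BestOrd 0"
  shows "labelled i W ht H0 (\<lambda>q' v'. Lab q' v' \<or> q' = q \<and> v' = v) a'"
proof -
  have r: "4 * v' + q' = 4 * v + q \<longleftrightarrow> v' = v \<and> q' = q" if "q' < 4" for v' q'
    using Row_eq_iff that v(3) by blast
  show ?thesis unfolding labelled_def
  proof (intro conjI ballI allI impI)
    fix v' q' assume h: "v' < n" "v' \<notin> W" "q' < (4::nat)"
    then show "a' Height (4 * v' + q') = H0 (4 * v' + q')"
      using lab v(1) unfolding labelled_def H by (auto simp: r)
  next
    fix v' q' assume h: "v' \<in> W" "q' < (4::nat)"
    then show "a' Height (4 * v' + q') = (if Lab q' v' \<or> q' = q \<and> v' = v then ht q' v' else 0)"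
      using lab ht unfolding labelled_def H by (auto simp: r)
    assume l: "Lab q' v' \<or> q' = q \<and> v' = v"
    show "ht q' v' \<le> a' Best 0"
      using l h lab B ht unfolding labelled_def by (fastforce split: if_splits)
    assume l': "1 < ht q' v'"
    have "a' Pred (4 * v' + q') \<in> W \<and> rel i q' (a' Pred (4 * v' + q')) v' \<and>
        Suc (ht q' (a' Pred (4 * v' + q'))) = ht q' v'"
    proof (cases "v' = v \<and> q' = q")
      case True
      with l' ht have "0 < L" by simp
      from pre[OF this] True ht show ?thesis unfolding P by simp
    next
      case False
      then have "a' Pred (4 * v' + q') = a Pred (4 * v' + q')" "Lab q' v'"
        using r[OF h(2)] l unfolding P by auto
      then show ?thesis using lab l' h unfolding labelled_def by simp
    qed
    then show "a' Pred (4 * v' + q') \<in> W" "rel i q' (a' Pred (4 * v' + q')) v'"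
      "Suc (ht q' (a' Pred (4 * v' + q'))) = ht q' v'" by auto
  next
    assume "0 < a' Best 0"
    then have "a' Cur 0 \<in> W \<and> a' BestOrd 0 < 4 \<and> (Lab (a' BestOrd 0) (a' Cur 0) \<or> a' BestOrd 0 = q \<and> a' Cur 0 = v) \<and>
        ht (a' BestOrd 0) (a' Cur 0) = a' Best 0"
      using lab v ht B unfolding labelled_def by (auto split: if_splits)
    then show "a' Cur 0 \<in> W" "a' BestOrd 0 < 4" "Lab (a' BestOrd 0) (a' Cur 0) \<or> a' BestOrd 0 = q \<and> a' Cur 0 = v"
      "ht (a' BestOrd 0) (a' Cur 0) = a' Best 0" by auto
  qed
qed

text \<open>
  The labels assigned when order \<open>q\<close>, level \<open>L + 1\<close> and segment \<open>w\<close> are about to be treated.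
\<close>

definition progress :: "(nat \<Rightarrow> nat \<Rightarrow> nat) \<Rightarrow> nat \<Rightarrow> nat \<Rightarrow> nat \<Rightarrow> nat \<Rightarrow> nat \<Rightarrow> bool" where
  "progress ht q L w q' v \<longleftrightarrow> q' < q \<or> q' = q \<and> (ht q v \<le> L \<or> ht q v = Suc L \<and> v < w)"

lemma wp_try_label:
  assumes a: "a NSeg 0 = n" "a NPl 0 = k" "a PlI 0 = i" "i < k" "a Ord 0 = q" "q < 4" "a VtxV 0 = v" "v < n"
    "a Lev 0 = L" and W: "active a i = W" and ht: "heights_ok i W ht"
    and lab: "labelled i W ht H0 (progress ht q L v) a"
  shows "wp R {VtxU, Flag, Pre, Height, Pred, Best, Cur, BestOrd} (try_label relB) (time_try_label M)
    (labelled i W ht H0 (progress ht q L (Suc v))) a"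
  unfolding try_label_def time_try_label_def
proof (rule wp_Cond)
  let ?X = "{VtxU, Flag, Pre, Height, Pred, Best, Cur, BestOrd}"
  let ?H = "\<lambda>u. a Height (4 * u + q)"
  have H: "?H u = (if progress ht q L v q u then ht q u else 0)" if "u \<in> W" for u
    using lab a(6) that unfolding labelled_def by blast
  have pos: "0 < ht q u" if "u \<in> W" for u using ht a(6) that unfolding heights_ok_def by blast
  have step: "ht q u \<le> Suc l \<longleftrightarrow> (\<forall>x\<in>W. rel i q x u \<longrightarrow> ht q x \<le> l)" if "u \<in> W" for u l
    using ht a(6) that unfolding heights_ok_def by blast
  {
    assume "bval (BAnd (Active VtxV) (NEq (At Height (Row (Var VtxV) (Var Ord))) (NLit 0))) (mem a, R)"
    then have v: "v \<in> W" "?H v = 0" using a unfolding W[symmetric] active_def by (auto simp: Active_def)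
    \<comment> \<open>An unlabelled segment has height above \<open>L\<close>, since heights up to
      \<open>L\<close> were assigned at earlier levels.\<close>
    then have L: "L < ht q v" using H[OF v(1)] pos[OF v(1)] by (auto simp: progress_def split: if_splits)
    show "wp R ?X (Seq (scan relB) (Cond (NLess (NLit 0) (Var Flag)) label Skip)) (time_scan M + Suc time_label)
        (labelled i W ht H0 (progress ht q L (Suc v))) a"
    proof (rule wp_Seq, rule wp_weaken[OF wp_scan[where a = a, OF a, unfolded W]])
      fix a1 assume fr: "\<And>x. x \<notin> {VtxU, Flag, Pre} \<Longrightarrow> a1 x = a x"
        and s: "(a1 Flag 0 \<noteq> 0 \<longleftrightarrow> (\<forall>u\<in>W. rel i q u v \<longrightarrow> 0 < ?H u \<and> ?H u \<le> L)) \<and>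
          ((\<exists>u\<in>W. rel i q u v \<and> 0 < ?H u \<and> ?H u = L) \<longrightarrow>
            a1 Pre 0 \<in> W \<and> rel i q (a1 Pre 0) v \<and> ?H (a1 Pre 0) = L)"
      \<comment> \<open>Labels of order \<open>q\<close> are at most \<open>L + 1\<close>, those
        equal to \<open>L + 1\<close> stemming from the current level; a label between
        \<open>1\<close> and \<open>L\<close> thus recognises a true height up to
        \<open>L\<close>.\<close>
      have "0 < ?H u \<and> ?H u \<le> L \<longleftrightarrow> ht q u \<le> L" if "u \<in> W" for u
        using H[OF that] pos[OF that] by (auto simp: progress_def)
      then have "a1 Flag 0 \<noteq> 0 \<longleftrightarrow> (\<forall>u\<in>W. rel i q u v \<longrightarrow> ht q u \<le> L)" using s by blast
      then have flag: "a1 Flag 0 \<noteq> 0 \<longleftrightarrow> ht q v \<le> Suc L" using step[OF v(1)] by blast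
      show "wp R ?X (Cond (NLess (NLit 0) (Var Flag)) label Skip) (Suc time_label)
          (labelled i W ht H0 (progress ht q L (Suc v))) a1"
      proof (rule wp_Cond)
        assume "bval (NLess (NLit 0) (Var Flag)) (mem a1, R)"
        then have htv: "ht q v = Suc L" using flag L by simp
        have pre: "a1 Pre 0 \<in> W \<and> rel i q (a1 Pre 0) v \<and> ht q (a1 Pre 0) = L" if "0 < L"
        proof -
          \<comment> \<open>As the height of \<open>v\<close> exceeds \<open>L\<close>, some
            predecessor has height at least \<open>L\<close>; as it is at most \<open>L + 1\<close>,
            none has more.\<close>
          obtain l where l: "L = Suc l" using \<open>0 < L\<close> gr0_implies_Suc by blast
          then have "\<not> ht q v \<le> Suc l" using htv by simp
          then obtain u where u: "u \<in> W" "rel i q u v" "l < ht q u" using step[OF v(1)] by (meson not_le)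
          then have "ht q u = L" using htv step[OF v(1), of L] l by fastforce
          then have "?H u = L" using H[OF u(1)] by (simp add: progress_def)
          then have p: "a1 Pre 0 \<in> W \<and> rel i q (a1 Pre 0) v \<and> ?H (a1 Pre 0) = L" using s u \<open>0 < L\<close> by blast
          then have "ht q (a1 Pre 0) = L" using H[of "a1 Pre 0"] \<open>0 < L\<close> by (auto split: if_splits)
          with p show ?thesis by blast
        qed
        have lab1: "labelled i W ht H0 (progress ht q L v) a1"
          using lab by (subst labelled_cong[where a' = a and Lab' = "progress ht q L v"]) (auto simp: fr)
        have fin: "labelled i W ht H0 (progress ht q L (Suc v)) a'"
          if "a' Height = (a1 Height)(4 * v + q := Suc L)" "a' Pred = (a1 Pred)(4 * v + q := a1 Pre 0)"
            "if a1 Best 0 < Suc L then a' Best 0 = Suc L \<and> a' Cur 0 = v \<and> a' BestOrd 0 = q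
              else a' Best 0 = a1 Best 0 \<and> a' Cur 0 = a1 Cur 0 \<and> a' BestOrd 0 = a1 BestOrd 0" for a'
          using labelled_insert[OF lab1 v(1) a(8,6) htv pre that]
          by (subst labelled_cong[where a' = a' and Lab' = "\<lambda>q' v'. progress ht q L v q' v' \<or> q' = q \<and> v' = v"])
            (auto simp: progress_def htv)
        show "wp R ?X label time_label (labelled i W ht H0 (progress ht q L (Suc v))) a1"
          unfolding label_def time_label_def
          by (intro wp_Seq wp_put wp_Cond wp_Skip fin) (use a in \<open>simp_all add: fr\<close>)
      next
        assume "\<not> bval (NLess (NLit 0) (Var Flag)) (mem a1, R)"
        then have "Suc L < ht q v" using flag by simp
        then have "labelled i W ht H0 (progress ht q L (Suc v)) a1"
          using lab by (subst labelled_cong[where a' = a and Lab' = "progress ht q L v"])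
            (auto simp: fr progress_def less_Suc_eq)
        then show "wp R ?X Skip time_label (labelled i W ht H0 (progress ht q L (Suc v))) a1"
          by (intro wp_Skip) (simp_all add: time_label_def)
      qed
    qed auto
  }
  {
    assume "\<not> bval (BAnd (Active VtxV) (NEq (At Height (Row (Var VtxV) (Var Ord))) (NLit 0))) (mem a, R)"
    then have "v \<in> W \<Longrightarrow> ?H v \<noteq> 0" using a unfolding W[symmetric] active_def by (auto simp: Active_def)
    then have "v \<in> W \<Longrightarrow> progress ht q L v q v" using H[of v] by (auto split: if_splits)
    then have "labelled i W ht H0 (progress ht q L (Suc v)) a"
      using lab by (subst labelled_cong[where a' = a and Lab' = "progress ht q L v"])
        (auto simp: progress_def less_Suc_eq)
    then show "wp R ?X Skip (time_scan M + Suc time_label) (labelled i W ht H0 (progress ht q L (Suc v))) a"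
      by (intro wp_Skip) (simp_all add: time_scan_def)
  }
qed

lemma labelled_upd:
  "c \<notin> {Height, Pred, Best, Cur, BestOrd} \<Longrightarrow> labelled i W ht H0 Lab (a(c := z)) = labelled i W ht H0 Lab a"
  by (rule labelled_cong) auto

lemma wp_heights:
  assumes a: "a NSeg 0 = n" "a NPl 0 = k" "a PlI 0 = i" "i < k" and W: "active a i = W"
    and ht: "heights_ok i W ht" and zero: "a Best 0 = 0" "\<forall>v\<in>W. \<forall>q<4. a Height (4 * v + q) = 0"
  shows "wp R {Ord, Lev, VtxV, VtxU, Flag, Pre, Height, Pred, Best, Cur, BestOrd} (heights relB) (time_heights M)
    (labelled i W ht (a Height) (\<lambda>_ _. True)) a"
proof -
  let ?lab = "labelled i W ht (a Height)"
  have htn: "0 < ht q v" "ht q v \<le> n" if "q < 4" "v \<in> W" for q v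
    using ht that unfolding heights_ok_def by blast+
  have Wn: "v < n" if "v \<in> W" for v using that W unfolding active_def by blast
  have vertices: "wp R {VtxV, VtxU, Flag, Pre, Height, Pred, Best, Cur, BestOrd}
      (For VtxV (Var NSeg) (try_label relB)) (M * (time_try_label M + 2) + 2)
      (?lab (progress ht q (Suc L) 0)) b"
    if b: "b NSeg 0 = n" "b NPl 0 = k" "b PlI 0 = i" "b Ord 0 = q" "b Lev 0 = L" "active b i = W" and q: "q < 4"
      and lab: "?lab (progress ht q L 0) b" for b q L
  proof (rule wp_For[where N = n and I = "\<lambda>v. ?lab (progress ht q L v)"])
    fix v b' assume v: "v < n" and lab': "?lab (progress ht q L v) b'"
      and fr: "\<And>y. y \<notin> {VtxV, VtxU, Flag, Pre, Height, Pred, Best, Cur, BestOrd} \<Longrightarrow> b' y = b y"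
      and bv: "b' VtxV 0 = v"
    have "active b' i = W" using b(6) by (simp add: active_def fr)
    then have "wp R {VtxU, Flag, Pre, Height, Pred, Best, Cur, BestOrd} (try_label relB) (time_try_label M)
        (?lab (progress ht q L (Suc v))) b'"
      by (intro wp_try_label[where v = v]) (use b a(4) v q lab' ht bv in \<open>simp_all add: fr\<close>)
    then show "wp R {VtxV, VtxU, Flag, Pre, Height, Pred, Best, Cur, BestOrd} (try_label relB) (time_try_label M)
        (\<lambda>b''. b'' VtxV 0 = v \<and> ?lab (progress ht q L (Suc v)) b'') b'"
      by (rule wp_weaken) (use bv in auto)
  next
    fix b' assume "?lab (progress ht q L n) b'"
    \<comment> \<open>All segments of \<open>W\<close> have an index below \<open>n\<close>, so
      level \<open>L + 1\<close> is complete.\<close>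
    then show "?lab (progress ht q (Suc L) 0) b'"
      by (subst labelled_cong[where a' = b' and Lab' = "progress ht q L n"]) (auto simp: progress_def dest: Wn)
  qed (use b n_le lab in \<open>auto simp: labelled_upd\<close>)
  have levels: "wp R {Lev, VtxV, VtxU, Flag, Pre, Height, Pred, Best, Cur, BestOrd}
      (For Lev (Var NSeg) (For VtxV (Var NSeg) (try_label relB)))
      (M * ((M * (time_try_label M + 2) + 2) + 2) + 2) (?lab (progress ht (Suc q) 0 0)) b"
    if b: "b NSeg 0 = n" "b NPl 0 = k" "b PlI 0 = i" "b Ord 0 = q" "active b i = W" and q: "q < 4"
      and lab: "?lab (progress ht q 0 0) b" for b q
  proof (rule wp_For[where N = n and I = "\<lambda>L. ?lab (progress ht q L 0)"])
    fix L b' assume L: "L < n" and lab': "?lab (progress ht q L 0) b'"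
      and fr: "\<And>y. y \<notin> {Lev, VtxV, VtxU, Flag, Pre, Height, Pred, Best, Cur, BestOrd} \<Longrightarrow> b' y = b y"
      and bL: "b' Lev 0 = L"
    have "active b' i = W" using b(5) by (simp add: active_def fr)
    then show "wp R {Lev, VtxV, VtxU, Flag, Pre, Height, Pred, Best, Cur, BestOrd}
        (For VtxV (Var NSeg) (try_label relB)) (M * (time_try_label M + 2) + 2)
        (\<lambda>b''. b'' Lev 0 = L \<and> ?lab (progress ht q (Suc L) 0) b'') b'"
      by (intro wp_weaken[OF vertices[where b = b' and q = q and L = L]]) (use b q lab' bL fr in auto)
  next
    \<comment> \<open>After \<open>n\<close> levels, order \<open>q\<close> is fully labelled
      because heights are at most \<open>n\<close>; nothing of order \<open>q + 1\<close> is,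
      because heights are positive.\<close>
    have eq: "progress ht (Suc q) 0 0 q' v \<longleftrightarrow> progress ht q n 0 q' v" if "q' < 4" "v \<in> W" for q' v
      using htn[OF q that(2)] htn[OF that] by (auto simp: progress_def less_Suc_eq)
    show "?lab (progress ht (Suc q) 0 0) b'" if "?lab (progress ht q n 0) b'" for b'
      using that by (subst labelled_cong[where a' = b' and Lab' = "progress ht q n 0"]) (auto simp: eq)
  qed (use b n_le lab in \<open>auto simp: labelled_upd\<close>)
  have init: "?lab (progress ht 0 0 0) a"
  proof -
    have "\<not> progress ht 0 0 0 q v" if "q < 4" "v \<in> W" for q v
      using htn(1)[of 0 v] that by (auto simp: progress_def)
    then show ?thesis unfolding labelled_def using zero by simp
  qed
  show ?thesis unfolding heights_def time_heights_def
  proof (rule wp_For[where N = 4 and I = "\<lambda>q. ?lab (progress ht q 0 0)"])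
    fix q b assume q: "q < 4" and lab: "?lab (progress ht q 0 0) b"
      and fr: "\<And>y. y \<notin> {Ord, Lev, VtxV, VtxU, Flag, Pre, Height, Pred, Best, Cur, BestOrd} \<Longrightarrow> b y = a y"
      and bq: "b Ord 0 = q"
    have "active b i = W" using W by (simp add: active_def fr)
    then show "wp R {Ord, Lev, VtxV, VtxU, Flag, Pre, Height, Pred, Best, Cur, BestOrd}
        (For Lev (Var NSeg) (For VtxV (Var NSeg) (try_label relB)))
        (M * ((M * (time_try_label M + 2) + 2) + 2) + 2)
        (\<lambda>b'. b' Ord 0 = q \<and> ?lab (progress ht (Suc q) 0 0) b') b"
      by (intro wp_weaken[OF levels[where b = b and q = q]]) (use a q lab bq fr in auto)
  next
    fix b assume "?lab (progress ht 4 0 0) b"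
    then show "?lab (\<lambda>_ _. True) b"
      by (subst labelled_cong[where a' = b and Lab' = "progress ht 4 0 0"]) (auto simp: progress_def)
  qed (use init four_le in \<open>auto simp: labelled_upd\<close>)
qed

text \<open>After \<open>s\<close> rounds with \<open>s < B\<close>, the current segment has height
  \<open>B - s\<close> and precedes all collected ones. Hence the walk yields exactly
  \<open>B\<close> distinct, pairwise comparable segments, and these are pairwise disjoint.\<close>

lemma wp_extract_chain:
  assumes lab: "labelled i W ht H0 (\<lambda>_ _. True) a" and W: "W \<subseteq> {..<n}" and ht: "heights_ok i W ht"
  shows "wp R {Lev, Chosen, Cur} extract_chain (time_extract_chain M)
    (\<lambda>a'. \<exists>C. C \<subseteq> W \<and> card C = a Best 0 \<and> (\<forall>x\<in>C. \<forall>y\<in>C. x \<noteq> y \<longrightarrow> \<not> meets x y) \<and>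
      (\<forall>x. a' Chosen x \<noteq> 0 \<longleftrightarrow> a Chosen x \<noteq> 0 \<or> x \<in> C)) a"
proof -
  define q B where "q = a BestOrd 0" and "B = a Best 0"
  have best: "0 < B \<Longrightarrow> a Cur 0 \<in> W \<and> q < 4 \<and> ht q (a Cur 0) = B"
    using lab unfolding labelled_def q_def B_def by auto
  have pred: "a Pred (4 * v + q) \<in> W \<and> rel i q (a Pred (4 * v + q)) v \<and> Suc (ht q (a Pred (4 * v + q))) = ht q v"
    if "v \<in> W" "1 < ht q v" "q < 4" for v
    using lab that unfolding labelled_def by auto
  \<comment> \<open>The number of rounds is zero or a height, hence at most
    \<open>n\<close>.\<close>
  have BM: "B \<le> M"
  proof (cases "B = 0")
    case False
    then have "a Cur 0 \<in> W" "q < 4" "ht q (a Cur 0) = B" using best by auto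
    then have "B \<le> n" using ht unfolding heights_ok_def by blast
    then show ?thesis using n_le by simp
  qed simp
  let ?I = "\<lambda>s a'. \<exists>C. C \<subseteq> W \<and> card C = s \<and> (\<forall>x\<in>C. \<forall>y\<in>C. x \<noteq> y \<longrightarrow> \<not> meets x y) \<and>
      (\<forall>x. a' Chosen x \<noteq> 0 \<longleftrightarrow> a Chosen x \<noteq> 0 \<or> x \<in> C) \<and>
      (s < B \<longrightarrow> a' Cur 0 \<in> W \<and> ht q (a' Cur 0) = B - s \<and> (\<forall>x\<in>C. rel i q (a' Cur 0) x))"
  show ?thesis unfolding extract_chain_def time_extract_chain_def
  proof (rule wp_For[where N = B and I = ?I])
    fix s a' assume s: "s < B" and fr: "\<And>y. y \<notin> {Lev, Chosen, Cur} \<Longrightarrow> a' y = a y" and as: "a' Lev 0 = s"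
      and "?I s a'"
    then obtain C where C: "C \<subseteq> W" "card C = s" "\<forall>x\<in>C. \<forall>y\<in>C. x \<noteq> y \<longrightarrow> \<not> meets x y"
      "\<forall>x. a' Chosen x \<noteq> 0 \<longleftrightarrow> a Chosen x \<noteq> 0 \<or> x \<in> C"
      "a' Cur 0 \<in> W" "ht q (a' Cur 0) = B - s" "\<forall>x\<in>C. rel i q (a' Cur 0) x" by blast
    define c p where "c = a' Cur 0" and "p = a Pred (4 * c + q)"
    have q: "q < 4" using best s by auto
    have n: "x < n" if "x \<in> W" for x using that W by blast
    have c: "c \<in> W" "\<forall>x\<in>C. rel i q c x" "ht q c = B - s" using C by (auto simp: c_def)
    have "c \<notin> C" using c rel_irrefl n by blast
    have fin: "finite C" using finite_subset[OF subset_trans[OF C(1) W]] by simp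
    have 1: "insert c C \<subseteq> W" "card (insert c C) = Suc s" using C c \<open>c \<notin> C\<close> fin by auto
    have disj: "\<not> meets c x \<and> \<not> meets x c" if "x \<in> C" for x
    proof -
      have "\<not> meets c x" using rel_disjoint[of c x i q] c that n C(1) by blast
      then show ?thesis using meets_sym by blast
    qed
    have 2: "\<forall>x\<in>insert c C. \<forall>y\<in>insert c C. x \<noteq> y \<longrightarrow> \<not> meets x y" using C(3) disj by blast
    have 3: "p \<in> W \<and> ht q p = B - Suc s \<and> (\<forall>x\<in>insert c C. rel i q p x)" if "Suc s < B"
    proof -
      have "1 < ht q c" using c that by simp
      from pred[OF c(1) this q] have p: "p \<in> W" "rel i q p c" "Suc (ht q p) = ht q c" by (auto simp: p_def)
      moreover have "rel i q p x" if "x \<in> C" for x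
        using rel_trans[of p c x i q] p c that n C(1) by blast
      ultimately show ?thesis using c(3) by auto
    qed
    show "wp R {Lev, Chosen, Cur} (Seq (put Chosen (Var Cur) (NLit 1))
          (put Cur (NLit 0) (At Pred (Row (Var Cur) (Var BestOrd))))) (1 + 1)
        (\<lambda>a''. a'' Lev 0 = s \<and> ?I (Suc s) a'') a'"
    proof (intro wp_Seq wp_put conjI exI[of _ "insert c C"])
    qed (use 1 2 3 C(4) as in \<open>auto simp: fr c_def p_def q_def\<close>)
  next
    show "?I 0 a" by (rule exI[of _ "{}"]) (use best in auto)
  next
    fix a' assume "?I B a'"
    then show "\<exists>C. C \<subseteq> W \<and> card C = a Best 0 \<and> (\<forall>x\<in>C. \<forall>y\<in>C. x \<noteq> y \<longrightarrow> \<not> meets x y) \<and>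
      (\<forall>x. a' Chosen x \<noteq> 0 \<longleftrightarrow> a Chosen x \<noteq> 0 \<or> x \<in> C)" unfolding B_def by blast
  qed (use BM in \<open>auto simp: B_def\<close>)
qed

text \<open>Classes below \<open>i\<close> are finished, while hits and heights of the others still
  hold the initial zeros. Hit segments keep height \<open>0\<close>, so that their signature is
  determined by class and hitting segment. Strict growth of heights along the orders later separates
  disjoint unhit segments; bounding the heights by the chosen part of the class yields the fourth
  power.\<close>

definition processed :: "nat \<Rightarrow> state \<Rightarrow> bool" where
  "processed i a \<longleftrightarrow>
     (\<forall>v<n. a Class v = cl v) \<and>
     (\<forall>v. a Chosen v \<noteq> 0 \<longrightarrow> v < n \<and> cl v < i) \<and>
     (\<forall>u v. a Chosen u \<noteq> 0 \<longrightarrow> a Chosen v \<noteq> 0 \<longrightarrow> u \<noteq> v \<longrightarrow> \<not> meets u v) \<and>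
     (\<forall>v<n. i \<le> cl v \<longrightarrow> a Hit v = 0 \<and> (\<forall>q<4. a Height (4 * v + q) = 0)) \<and>
     (\<forall>v<n. \<forall>t. cl v < i \<longrightarrow> a Hit v = Suc t \<longrightarrow>
        a Chosen t \<noteq> 0 \<and> cl t < cl v \<and> meets t v \<and> (\<forall>q<4. a Height (4 * v + q) = 0)) \<and>
     (\<forall>v<n. cl v < i \<longrightarrow> a Hit v = 0 \<longrightarrow>
        (\<forall>q<4. 0 < a Height (4 * v + q) \<and> a Height (4 * v + q) \<le> card {x. a Chosen x \<noteq> 0 \<and> cl x = cl v})) \<and>
     (\<forall>u<n. \<forall>v<n. \<forall>q<4. cl u = cl v \<longrightarrow> cl v < i \<longrightarrow> a Hit u = 0 \<longrightarrow> a Hit v = 0 \<longrightarrow>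
        rel (cl v) q u v \<longrightarrow> a Height (4 * u + q) < a Height (4 * v + q))"

text \<open>Elimination rules for the single clauses, so that later steps need not unfold the whole
  invariant.\<close>

lemma processedD:
  assumes "processed i a"
  shows "v < n \<Longrightarrow> a Class v = cl v"
    "a Chosen v \<noteq> 0 \<Longrightarrow> v < n" "a Chosen v \<noteq> 0 \<Longrightarrow> cl v < i"
    "a Chosen u \<noteq> 0 \<Longrightarrow> a Chosen v \<noteq> 0 \<Longrightarrow> u \<noteq> v \<Longrightarrow> \<not> meets u v"
    "v < n \<Longrightarrow> i \<le> cl v \<Longrightarrow> a Hit v = 0"
    "v < n \<Longrightarrow> i \<le> cl v \<Longrightarrow> q < 4 \<Longrightarrow> a Height (4 * v + q) = 0"
    "v < n \<Longrightarrow> cl v < i \<Longrightarrow> a Hit v = Suc t \<Longrightarrow>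
      a Chosen t \<noteq> 0 \<and> cl t < cl v \<and> meets t v \<and> (\<forall>q<4. a Height (4 * v + q) = 0)"
    "v < n \<Longrightarrow> cl v < i \<Longrightarrow> a Hit v = 0 \<Longrightarrow> q < 4 \<Longrightarrow>
      0 < a Height (4 * v + q) \<and> a Height (4 * v + q) \<le> card {x. a Chosen x \<noteq> 0 \<and> cl x = cl v}"
    "u < n \<Longrightarrow> v < n \<Longrightarrow> q < 4 \<Longrightarrow> cl u = cl v \<Longrightarrow> cl v < i \<Longrightarrow> a Hit u = 0 \<Longrightarrow> a Hit v = 0 \<Longrightarrow>
      rel (cl v) q u v \<Longrightarrow> a Height (4 * u + q) < a Height (4 * v + q)"
proof -
  note c = assms[unfolded processed_def]
  note c1 = conjunct1[OF c] and r1 = conjunct2[OF c]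
  note c2 = conjunct1[OF r1] and r2 = conjunct2[OF r1]
  note c3 = conjunct1[OF r2] and r3 = conjunct2[OF r2]
  note c4 = conjunct1[OF r3] and r4 = conjunct2[OF r3]
  note c5 = conjunct1[OF r4] and r5 = conjunct2[OF r4]
  show "v < n \<Longrightarrow> a Class v = cl v" using c1 by blast
  show "a Chosen v \<noteq> 0 \<Longrightarrow> v < n" "a Chosen v \<noteq> 0 \<Longrightarrow> cl v < i" using c2 by blast+
  show "a Chosen u \<noteq> 0 \<Longrightarrow> a Chosen v \<noteq> 0 \<Longrightarrow> u \<noteq> v \<Longrightarrow> \<not> meets u v" using c3 by blast
  show "v < n \<Longrightarrow> i \<le> cl v \<Longrightarrow> a Hit v = 0"
    "v < n \<Longrightarrow> i \<le> cl v \<Longrightarrow> q < 4 \<Longrightarrow> a Height (4 * v + q) = 0" using c4 by blast+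
  show "v < n \<Longrightarrow> cl v < i \<Longrightarrow> a Hit v = Suc t \<Longrightarrow>
      a Chosen t \<noteq> 0 \<and> cl t < cl v \<and> meets t v \<and> (\<forall>q<4. a Height (4 * v + q) = 0)" using c5 by blast
  show "v < n \<Longrightarrow> cl v < i \<Longrightarrow> a Hit v = 0 \<Longrightarrow> q < 4 \<Longrightarrow>
      0 < a Height (4 * v + q) \<and> a Height (4 * v + q) \<le> card {x. a Chosen x \<noteq> 0 \<and> cl x = cl v}"
    using conjunct1[OF r5] by blast
  show "u < n \<Longrightarrow> v < n \<Longrightarrow> q < 4 \<Longrightarrow> cl u = cl v \<Longrightarrow> cl v < i \<Longrightarrow> a Hit u = 0 \<Longrightarrow> a Hit v = 0 \<Longrightarrow>
      rel (cl v) q u v \<Longrightarrow> a Height (4 * u + q) < a Height (4 * v + q)"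
    using conjunct2[OF r5] by blast
qed

lemma wp_process_class:
  assumes a: "a NSeg 0 = n" "a NPl 0 = k" "a PlI 0 = i" "i < k" and J: "processed i a"
  shows "wp R (- {NSeg, NPl, PlI, Class, Out}) (process_class meetB relB) (time_process_class M)
    (processed (Suc i)) a"
  unfolding process_class_def time_process_class_def
proof (rule wp_Seq, rule wp_weaken[OF wp_find_hits[where a = a, OF a(1-3)]])
  let ?X = "- {NSeg, NPl, PlI, Class, Out}"
  show "\<forall>v<n. a Class v = cl v" "\<forall>v<n. cl v = i \<longrightarrow> a Hit v = 0"
    using processedD(1)[OF J] processedD(5)[OF J] by simp_all
  fix b assume frb: "\<And>x. x \<notin> {VtxV, VtxU, Hit} \<Longrightarrow> b x = a x"
    and hit: "\<forall>v<n. if cl v = i then hit_ok (a Chosen) n (b Hit v) v else b Hit v = a Hit v"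
  let ?b = "b(Best := (b Best)(nval (NLit 0) (mem b, R) := nval (NLit 0) (mem b, R)))"
  define W where "W = {v. v < n \<and> cl v = i \<and> b Hit v = 0}"
  have Wn: "W \<subseteq> {..<n}" unfolding W_def by auto
  then have finW: "finite W" using finite_subset by blast
  obtain ht where ht: "heights_ok i W ht" using heights_ok_exists[OF Wn] .
  have cls: "a Class v = cl v" if "v < n" for v using processedD(1)[OF J that] .
  have act: "active ?b i = W" unfolding active_def W_def by (auto simp: frb cls)
  have Hz: "a Height (4 * v + q) = 0" if "v < n" "i \<le> cl v" "q < 4" for v q
    using processedD(6)[OF J that] .
  show "wp R ?X (Seq (put Best (NLit 0) (NLit 0)) (Seq (heights relB) extract_chain))
      (1 + (time_heights M + time_extract_chain M)) (processed (Suc i)) b"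
  proof (rule wp_Seq, rule wp_put, simp, simp, rule wp_Seq, rule wp_weaken[OF wp_heights[where i = i and W = W and ht = ht]])
    fix c assume frc: "\<And>x. x \<notin> {Ord, Lev, VtxV, VtxU, Flag, Pre, Height, Pred, Best, Cur, BestOrd} \<Longrightarrow> c x = ?b x"
      and lab: "labelled i W ht (?b Height) (\<lambda>_ _. True) c"
    show "wp R ?X extract_chain (time_extract_chain M) (processed (Suc i)) c"
    proof (rule wp_weaken[OF wp_extract_chain[OF lab Wn ht]])
      fix e assume fre: "\<And>x. x \<notin> {Lev, Chosen, Cur} \<Longrightarrow> e x = c x"
        and "\<exists>C. C \<subseteq> W \<and> card C = c Best 0 \<and> (\<forall>x\<in>C. \<forall>y\<in>C. x \<noteq> y \<longrightarrow> \<not> meets x y) \<and>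
          (\<forall>x. e Chosen x \<noteq> 0 \<longleftrightarrow> c Chosen x \<noteq> 0 \<or> x \<in> C)"
      then obtain C where C: "C \<subseteq> W" "card C = c Best 0" "\<forall>x\<in>C. \<forall>y\<in>C. x \<noteq> y \<longrightarrow> \<not> meets x y"
        "\<And>x. e Chosen x \<noteq> 0 \<longleftrightarrow> a Chosen x \<noteq> 0 \<or> x \<in> C" by (auto simp: frc frb)
      have eC: "e Class = a Class" and eH: "e Hit = b Hit" by (simp_all add: fre frc frb)
      have Hout: "e Height (4 * v + q) = a Height (4 * v + q)" if "v < n" "v \<notin> W" "q < 4" for v q
        using lab that unfolding labelled_def by (auto simp: fre frb)
      have HW: "e Height (4 * v + q) = ht q v" "ht q v \<le> card C" if "v \<in> W" "q < 4" for v q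
        using lab that C(2) unfolding labelled_def by (auto simp: fre)
      have oldZ: "v < n" "cl v < i" if "a Chosen v \<noteq> 0" for v
        using processedD(2,3)[OF J that] .
      have hit_i: "hit_ok (a Chosen) n (b Hit v) v" if "v < n" "cl v = i" for v
        using hit that by auto
      have hit_old: "b Hit v = a Hit v" if "v < n" "cl v \<noteq> i" for v
        using hit that by auto
      have Zcard: "{x. e Chosen x \<noteq> 0 \<and> cl x = j} = {x. a Chosen x \<noteq> 0 \<and> cl x = j}" if "j \<noteq> i" for j
        using that C(1,4) unfolding W_def by auto
      have ZC: "{x. e Chosen x \<noteq> 0 \<and> cl x = i} = C"
        using oldZ C(1,4) unfolding W_def by force
      \<comment> \<open>Chain elements are unhit, so they are disjoint from everything chosen
        before; this keeps the chosen set pairwise disjoint.\<close>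
      have cross: "\<not> meets u x \<and> \<not> meets x u" if "a Chosen u \<noteq> 0" "x \<in> C" for u x
      proof -
        have "x < n" "cl x = i" "b Hit x = 0" using that C(1) unfolding W_def by auto
        then have "\<not> meets u x" using hit_i[of x] that(1) oldZ(1) unfolding hit_ok_def by simp
        then show ?thesis using meets_sym by blast
      qed
      show "processed (Suc i) e" unfolding processed_def
      proof (intro conjI allI impI)
        fix v assume "v < n" then show "e Class v = cl v" using cls eC by simp
      next
        fix v assume "e Chosen v \<noteq> 0"
        then have "a Chosen v \<noteq> 0 \<or> v \<in> W" using C by blast
        then show "v < n" "cl v < Suc i" using oldZ[of v] unfolding W_def by auto
      next
        fix u v assume "e Chosen u \<noteq> 0" "e Chosen v \<noteq> 0" "u \<noteq> v"
        moreover have "\<not> meets u v" if "a Chosen u \<noteq> 0" "a Chosen v \<noteq> 0" "u \<noteq> v"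
          using processedD(4)[OF J that] .
        ultimately show "\<not> meets u v" using C(3,4) cross by blast
      next
        fix v assume v: "v < n" "Suc i \<le> cl v"
        then show "e Hit v = 0" using processedD(5)[OF J] hit_old unfolding eH by simp
        fix q assume "q < (4::nat)"
        then show "e Height (4 * v + q) = 0" using v Hout[of v q] Hz unfolding W_def by simp
      next
        fix v t assume v: "v < n" "cl v < Suc i" "e Hit v = Suc t"
        then have "v \<notin> W" unfolding W_def eH by simp
        \<comment> \<open>When the current class was searched for hits, its own chain was not yet
          chosen; so the hitting segment has a strictly smaller class.\<close>
        have "a Chosen t \<noteq> 0 \<and> cl t < cl v \<and> meets t v \<and> (\<forall>q<4. a Height (4 * v + q) = 0)"
        proof (cases "cl v = i")
          case True
          then show ?thesis using hit_i[of v] v oldZ(2) Hz unfolding hit_ok_def eH by auto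
        next
          case False
          then show ?thesis using processedD(7)[OF J] v hit_old unfolding eH by simp
        qed
        then show "e Chosen t \<noteq> 0" "cl t < cl v" "meets t v" "\<And>q. q < 4 \<Longrightarrow> e Height (4 * v + q) = 0"
          using C(4) Hout[OF v(1) \<open>v \<notin> W\<close>] by auto
      next
        fix v q assume v: "v < n" "cl v < Suc i" "e Hit v = 0" "q < (4::nat)"
        have "0 < e Height (4 * v + q) \<and> e Height (4 * v + q) \<le> card {x. e Chosen x \<noteq> 0 \<and> cl x = cl v}"
        proof (cases "cl v = i")
          case True
          then have "v \<in> W" using v unfolding W_def eH by simp
          then show ?thesis using HW v(4) ht True ZC unfolding heights_ok_def by simp
        next
          case False
          then have "v \<notin> W" unfolding W_def by simp
          then show ?thesis
            using False processedD(8)[OF J v(1) _ _ v(4)] v hit_old Zcard[OF False] Hout[OF v(1) _ v(4)]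
            unfolding eH by simp
        qed
        then show "0 < e Height (4 * v + q)" "e Height (4 * v + q) \<le> card {x. e Chosen x \<noteq> 0 \<and> cl x = cl v}"
          by auto
      next
        fix u v q assume h: "u < n" "v < n" "q < (4::nat)" "cl u = cl v" "cl v < Suc i" "e Hit u = 0" "e Hit v = 0"
          "rel (cl v) q u v"
        show "e Height (4 * u + q) < e Height (4 * v + q)"
        proof (cases "cl v = i")
          case True
          then have W: "u \<in> W" "v \<in> W" using h unfolding W_def eH by simp_all
          \<comment> \<open>Positivity allows the height recursion with
            \<open>l = ht q v - 1\<close>, which gives strict growth.\<close>
          have "0 < ht q v" "\<And>l. ht q v \<le> Suc l \<Longrightarrow> ht q u \<le> l"
            using ht W h True unfolding heights_ok_def by blast+
          from this(1) this(2)[of "ht q v - 1"] have "ht q u < ht q v" by simp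
          then show ?thesis using HW W h(3) by simp
        next
          case False
          then have "u \<notin> W" "v \<notin> W" using h(4) unfolding W_def by auto
          then show ?thesis
            using False processedD(9)[OF J h(1-4)] h hit_old Hout[OF h(1) _ h(3)] Hout[OF h(2) _ h(3)]
            unfolding eH by simp
        qed
      qed
    qed auto
  qed (use a act ht Hz in \<open>auto simp: frb W_def\<close>)
qed auto

end

section \<open>Output and total running time\<close>

definition time_process_all :: "nat \<Rightarrow> nat" where
  "time_process_all M = M * (time_process_class M + 2) + 2"

definition time_choose_colors :: "nat \<Rightarrow> nat" where
  "time_choose_colors M = M * ((M * (Suc 1 + 2) + 2) + 2) + 2"

definition time_copy_chosen :: "nat \<Rightarrow> nat" where
  "time_copy_chosen M = M * (1 + 2) + 2"

text \<open>
  The output overwrites all cells below \<open>2 * n\<close>, including every variable at a fixed address except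
  the counter in cell \<open>0\<close>. Copying in ascending order is safe because the source of cell \<open>i\<close> lies
  above \<open>i\<close>; the loop recognises its end by a zero, as \<open>Out\<close> stores all values incremented; and
  cell \<open>0\<close> finally receives the color of the first segment, which is \<open>0\<close>.
\<close>

abbreviation Source :: nexp where
  "Source \<equiv> NCell (NAdd (nmul 18 (NCell (NLit 0))) (NLit (code Out)))"

definition emit :: com where
  "emit = Seq (NStore (NLit 0) (NLit 1))
     (Seq (While (NLess (NLit 0) Source)
            (Seq (NStore (NCell (NLit 0)) (NSub Source (NLit 1)))
                 (NStore (NLit 0) (NAdd (NCell (NLit 0)) (NLit 1)))))
          (NStore (NLit 0) (NLit 0)))"

text \<open>Cells from \<open>1\<close> up to but excluding \<open>i\<close> already hold output,
  and those from \<open>i\<close> on are as in \<mu>; the source of cell \<open>i\<close> is among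
  the latter. Each round takes three steps: a test, a copy and an increment.\<close>

lemma emit_loop:
  fixes \<mu> \<mu>' :: "nat \<Rightarrow> nat"
  assumes pos: "\<And>j. 1 \<le> j \<Longrightarrow> j < N \<Longrightarrow> 0 < \<mu> (18 * j + code Out)" and stop: "\<mu> (18 * N + code Out) = 0"
    and "1 \<le> i" "i \<le> N" "\<mu>' 0 = i" "\<And>j. 1 \<le> j \<Longrightarrow> j < i \<Longrightarrow> \<mu>' j = \<mu> (18 * j + code Out) - 1"
    "\<And>x. i \<le> x \<Longrightarrow> \<mu>' x = \<mu> x"
  shows "\<exists>\<mu>''. runs (While (NLess (NLit 0) Source)
        (Seq (NStore (NCell (NLit 0)) (NSub Source (NLit 1)))
             (NStore (NLit 0) (NAdd (NCell (NLit 0)) (NLit 1))))) (\<mu>', R) (3 * (N - i) + 1) (\<mu>'', R) \<and>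
      (\<forall>j. 1 \<le> j \<longrightarrow> j < N \<longrightarrow> \<mu>'' j = \<mu> (18 * j + code Out) - 1)"
  using assms(3-)
proof (induction "N - i" arbitrary: i \<mu>')
  case 0
  then have "i = N" by simp
  with 0 stop have "\<not> bval (NLess (NLit 0) Source) (\<mu>', R)" by simp
  from runs.WhileFalse[OF this] show ?case using 0 \<open>i = N\<close> by auto
next
  case (Suc D)
  then have i: "i < N" by simp
  let ?c = "Seq (NStore (NCell (NLit 0)) (NSub Source (NLit 1)))
             (NStore (NLit 0) (NAdd (NCell (NLit 0)) (NLit 1)))"
  have src: "\<mu>' (18 * i + code Out) = \<mu> (18 * i + code Out)" using Suc.prems(5) by simp
  have b: "bval (NLess (NLit 0) Source) (\<mu>', R)" using pos[of i] i Suc.prems(1,3) src by simp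
  let ?\<mu>1 = "\<mu>'(i := \<mu> (18 * i + code Out) - 1)"
  have s1: "runs (NStore (NCell (NLit 0)) (NSub Source (NLit 1))) (\<mu>', R) 1 (?\<mu>1, R)"
    using runs.NStore[of "NCell (NLit 0)" "NSub Source (NLit 1)" "(\<mu>', R)"] Suc.prems(3) src by simp
  have s2: "runs (NStore (NLit 0) (NAdd (NCell (NLit 0)) (NLit 1))) (?\<mu>1, R) 1 (?\<mu>1(0 := Suc i), R)"
    using runs.NStore[of "NLit 0" "NAdd (NCell (NLit 0)) (NLit 1)" "(?\<mu>1, R)"] Suc.prems(1,3) by simp
  have body: "runs ?c (\<mu>', R) (1 + 1) (?\<mu>1(0 := Suc i), R)" using runs.Seq[OF s1 s2] .
  have inv: "(?\<mu>1(0 := Suc i)) j = \<mu> (18 * j + code Out) - 1" if "1 \<le> j" "j < Suc i" for j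
    using Suc.prems(4)[of j] that by (auto simp: less_Suc_eq)
  have rest: "(?\<mu>1(0 := Suc i)) x = \<mu> x" if "Suc i \<le> x" for x
    using Suc.prems(5)[of x] that by auto
  have "N - Suc i = D" using Suc.hyps(2) by simp
  with Suc.hyps(1)[of "Suc i" "?\<mu>1(0 := Suc i)", OF _ _ _ _ inv rest] i obtain \<mu>'' where
    "runs (While (NLess (NLit 0) Source) ?c) (?\<mu>1(0 := Suc i), R) (3 * (N - Suc i) + 1) (\<mu>'', R)"
    "\<forall>j. 1 \<le> j \<longrightarrow> j < N \<longrightarrow> \<mu>'' j = \<mu> (18 * j + code Out) - 1"
    by auto
  moreover have "Suc (1 + 1 + (3 * (N - Suc i) + 1)) = 3 * (N - i) + 1" using i by simp
  ultimately show ?case using runs.WhileTrue[OF b body] by metis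
qed

lemma emit_runs:
  fixes \<mu> :: "nat \<Rightarrow> nat"
  assumes pos: "\<And>j. j < N \<Longrightarrow> 0 < \<mu> (18 * j + code Out)" and stop: "\<And>j. N \<le> j \<Longrightarrow> \<mu> (18 * j + code Out) = 0"
    and zero: "\<mu> (18 * 0 + code Out) \<le> 1"
  obtains t \<mu>' where "runs emit (\<mu>, R) t (\<mu>', R)" "t \<le> 3 * N + 3"
    "\<And>j. j < N \<Longrightarrow> \<mu>' j = \<mu> (18 * j + code Out) - 1"
proof -
  \<comment> \<open>The counter starts at \<open>1\<close>, so an empty output is treated like one
    of length \<open>1\<close>; in both cases the loop stops at once.\<close>
  let ?N = "max 1 N"
  have "\<mu> (18 * ?N + code Out) = 0" by (rule stop) simp
  moreover have "0 < (\<mu>(0 := 1)) (18 * j + code Out)" if "1 \<le> j" "j < ?N" for j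
    using pos[of j] that by (auto simp: max_def split: if_splits)
  ultimately obtain \<mu>'' where
    1: "runs (While (NLess (NLit 0) Source)
        (Seq (NStore (NCell (NLit 0)) (NSub Source (NLit 1)))
             (NStore (NLit 0) (NAdd (NCell (NLit 0)) (NLit 1))))) (\<mu>(0 := 1), R) (3 * (?N - 1) + 1) (\<mu>'', R)"
    and 2: "\<forall>j. 1 \<le> j \<longrightarrow> j < ?N \<longrightarrow> \<mu>'' j = \<mu> (18 * j + code Out) - 1"
    using emit_loop[of ?N "\<mu>" 1 "\<mu>(0 := 1)" R] by auto
  have s: "runs (NStore (NLit 0) (NLit 1)) (\<mu>, R) 1 (\<mu>(0 := 1), R)"
    using runs.NStore[of "NLit 0" "NLit 1" "(\<mu>, R)"] by simp
  have e: "runs (NStore (NLit 0) (NLit 0)) (\<mu>'', R) 1 (\<mu>''(0 := 0), R)"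
    using runs.NStore[of "NLit 0" "NLit 0" "(\<mu>'', R)"] by simp
  have "runs emit (\<mu>, R) (1 + (3 * (?N - 1) + 1 + 1)) (\<mu>''(0 := 0), R)"
    unfolding emit_def by (rule runs.Seq[OF s runs.Seq[OF 1 e]])
  moreover have "1 + (3 * (?N - 1) + 1 + 1) \<le> 3 * N + 3" by simp
  \<comment> \<open>Cell \<open>0\<close> receives the literal \<open>0\<close>, which is the right
    value because its source is at most \<open>1\<close>.\<close>
  moreover have "(\<mu>''(0 := 0)) j = \<mu> (18 * j + code Out) - 1" if "j < N" for j
    using 2 zero that by (cases "j = 0") auto
  ultimately show ?thesis using that by blast
qed

definition segment_coloring :: "bexp \<Rightarrow> bexp \<Rightarrow> bexp \<Rightarrow> com" where
  "segment_coloring inB meetB relB =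
     Seq (Seq (classify inB) (Seq (For PlI (Var NPl) (process_class meetB relB))
       (Seq choose_colors copy_chosen))) emit"

definition time_segment_coloring :: "nat \<Rightarrow> nat" where
  "time_segment_coloring M = time_classify M + (time_process_all M + (time_choose_colors M + time_copy_chosen M)) +
     (3 * (2 * M) + 3)"

definition signature :: "state \<Rightarrow> nat \<Rightarrow> nat \<times> nat \<times> nat \<times> nat \<times> nat \<times> nat" where
  "signature a v = (a Class v, a Hit v, a Height (4 * v + 0), a Height (4 * v + 1),
     a Height (4 * v + 2), a Height (4 * v + 3))"

lemma signature_Height: "signature a u = signature a v \<Longrightarrow> q < 4 \<Longrightarrow> a Height (4 * u + q) = a Height (4 * v + q)"
  by (auto simp: signature_def eval_nat_numeral less_Suc_eq)

context segment_program
begin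

lemma processed_upd: "processed i (a(PlI := z)) = processed i a"
  by (simp add: processed_def)

lemma wp_process_all:
  assumes a: "a NSeg 0 = n" "a NPl 0 = k" and cls: "\<forall>v<n. a Class v = cl v"
    and zero: "a Hit = (\<lambda>_. 0)" "a Height = (\<lambda>_. 0)" "a Chosen = (\<lambda>_. 0)"
  shows "wp R (- {NSeg, NPl, Class, Out}) (For PlI (Var NPl) (process_class meetB relB)) (time_process_all M)
    (processed k) a"
  unfolding time_process_all_def
proof (rule wp_For[where N = k and I = processed])
  fix i a' assume i: "i < k" and fr: "\<And>y. y \<notin> - {NSeg, NPl, Class, Out} \<Longrightarrow> a' y = a y" and "a' PlI 0 = i"
    and J: "processed i a'"
  have "a' NSeg 0 = n" "a' NPl 0 = k" using a fr[of NSeg] fr[of NPl] by auto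
  then show "wp R (- {NSeg, NPl, Class, Out}) (process_class meetB relB) (time_process_class M)
      (\<lambda>a''. a'' PlI 0 = i \<and> processed (Suc i) a'') a'"
    by (intro wp_weaken[OF wp_process_class[where a = a' and i = i]]) (use i \<open>a' PlI 0 = i\<close> J in auto)
next
  show "processed 0 a" unfolding processed_def using cls zero by simp
  show "processed i (a'(PlI := z))" if "processed i a'" for i a' z
    using that by (simp only: processed_upd)
  show "processed k a'" if "processed k a'" for a' using that .
qed (use a k_le in auto)

text \<open>The minimum ranges over all natural numbers but is at most \<open>v\<close>, so the
  program finds it among the segments. Colors need not be consecutive; only the number of values
  counts.\<close>

definition color_of :: "state \<Rightarrow> nat \<Rightarrow> nat" where
  "color_of a v = (LEAST u. signature a u = signature a v)"

lemma wp_choose_colors: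
  assumes a: "a NSeg 0 = n" and zero: "a Out = (\<lambda>_. 0)"
  shows "wp R {VtxV, VtxU, Out} choose_colors (time_choose_colors M)
    (\<lambda>a'. \<forall>x. a' Out x = (if x < n then Suc (color_of a x) else 0)) a"
proof -
  let ?c = "Cond (BAnd (NEq (At Out (Var VtxV)) (NLit 0)) SameColor)
       (put Out (Var VtxV) (NAdd (Var VtxU) (NLit 1))) Skip"
  have inner: "wp R {VtxU, Out} (For VtxU (Var NSeg) ?c) (M * (Suc 1 + 2) + 2)
      (\<lambda>b'. b' Out v = Suc (color_of b v) \<and> (\<forall>x. x \<noteq> v \<longrightarrow> b' Out x = b Out x)) b"
    if b: "b NSeg 0 = n" "b VtxV 0 = v" "v < n" "b Out v = 0" for b v
  proof (rule wp_For[where N = n and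
      I = "\<lambda>w b'. b' Out v = (if \<exists>u<w. signature b u = signature b v then Suc (color_of b v) else 0) \<and>
        (\<forall>x. x \<noteq> v \<longrightarrow> b' Out x = b Out x)"])
    fix u b' assume u: "u < n" and fr: "\<And>y. y \<notin> {VtxU, Out} \<Longrightarrow> b' y = b y" and bu: "b' VtxU 0 = u"
      and I: "b' Out v = (if \<exists>x<u. signature b x = signature b v then Suc (color_of b v) else 0) \<and>
        (\<forall>x. x \<noteq> v \<longrightarrow> b' Out x = b Out x)"
    have same: "bval SameColor (mem b', R) \<longleftrightarrow> signature b u = signature b v"
      using b(2) bu by (simp add: SameColor_def signature_def fr)
    have least: "color_of b v = u" if "\<not> (\<exists>x<u. signature b x = signature b v)" "signature b u = signature b v"
      unfolding color_of_def by (rule Least_equality) (use that not_less in blast)+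
    show "wp R {VtxU, Out} ?c (Suc 1) (\<lambda>b''. b'' VtxU 0 = u \<and>
        b'' Out v = (if \<exists>x<Suc u. signature b x = signature b v then Suc (color_of b v) else 0) \<and>
        (\<forall>x. x \<noteq> v \<longrightarrow> b'' Out x = b Out x)) b'"
    proof (rule wp_Cond)
      assume "bval (BAnd (NEq (At Out (Var VtxV)) (NLit 0)) SameColor) (mem b', R)"
      then have "b' Out v = 0" "signature b u = signature b v" using same b(2) by (auto simp: fr)
      then have "signature b u = signature b v" "color_of b v = u" using I least by (auto split: if_splits)
      then show "wp R {VtxU, Out} (put Out (Var VtxV) (NAdd (Var VtxU) (NLit 1))) 1 (\<lambda>b''. b'' VtxU 0 = u \<and>
        b'' Out v = (if \<exists>x<Suc u. signature b x = signature b v then Suc (color_of b v) else 0) \<and>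
        (\<forall>x. x \<noteq> v \<longrightarrow> b'' Out x = b Out x)) b'"
        using I b(2) bu by (intro wp_put) (auto simp: fr)
    next
      assume "\<not> bval (BAnd (NEq (At Out (Var VtxV)) (NLit 0)) SameColor) (mem b', R)"
      then have "b' Out v \<noteq> 0 \<or> signature b u \<noteq> signature b v" using same b(2) by (auto simp: fr)
      then have "(\<exists>x<Suc u. signature b x = signature b v) \<longleftrightarrow> (\<exists>x<u. signature b x = signature b v)"
        using I by (auto simp: less_Suc_eq split: if_splits)
      then show "wp R {VtxU, Out} Skip 1 (\<lambda>b''. b'' VtxU 0 = u \<and>
        b'' Out v = (if \<exists>x<Suc u. signature b x = signature b v then Suc (color_of b v) else 0) \<and>
        (\<forall>x. x \<noteq> v \<longrightarrow> b'' Out x = b Out x)) b'"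
        using I bu by (intro wp_Skip) simp_all
    qed
  qed (use b n_le in auto)
  show ?thesis unfolding choose_colors_def time_choose_colors_def
  proof (rule wp_For[where N = n and
      I = "\<lambda>w b. \<forall>x. b Out x = (if x < w then Suc (color_of a x) else 0)"])
    fix v b assume v: "v < n" and fr: "\<And>y. y \<notin> {VtxV, VtxU, Out} \<Longrightarrow> b y = a y" and bv: "b VtxV 0 = v"
      and I: "\<forall>x. b Out x = (if x < v then Suc (color_of a x) else 0)"
    have "color_of b v = color_of a v" by (simp add: color_of_def signature_def fr)
    then show "wp R {VtxV, VtxU, Out} (For VtxU (Var NSeg) ?c) (M * (Suc 1 + 2) + 2)
        (\<lambda>b'. b' VtxV 0 = v \<and> (\<forall>x. b' Out x = (if x < Suc v then Suc (color_of a x) else 0))) b"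
      by (intro wp_weaken[OF inner[of b v]]) (use a v bv I in \<open>auto simp: fr less_Suc_eq\<close>)
  qed (use a zero n_le in auto)
qed

lemma wp_copy_chosen:
  assumes a: "a NSeg 0 = n"
  shows "wp R {VtxV, Out} copy_chosen (time_copy_chosen M)
    (\<lambda>a'. \<forall>x. a' Out x = (if n \<le> x \<and> x < n + n then Suc (a Chosen (x - n)) else a Out x)) a"
  unfolding copy_chosen_def time_copy_chosen_def
proof (rule wp_For[where N = n and
    I = "\<lambda>w b. \<forall>x. b Out x = (if n \<le> x \<and> x < n + w then Suc (a Chosen (x - n)) else a Out x)"])
  fix v b assume v: "v < n" and fr: "\<And>y. y \<notin> {VtxV, Out} \<Longrightarrow> b y = a y" and bv: "b VtxV 0 = v"
    and I: "\<forall>x. b Out x = (if n \<le> x \<and> x < n + v then Suc (a Chosen (x - n)) else a Out x)"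
  show "wp R {VtxV, Out} (put Out (NAdd (Var NSeg) (Var VtxV)) (NAdd (At Chosen (Var VtxV)) (NLit 1))) 1
      (\<lambda>b'. b' VtxV 0 = v \<and>
        (\<forall>x. b' Out x = (if n \<le> x \<and> x < n + Suc v then Suc (a Chosen (x - n)) else a Out x))) b"
    by (intro wp_put) (use a v bv I in \<open>auto simp: fr\<close>)
qed (use a n_le in auto)

text \<open>Disjoint segments with equal signatures would lie in one class. If unhit, they are
  comparable in some order and their heights differ; if hit by the same \<open>t\<close>, they share
  the point where \<open>t\<close> pierces the plane.\<close>

lemma color_of_proper:
  assumes J: "processed k a" and uv: "u < n" "v < n" "u \<noteq> v" "\<not> meets u v"
  shows "color_of a u \<noteq> color_of a v"
proof
  assume "color_of a u = color_of a v"
  moreover have "signature a (color_of a x) = signature a x" for x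
    unfolding color_of_def by (rule LeastI[of _ x]) simp
  ultimately have s: "signature a u = signature a v" by metis
  have c: "cl u = cl v" using s processedD(1)[OF J] uv by (simp add: signature_def)
  have h: "a Hit u = a Hit v" using s by (simp add: signature_def)
  note k = cl(1)[OF uv(1)] cl(1)[OF uv(2)]
  note inP = cl(2)[OF uv(1)] cl(2)[OF uv(2), folded c]
  show False
  proof (cases "a Hit u")
    case 0
    with h have 0: "a Hit u = 0" "a Hit v = 0" by auto
    obtain q where q: "q < 4" "rel (cl u) q u v \<or> rel (cl u) q v u"
      using rel_comparable[OF k(1) uv(1,2) inP uv(4)] by blast
    have "a Height (4 * u + q) \<noteq> a Height (4 * v + q)"
      using q(2) processedD(9)[OF J uv(1,2) q(1) c k(2) 0]
        processedD(9)[OF J uv(2,1) q(1) c[symmetric] k(1) 0(2,1)] c by auto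
    then show False using signature_Height[OF s q(1)] by blast
  next
    case (Suc t)
    with h have "a Hit v = Suc t" by simp
    from processedD(7)[OF J uv(1) k(1) Suc] processedD(7)[OF J uv(2) k(2) this]
    have t: "a Chosen t \<noteq> 0" "cl t < cl u" "meets t u" "meets t v" by auto
    have tn: "t < n" using processedD(2)[OF J t(1)] .
    \<comment> \<open>The class of \<open>t\<close> is the last plane containing it and precedes the
      class of \<open>u\<close>, so the plane of \<open>u\<close> does not contain
      \<open>t\<close>.\<close>
    then have "\<not> inP (cl u) t" using cl(3)[OF tn _ k(1)] t(2) by fastforce
    from piercing[OF tn uv(1,2) k(1) inP this t(3,4)] show False using uv(4) by simp
  qed
qed

text \<open>The color is a function of the signature, so it suffices to count signatures.\<close>

lemma card_color_of:
  assumes J: "processed k a"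
  shows "card (color_of a ` {..<n}) \<le> (k - 1) * card {v. a Chosen v \<noteq> 0} + card {v. a Chosen v \<noteq> 0} ^ 4"
proof -
  let ?Z = "{v. a Chosen v \<noteq> 0}"
  let ?h = "\<lambda>v q. a Height (4 * v + q)"
  have Z: "?Z \<subseteq> {..<n}" using processedD(2)[OF J] by blast
  have fin: "finite ?Z" using finite_subset[OF Z] by simp
  have "color_of a ` {..<n} = (\<lambda>s. LEAST u. signature a u = s) ` signature a ` {..<n}"
    by (simp add: image_image color_of_def)
  then have "card (color_of a ` {..<n}) \<le> card (signature a ` {..<n})"
    by (simp add: card_image_le)
  also have "signature a ` {..<n} = (\<lambda>v. (cl v, a Hit v, ?h v 0, ?h v 1, ?h v 2, ?h v 3)) ` {..<n}"
    using processedD(1)[OF J] by (intro image_cong) (simp_all add: signature_def)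
  also have "card \<dots> \<le> (k - 1) * card ?Z + card ?Z ^ 4"
  proof (rule card_signatures_le[OF fin])
    show "cl v < k" if "v < n" for v using cl(1)[OF that] .
    show "t \<in> ?Z \<and> cl t < cl v \<and> (\<forall>q<4. ?h v q = 0)" if "v < n" "a Hit v = Suc t" for v t
      using processedD(7)[OF J that(1) cl(1)[OF that(1)] that(2)] by simp
    show "0 < ?h v q \<and> ?h v q \<le> card {x \<in> ?Z. cl x = cl v}" if "v < n" "a Hit v = 0" "q < 4" for v q
      using processedD(8)[OF J that(1) cl(1)[OF that(1)] that(2,3)] by simp
  qed
  finally show ?thesis .
qed

text \<open>Agrees with the literal that the output stage finally stores in cell
  \<open>0\<close>.\<close>

lemma color_of_first: "color_of a 0 = 0"
  unfolding color_of_def by (rule Least_equality) simp_all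

lemma mem_load: "mem (\<lambda>c i. load [n, k] (18 * i + code c)) = load [n, k]"
  by (rule ext) (simp add: mem_def code_cells_nth)

theorem segment_coloring_runs:
  "\<exists>t \<mu> Z. runs (segment_coloring inB meetB relB) (load [n, k], R) t (\<mu>, R) \<and>
    t \<le> time_segment_coloring M \<and> Z \<subseteq> {..<n} \<and> (\<forall>v<n. \<mu> (n + v) \<noteq> 0 \<longleftrightarrow> v \<in> Z) \<and>
    (\<forall>u\<in>Z. \<forall>v\<in>Z. u \<noteq> v \<longrightarrow> \<not> meets u v) \<and>
    (\<forall>u<n. \<forall>v<n. u \<noteq> v \<longrightarrow> \<not> meets u v \<longrightarrow> \<mu> u \<noteq> \<mu> v) \<and>
    card (\<mu> ` {..<n}) \<le> (k - 1) * card Z + card Z ^ 4"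
proof -
  define a0 where "a0 = (\<lambda>c i. load [n, k] (18 * i + code c))"
  have a0: "a0 NSeg 0 = n" "a0 NPl 0 = k" by (simp_all add: a0_def load_def)
  have zero: "a0 c = (\<lambda>_. 0)" if "c \<notin> {NSeg, NPl}" for c
  proof -
    have "2 \<le> code c" using that by (cases c) simp_all
    then show ?thesis by (auto simp: a0_def load_def)
  qed
  let ?X = "- {NSeg, NPl}"
  \<comment> \<open>The state \<open>a\<close> at the end of the last class is kept existentially,
    since colors and selection are described by it while \<open>Out\<close> is being filled.\<close>
  let ?Q = "\<lambda>b. \<exists>a. processed k a \<and> (\<forall>x. b Out x = (if n \<le> x \<and> x < n + n then Suc (a Chosen (x - n))
    else if x < n then Suc (color_of a x) else 0))"
  have "wp R ?X (Seq (classify inB) (Seq (For PlI (Var NPl) (process_class meetB relB))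
       (Seq choose_colors copy_chosen)))
     (time_classify M + (time_process_all M + (time_choose_colors M + time_copy_chosen M))) ?Q a0"
  proof (rule wp_Seq, rule wp_weaken[OF wp_classify[where a = a0, OF a0]])
    fix a1 assume f1: "\<And>x. x \<notin> {PlI, VtxV, Class} \<Longrightarrow> a1 x = a0 x" and c: "\<forall>v<n. a1 Class v = cl v"
    show "wp R ?X (Seq (For PlI (Var NPl) (process_class meetB relB)) (Seq choose_colors copy_chosen))
      (time_process_all M + (time_choose_colors M + time_copy_chosen M)) ?Q a1"
    proof (rule wp_Seq, rule wp_weaken[OF wp_process_all[where a = a1, OF _ _ c]])
      fix a2 assume f2: "\<And>x. x \<notin> - {NSeg, NPl, Class, Out} \<Longrightarrow> a2 x = a1 x" and J: "processed k a2"
      have s2: "a2 NSeg 0 = n" using f2[of NSeg] f1[of NSeg] a0 by simp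
      have o2: "a2 Out = (\<lambda>_. 0)" using f2[of Out] f1[of Out] zero[of Out] by simp
      show "wp R ?X (Seq choose_colors copy_chosen) (time_choose_colors M + time_copy_chosen M) ?Q a2"
      proof (rule wp_Seq, rule wp_weaken[OF wp_choose_colors[where a = a2, OF s2 o2]])
        fix a3 assume f3: "\<And>x. x \<notin> {VtxV, VtxU, Out} \<Longrightarrow> a3 x = a2 x"
          and o3: "\<forall>x. a3 Out x = (if x < n then Suc (color_of a2 x) else 0)"
        have "a3 NSeg 0 = n" using s2 f3[of NSeg] by simp
        from wp_copy_chosen[where a = a3, OF this] show "wp R ?X copy_chosen (time_copy_chosen M) ?Q a3"
        proof (rule wp_weaken)
          fix a4 assume "\<forall>x. a4 Out x = (if n \<le> x \<and> x < n + n then Suc (a3 Chosen (x - n)) else a3 Out x)"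
          then show "?Q a4" using o3 f3[of Chosen] J by (intro exI[of _ a2]) simp
        qed auto
      qed auto
    qed (use f1 a0 zero in auto)
  qed (use zero in auto)
  then obtain b t1 a where t1: "t1 \<le> time_classify M + (time_process_all M + (time_choose_colors M + time_copy_chosen M))"
    and run1: "runs (Seq (classify inB) (Seq (For PlI (Var NPl) (process_class meetB relB))
       (Seq choose_colors copy_chosen))) (load [n, k], R) t1 (mem b, R)"
    and J: "processed k a" and out: "\<And>x. b Out x = (if n \<le> x \<and> x < n + n then Suc (a Chosen (x - n))
    else if x < n then Suc (color_of a x) else 0)"
    unfolding wp_def a0_def mem_load by blast
  obtain t2 \<mu> where run2: "runs emit (mem b, R) t2 (\<mu>, R)" and t2: "t2 \<le> 3 * (n + n) + 3"
    and \<mu>: "\<And>j. j < n + n \<Longrightarrow> \<mu> j = mem b (18 * j + code Out) - 1"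
  proof (rule emit_runs[of "n + n" "mem b" R])
    show "mem b (18 * 0 + code Out) \<le> 1"
      unfolding mem_fetch out using color_of_first[of a] by (cases "n = 0") auto
  qed (simp_all add: out del: code.simps)
  note \<mu> = \<mu>[unfolded mem_fetch]
  have col: "\<mu> v = color_of a v" if "v < n" for v using \<mu>[of v] out[of v] that by simp
  have sel: "\<mu> (n + v) = a Chosen v" if "v < n" for v using \<mu>[of "n + v"] out[of "n + v"] that by simp
  let ?Z = "{v. a Chosen v \<noteq> 0}"
  show ?thesis
  proof (intro exI[of _ "t1 + t2"] exI[of _ \<mu>] exI[of _ ?Z] conjI allI ballI impI)
    show "runs (segment_coloring inB meetB relB) (load [n, k], R) (t1 + t2) (\<mu>, R)"
      unfolding segment_coloring_def by (rule runs.Seq[OF run1 run2])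
    show "t1 + t2 \<le> time_segment_coloring M"
      unfolding time_segment_coloring_def by (rule add_mono[OF t1]) (use t2 n_le in simp)
    show "?Z \<subseteq> {..<n}" using processedD(2)[OF J] by blast
    show "\<mu> (n + v) \<noteq> 0 \<longleftrightarrow> v \<in> ?Z" if "v < n" for v using sel[OF that] by simp
    show "\<not> meets u v" if "u \<in> ?Z" "v \<in> ?Z" "u \<noteq> v" for u v using processedD(4)[OF J] that by blast
    show "\<mu> u \<noteq> \<mu> v" if "u < n" "v < n" "u \<noteq> v" "\<not> meets u v" for u v
      using color_of_proper[OF J that] col that by simp
    have "\<mu> ` {..<n} = color_of a ` {..<n}" using col by (intro image_cong) auto
    then show "card (\<mu> ` {..<n}) \<le> (k - 1) * card ?Z + card ?Z ^ 4" using card_color_of[OF J] by simp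
  qed
qed

end

section \<open>Geometric instance of the program\<close>

definition Endpoint :: "nat \<Rightarrow> nat \<Rightarrow> cell \<Rightarrow> vexp" where
  "Endpoint d l x = (\<lambda>j. RCell (NAdd (nmul (2 * d) (Var x)) (NLit (l * d + j))))"

text \<open>The planes are stored behind the coordinates of all segments, whence the offset by
  \<open>2 * d\<close> times the content of \<open>NSeg\<close>.\<close>

definition PlanePoint :: "nat \<Rightarrow> nat \<Rightarrow> vexp" where
  "PlanePoint d l =
     (\<lambda>j. RCell (NAdd (nmul (2 * d) (Var NSeg)) (NAdd (nmul (3 * d) (Var PlI)) (NLit (l * d + j)))))"

text \<open>By convexity of the plane, the two endpoints decide whether it contains the
  segment.\<close>

definition InPlane :: "nat \<Rightarrow> bexp" where
  "InPlane d = BAll (map (\<lambda>l. OnPlane d (Endpoint d l VtxV) (PlanePoint d 0) (PlanePoint d 1) (PlanePoint d 2)) [0, 1])"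

definition Meet :: "nat \<Rightarrow> bexp" where
  "Meet d = SegmentsMeet d (Endpoint d 0 VtxU) (Endpoint d 1 VtxU) (Endpoint d 0 VtxV) (Endpoint d 1 VtxV)"

text \<open>The order index is a run-time value, whereas \<open>SegOrder\<close> takes it while the
  program is built; hence a disjunction over the four values, written as a negated
  conjunction.\<close>

definition Related :: "nat \<Rightarrow> bexp" where
  "Related d = BNot (BAll (map (\<lambda>q. BNot (BAnd (NEq (Var Ord) (NLit q))
     (SegOrder (VDot d (VSub (PlanePoint d 1) (PlanePoint d 0))) (VDot d (VSub (PlanePoint d 2) (PlanePoint d 0))) q
       [Endpoint d 0 VtxU, Endpoint d 1 VtxU] [Endpoint d 0 VtxV, Endpoint d 1 VtxV]))) [0, 1, 2, 3]))"

lemma length_coords [simp]: "length (coords (x :: real^'n)) = CARD('n)"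
  by (simp add: coords_def)

lemma coords_nth: "j < CARD('n) \<Longrightarrow> coords (x :: real^'n) ! j = x $ from_nat_into UNIV j"
  by (simp add: coords_def)

lemma length_input_reals:
  fixes ss :: "((real^'n) \<times> (real^'n)) list"
  shows "length (input_reals ss ps) = 2 * CARD('n) * length ss + 3 * CARD('n) * length ps"
proof -
  have "length (concat (map (\<lambda>(a, b). coords a @ coords b) ss)) = 2 * CARD('n) * length ss"
    by (rule length_concat_blocks) auto
  moreover have "length (concat (map (\<lambda>(p, q, r). coords p @ coords q @ coords r) ps)) = 3 * CARD('n) * length ps"
    by (rule length_concat_blocks) auto
  ultimately show ?thesis by (simp add: input_reals_def)
qed

lemma input_reals_endpoint:
  fixes ss :: "((real^'n) \<times> (real^'n)) list"
  assumes "v < length ss" "j < CARD('n)" "l < 2"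
  shows "load (input_reals ss ps) (2 * CARD('n) * v + (l * CARD('n) + j)) =
    (if l = 0 then fst (ss ! v) else snd (ss ! v)) $ from_nat_into UNIV j"
proof -
  let ?d = "CARD('n)"
  let ?f = "\<lambda>(a, b). coords a @ coords b"
  have lj: "l * ?d + j < 2 * ?d" using assms(2,3) by (auto simp: less_2_cases_iff)
  have len: "length (?f x) = 2 * ?d" for x :: "(real^'n) \<times> (real^'n)" by (cases x) simp
  have "2 * ?d * v + (l * ?d + j) < 2 * ?d * Suc v" using lj by simp
  also have "\<dots> \<le> 2 * ?d * length ss" using assms(1) by (intro mult_le_mono2) simp
  finally have b: "2 * ?d * v + (l * ?d + j) < length (concat (map ?f ss))"
    using length_concat_blocks[of ss ?f, OF len] by simp
  then have "load (input_reals ss ps) (2 * ?d * v + (l * ?d + j)) = concat (map ?f ss) ! (2 * ?d * v + (l * ?d + j))"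
    unfolding load_def input_reals_def by (simp add: nth_append)
  also have "\<dots> = ?f (ss ! v) ! (l * ?d + j)"
    by (rule nth_concat_blocks[OF len assms(1) lj])
  also have "\<dots> = (if l = 0 then fst (ss ! v) else snd (ss ! v)) $ from_nat_into UNIV j"
    using assms(2,3) by (cases "ss ! v") (auto simp: less_2_cases_iff nth_append coords_nth)
  finally show ?thesis .
qed

lemma input_reals_plane_point:
  fixes ss :: "((real^'n) \<times> (real^'n)) list"
  assumes "i < length ps" "j < CARD('n)" "l < 3"
  shows "load (input_reals ss ps) (2 * CARD('n) * length ss + (3 * CARD('n) * i + (l * CARD('n) + j))) =
    (if l = 0 then fst (ps ! i) else if l = 1 then fst (snd (ps ! i)) else snd (snd (ps ! i))) $ from_nat_into UNIV j"
proof -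
  let ?d = "CARD('n)"
  let ?f = "\<lambda>(p, q, r). coords p @ coords q @ coords r"
  have l: "l = 0 \<or> l = 1 \<or> l = 2" using assms(3) by auto
  have lj: "l * ?d + j < 3 * ?d" using assms(2) l by auto
  have len: "length (?f x) = 3 * ?d" for x :: "(real^'n) \<times> (real^'n) \<times> (real^'n)" by (cases x) simp
  have lens: "length (concat (map (\<lambda>(a, b). coords a @ coords b) ss)) = 2 * ?d * length ss"
    by (rule length_concat_blocks) auto
  have "3 * ?d * i + (l * ?d + j) < 3 * ?d * Suc i" using lj by simp
  also have "\<dots> \<le> 3 * ?d * length ps" using assms(1) by (intro mult_le_mono2) simp
  finally have "load (input_reals ss ps) (2 * ?d * length ss + (3 * ?d * i + (l * ?d + j))) =
      concat (map ?f ps) ! (3 * ?d * i + (l * ?d + j))"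
    unfolding load_def length_input_reals unfolding input_reals_def by (simp add: nth_append lens)
  also have "\<dots> = ?f (ps ! i) ! (l * ?d + j)"
    by (rule nth_concat_blocks[OF len assms(1) lj])
  also have "\<dots> = (if l = 0 then fst (ps ! i) else if l = 1 then fst (snd (ps ! i)) else snd (snd (ps ! i)))
      $ from_nat_into UNIV j"
    using assms(2) l by (cases "ps ! i") (auto simp: nth_append coords_nth)
  finally show ?thesis .
qed

lemma denotes_Endpoint:
  fixes ss :: "((real^'n) \<times> (real^'n)) list"
  assumes "a x 0 < length ss" "l < 2"
  shows "denotes (Endpoint CARD('n) l x) (mem a, load (input_reals ss ps))
    (if l = 0 then fst (ss ! a x 0) else snd (ss ! a x 0))"
  unfolding denotes_def Endpoint_def using input_reals_endpoint[OF assms(1) _ assms(2)] by simp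

lemma denotes_PlanePoint:
  fixes ss :: "((real^'n) \<times> (real^'n)) list"
  assumes "a NSeg 0 = length ss" "a PlI 0 < length ps" "l < 3"
  shows "denotes (PlanePoint CARD('n) l) (mem a, load (input_reals ss ps))
    (if l = 0 then fst (ps ! a PlI 0) else if l = 1 then fst (snd (ps ! a PlI 0)) else snd (snd (ps ! a PlI 0)))"
  unfolding denotes_def PlanePoint_def using input_reals_plane_point[OF assms(2) _ assms(3)] assms(1) by simp

lemma segment_of_conv: "segment_of s = closed_segment (fst s) (snd s)"
  by (simp add: segment_of_def case_prod_beta)

lemma plane_of_conv: "plane_of p = affine hull {fst p, fst (snd p), snd (snd p)}"
  by (simp add: plane_of_def case_prod_beta)

text \<open>Coordinates are inner products with two spanning vectors of the plane. Ring operations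
  compute them, whereas normalising a frame would involve square roots.\<close>

definition plane_order :: "(real^'n) \<times> (real^'n) \<times> (real^'n) \<Rightarrow> nat \<Rightarrow> (real^'n) set \<Rightarrow> (real^'n) set \<Rightarrow> bool" where
  "plane_order p = seg_order ((\<bullet>) (fst (snd p) - fst p)) ((\<bullet>) (snd (snd p) - fst p))"

lemma linear_inner: "linear ((\<bullet>) (x :: 'a::real_inner))"
  by (rule bounded_linear.linear[OF bounded_linear_inner_right])

text \<open>The bound \<open>M\<close> is the number of input reals plus \<open>4\<close>: every
  segment and every plane contributes at least one real, and the loop over the orders takes four
  rounds.\<close>

lemma segment_program_input:
  fixes ss :: "((real^'n) \<times> (real^'n)) list"
  assumes valid: "valid_input ss ps"
  defines "R \<equiv> load (input_reals ss ps)"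
  shows "segment_program R (length ss) (length ps) (length (input_reals ss ps) + 4)
    (InPlane CARD('n)) (Meet CARD('n)) (Related CARD('n))
    (\<lambda>i v. segment_of (ss ! v) \<subseteq> plane_of (ps ! i))
    (\<lambda>u v. segment_of (ss ! u) \<inter> segment_of (ss ! v) \<noteq> {})
    (\<lambda>i q u v. plane_order (ps ! i) q (segment_of (ss ! u)) (segment_of (ss ! v)))"
proof
  let ?d = "CARD('n)"
  have seg: "fst (ss ! v) \<noteq> snd (ss ! v)" if "v < length ss" for v
    using valid nth_mem[OF that] unfolding valid_input_def by (auto simp: case_prod_beta)
  have plane: "is_plane (plane_of (ps ! i))" if "i < length ps" for i
    using valid nth_mem[OF that] unfolding valid_input_def by auto
  have aff: "affine (plane_of p)" for p :: "(real^'n) \<times> (real^'n) \<times> (real^'n)"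
    unfolding plane_of_conv by (rule affine_affine_hull)
  have d: "1 \<le> ?d" by (simp add: Suc_leI)
  have "length ss \<le> 2 * ?d * length ss" "length ps \<le> 3 * ?d * length ps" using d by simp_all
  then show "length ss \<le> length (input_reals ss ps) + 4" "length ps \<le> length (input_reals ss ps) + 4"
    unfolding length_input_reals by linarith+
  show "4 \<le> length (input_reals ss ps) + 4" by simp
  show "bval (InPlane ?d) (mem a, R) = (segment_of (ss ! a VtxV 0) \<subseteq> plane_of (ps ! a PlI 0))"
    if h: "a NSeg 0 = length ss" "a NPl 0 = length ps" "a PlI 0 < length ps" "a VtxV 0 < length ss" for a
  proof -
    let ?s = "ss ! a VtxV 0" and ?p = "ps ! a PlI 0"
    have pts: "denotes (PlanePoint ?d 0) (mem a, R) (fst ?p)" "denotes (PlanePoint ?d 1) (mem a, R) (fst (snd ?p))"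
      "denotes (PlanePoint ?d 2) (mem a, R) (snd (snd ?p))"
      using denotes_PlanePoint[where a = a, OF h(1,3), of 0] denotes_PlanePoint[where a = a, OF h(1,3), of 1]
        denotes_PlanePoint[where a = a, OF h(1,3), of 2] by (simp_all add: R_def)
    have ends: "denotes (Endpoint ?d 0 VtxV) (mem a, R) (fst ?s)" "denotes (Endpoint ?d 1 VtxV) (mem a, R) (snd ?s)"
      using denotes_Endpoint[where a = a and x = VtxV, OF h(4), of 0] denotes_Endpoint[where a = a and x = VtxV, OF h(4), of 1] by (simp_all add: R_def)
    note pl = plane[OF h(3), unfolded plane_of_conv]
    have "segment_of ?s \<subseteq> plane_of ?p \<longleftrightarrow> fst ?s \<in> plane_of ?p \<and> snd ?s \<in> plane_of ?p"
      unfolding segment_of_conv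
      using closed_segment_subset[OF _ _ affine_imp_convex[OF aff]] ends_in_segment by blast
    then show ?thesis
      unfolding InPlane_def plane_of_conv
      by (simp add: bval_OnPlane[OF ends(1) pts pl, unfolded One_nat_def] bval_OnPlane[OF ends(2) pts pl, unfolded One_nat_def])
  qed
  show "bval (Meet ?d) (mem a, R) = (segment_of (ss ! a VtxU 0) \<inter> segment_of (ss ! a VtxV 0) \<noteq> {})"
    if h: "a NSeg 0 = length ss" "a NPl 0 = length ps" "a VtxU 0 < length ss" "a VtxV 0 < length ss" for a
    unfolding Meet_def segment_of_conv R_def
    by (rule bval_SegmentsMeet)
      (use denotes_Endpoint[where a = a and x = VtxU, OF h(3), of 0] denotes_Endpoint[where a = a and x = VtxU, OF h(3), of 1]
        denotes_Endpoint[where a = a and x = VtxV, OF h(4), of 0] denotes_Endpoint[where a = a and x = VtxV, OF h(4), of 1] seg h in simp_all)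
  show "bval (Related ?d) (mem a, R) =
      plane_order (ps ! a PlI 0) (a Ord 0) (segment_of (ss ! a VtxU 0)) (segment_of (ss ! a VtxV 0))"
    if h: "a NSeg 0 = length ss" "a NPl 0 = length ps" "a PlI 0 < length ps" "a Ord 0 < 4"
      "a VtxU 0 < length ss" "a VtxV 0 < length ss" for a
  proof -
    let ?p = "ps ! a PlI 0"
    let ?x = "VDot ?d (VSub (PlanePoint ?d 1) (PlanePoint ?d 0))"
    let ?y = "VDot ?d (VSub (PlanePoint ?d 2) (PlanePoint ?d 0))"
    have dirs: "denotes (VSub (PlanePoint ?d 1) (PlanePoint ?d 0)) (mem a, R) (fst (snd ?p) - fst ?p)"
      "denotes (VSub (PlanePoint ?d 2) (PlanePoint ?d 0)) (mem a, R) (snd (snd ?p) - fst ?p)"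
      using denotes_PlanePoint[where a = a, OF h(1,3), of 0] denotes_PlanePoint[where a = a, OF h(1,3), of 1]
        denotes_PlanePoint[where a = a, OF h(1,3), of 2] by (auto intro!: denotes_VSub simp: R_def)
    have e: "denotes (Endpoint ?d 0 VtxU) (mem a, R) (fst (ss ! a VtxU 0))"
      "denotes (Endpoint ?d 1 VtxU) (mem a, R) (snd (ss ! a VtxU 0))"
      "denotes (Endpoint ?d 0 VtxV) (mem a, R) (fst (ss ! a VtxV 0))"
      "denotes (Endpoint ?d 1 VtxV) (mem a, R) (snd (ss ! a VtxV 0))"
      using denotes_Endpoint[where a = a and x = VtxU, OF h(5), of 0] denotes_Endpoint[where a = a and x = VtxU, OF h(5), of 1]
        denotes_Endpoint[where a = a and x = VtxV, OF h(6), of 0] denotes_Endpoint[where a = a and x = VtxV, OF h(6), of 1] by (simp_all add: R_def)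
    have ord: "bval (SegOrder ?x ?y q [Endpoint ?d 0 VtxU, Endpoint ?d 1 VtxU] [Endpoint ?d 0 VtxV, Endpoint ?d 1 VtxV])
        (mem a, R) = plane_order ?p q (segment_of (ss ! a VtxU 0)) (segment_of (ss ! a VtxV 0))" for q
      unfolding plane_order_def segment_of_conv
      by (rule bval_SegOrder[OF linear_inner linear_inner]) (rule rval_VDot[OF dirs(1)] rval_VDot[OF dirs(2)]; rule e)+
    have "a Ord 0 = 0 \<or> a Ord 0 = 1 \<or> a Ord 0 = 2 \<or> a Ord 0 = 3" using h(4) by linarith
    then show ?thesis by (elim disjE) (simp_all add: Related_def ord[unfolded One_nat_def])
  qed
  show "\<exists>i<length ps. segment_of (ss ! v) \<subseteq> plane_of (ps ! i)" if v: "v < length ss" for v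
  proof -
    have "closed_segment (fst (ss ! v)) (snd (ss ! v)) \<subseteq> \<Union>(plane_of ` set ps)"
      using valid nth_mem[OF v] unfolding valid_input_def segment_of_conv by auto
    then obtain A where "A \<in> plane_of ` set ps" "closed_segment (fst (ss ! v)) (snd (ss ! v)) \<subseteq> A"
      using segment_subset_some_affine[of "plane_of ` set ps", OF _ _ seg[OF v]] aff by blast
    then show ?thesis unfolding segment_of_conv by (metis imageE in_set_conv_nth)
  qed
  show "segment_of (ss ! v) \<inter> segment_of (ss ! u) \<noteq> {}" if "segment_of (ss ! u) \<inter> segment_of (ss ! v) \<noteq> {}" for u v
    using that by blast
  show "segment_of (ss ! u) \<inter> segment_of (ss ! v) \<noteq> {}"
    if "segment_of (ss ! u) \<subseteq> plane_of (ps ! i)" "segment_of (ss ! v) \<subseteq> plane_of (ps ! i)"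
      "\<not> segment_of (ss ! t) \<subseteq> plane_of (ps ! i)"
      "segment_of (ss ! t) \<inter> segment_of (ss ! u) \<noteq> {}" "segment_of (ss ! t) \<inter> segment_of (ss ! v) \<noteq> {}" for i t u v
    using piercing_segments_meet[OF aff, of "fst (ss ! t)" "snd (ss ! t)"] that unfolding segment_of_conv by blast
  show "plane_order (ps ! i) q (segment_of (ss ! u)) (segment_of (ss ! w))"
    if "plane_order (ps ! i) q (segment_of (ss ! u)) (segment_of (ss ! v))"
      "plane_order (ps ! i) q (segment_of (ss ! v)) (segment_of (ss ! w))" for i q u v w
    using that unfolding plane_order_def segment_of_conv
    by (rule seg_order_trans[OF convex_closed_segment linear_inner])
  show disj: "\<not> segment_of (ss ! u) \<inter> segment_of (ss ! v) \<noteq> {}"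
    if "plane_order (ps ! i) q (segment_of (ss ! u)) (segment_of (ss ! v))" for i q u v
    using seg_order_disjoint that unfolding plane_order_def by blast
  show "\<not> plane_order (ps ! i) q (segment_of (ss ! u)) (segment_of (ss ! u))" for i q u
    using disj[of i q u u] unfolding segment_of_conv by auto
  show "\<exists>q<4. plane_order (ps ! i) q (segment_of (ss ! u)) (segment_of (ss ! v)) \<or>
      plane_order (ps ! i) q (segment_of (ss ! v)) (segment_of (ss ! u))"
    if h: "segment_of (ss ! u) \<subseteq> plane_of (ps ! i)" "segment_of (ss ! v) \<subseteq> plane_of (ps ! i)"
      "\<not> segment_of (ss ! u) \<inter> segment_of (ss ! v) \<noteq> {}" for i u v
  proof -
    have "x = y" if "x \<in> segment_of (ss ! u)" "y \<in> segment_of (ss ! v)"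
      "(fst (snd (ps ! i)) - fst (ps ! i)) \<bullet> x = (fst (snd (ps ! i)) - fst (ps ! i)) \<bullet> y"
      "(snd (snd (ps ! i)) - fst (ps ! i)) \<bullet> x = (snd (snd (ps ! i)) - fst (ps ! i)) \<bullet> y" for x y
      using plane_functionals_inj[OF _ _ that(3,4)] that(1,2) h(1,2) unfolding plane_of_conv by blast
    then show ?thesis
      using seg_order_comparable[OF segment_of_conv segment_of_conv linear_inner linear_inner] h(3)
      unfolding plane_order_def by metis
  qed
qed

section \<open>Polynomial running time\<close>

definition is_polynomial :: "(nat \<Rightarrow> nat) \<Rightarrow> bool" where
  "is_polynomial f \<longleftrightarrow> (\<exists>T. \<forall>x. f x = poly T x)"

lemma is_polynomial_intros:
  "is_polynomial (\<lambda>x. c)" "is_polynomial (\<lambda>x. x)"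
  "is_polynomial f \<Longrightarrow> is_polynomial g \<Longrightarrow> is_polynomial (\<lambda>x. f x + g x)"
  "is_polynomial f \<Longrightarrow> is_polynomial g \<Longrightarrow> is_polynomial (\<lambda>x. f x * g x)"
  "is_polynomial f \<Longrightarrow> is_polynomial (\<lambda>x. Suc (f x))"
proof -
  show "is_polynomial (\<lambda>x. c)" unfolding is_polynomial_def by (rule exI[of _ "[:c:]"]) simp
  show "is_polynomial (\<lambda>x. x)" unfolding is_polynomial_def by (rule exI[of _ "[:0, 1:]"]) simp
  show "is_polynomial (\<lambda>x. f x + g x)" if "is_polynomial f" "is_polynomial g"
    using that unfolding is_polynomial_def by (metis poly_add)
  show "is_polynomial (\<lambda>x. f x * g x)" if "is_polynomial f" "is_polynomial g"
    using that unfolding is_polynomial_def by (metis poly_mult)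
  show "is_polynomial (\<lambda>x. Suc (f x))" if f: "is_polynomial f"
  proof -
    obtain T where "\<forall>x. f x = poly T x" using f unfolding is_polynomial_def by blast
    then have "\<forall>x. Suc (f x) = poly (T + 1) x" by simp
    then show ?thesis unfolding is_polynomial_def by blast
  qed
qed

lemma is_polynomial_time: "is_polynomial (\<lambda>x. time_segment_coloring (x + 4))"
  unfolding time_segment_coloring_def time_classify_def time_process_all_def time_process_class_def
    time_find_hits_def time_heights_def time_try_label_def time_scan_def time_label_def
    time_extract_chain_def time_choose_colors_def time_copy_chosen_def
  by (intro is_polynomial_intros)

section \<open>From indices to the disjointness graph\<close>

lemma disjointness_edges_iff:
  "v \<in> S \<Longrightarrow> w \<in> S \<Longrightarrow> {v, w} \<in> disjointness_edges S \<longleftrightarrow> v \<noteq> w \<and> v \<inter> w = {}"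
  unfolding disjointness_edges_def by (auto simp: doubleton_eq_iff)

lemma segment_coloring_correct:
  fixes ss :: "((real^'n) \<times> (real^'n)) list"
  assumes valid: "valid_input ss ps"
  defines "S \<equiv> set (map segment_of ss)"
  obtains t m f where
    "runs (segment_coloring (InPlane CARD('n)) (Meet CARD('n)) (Related CARD('n))) (input_memory ss ps) t m"
    "t \<le> time_segment_coloring (length (input_reals ss ps) + 4)"
    "output_coloring ss m f" "output_vertices ss m \<subseteq> S" "clique (output_vertices ss m) (disjointness_edges S)"
    "proper_coloring S (disjointness_edges S) f"
    "card (f ` S) \<le> (length ps - 1) * card (output_vertices ss m) + card (output_vertices ss m) ^ 4"
proof -
  let ?n = "length ss" and ?k = "length ps" and ?seg = "\<lambda>v. segment_of (ss ! v)"
  obtain t \<mu> Z where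
    run: "runs (segment_coloring (InPlane CARD('n)) (Meet CARD('n)) (Related CARD('n)))
      (load [?n, ?k], load (input_reals ss ps)) t (\<mu>, load (input_reals ss ps))"
    and t: "t \<le> time_segment_coloring (length (input_reals ss ps) + 4)"
    and Z: "Z \<subseteq> {..<?n}" "\<forall>v<?n. \<mu> (?n + v) \<noteq> 0 \<longleftrightarrow> v \<in> Z"
    and clq: "\<forall>u\<in>Z. \<forall>v\<in>Z. u \<noteq> v \<longrightarrow> \<not> ?seg u \<inter> ?seg v \<noteq> {}"
    and col: "\<forall>u<?n. \<forall>v<?n. u \<noteq> v \<longrightarrow> \<not> ?seg u \<inter> ?seg v \<noteq> {} \<longrightarrow> \<mu> u \<noteq> \<mu> v"
    and card: "card (\<mu> ` {..<?n}) \<le> (?k - 1) * card Z + card Z ^ 4"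
    using segment_program.segment_coloring_runs[OF segment_program_input[OF valid]] by blast
  let ?m = "(\<mu>, load (input_reals ss ps))"
  \<comment> \<open>Distinctness of the input makes indices and segments correspond, so colors and
    selected indices carry over to the graph with the same cardinalities.\<close>
  have inj: "inj_on ?seg {..<?n}"
  proof (rule inj_onI)
    have "distinct (map segment_of ss)" using valid by (simp add: valid_input_def)
    then show "x = y" if "x \<in> {..<?n}" "y \<in> {..<?n}" "?seg x = ?seg y" for x y
      using nth_eq_iff_index_eq[of "map segment_of ss" x y] that by simp
  qed
  have S: "S = ?seg ` {..<?n}"
    unfolding S_def set_conv_nth[of "map segment_of ss"] by (force simp: image_iff)
  have K: "output_vertices ss ?m = ?seg ` Z"
    using Z unfolding output_vertices_def by auto
  define f where "f = (\<lambda>s. \<mu> (the_inv_into {..<?n} ?seg s))"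
  have f: "f (?seg v) = \<mu> v" if "v < ?n" for v
    unfolding f_def using the_inv_into_f_f[OF inj] that by simp
  have KS: "?seg ` Z \<subseteq> S" unfolding S using Z(1) by blast
  show ?thesis
  proof (rule that[of t ?m f])
    show "runs (segment_coloring (InPlane CARD('n)) (Meet CARD('n)) (Related CARD('n))) (input_memory ss ps) t ?m"
      using run unfolding input_memory_def .
    show "output_coloring ss ?m f" unfolding output_coloring_def using f by simp
    show "output_vertices ss ?m \<subseteq> S" unfolding K by (rule KS)
    have "{?seg u, ?seg v} \<in> disjointness_edges S" if "u \<in> Z" "v \<in> Z" "?seg u \<noteq> ?seg v" for u v
    proof -
      have "u \<noteq> v" using that(3) by auto
      then have "?seg u \<inter> ?seg v = {}" using clq that(1,2) by simp
      moreover have "?seg u \<in> S" "?seg v \<in> S" using KS that(1,2) by auto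
      ultimately show ?thesis using that(3) by (simp add: disjointness_edges_iff)
    qed
    then show "clique (output_vertices ss ?m) (disjointness_edges S)" unfolding K clique_def by blast
    show "proper_coloring S (disjointness_edges S) f" unfolding proper_coloring_def
    proof (intro ballI impI)
      fix v w assume vw: "v \<in> S" "w \<in> S" "{v, w} \<in> disjointness_edges S"
      then obtain x y where xy: "x < ?n" "y < ?n" "v = ?seg x" "w = ?seg y" unfolding S by auto
      have "v \<noteq> w" "v \<inter> w = {}" using vw by (simp_all add: disjointness_edges_iff)
      then have "\<mu> x \<noteq> \<mu> y" using col xy by auto
      then show "f v \<noteq> f w" using xy f by simp
    qed
    have "f ` S = \<mu> ` {..<?n}" unfolding S image_image using f by (intro image_cong) auto
    moreover have "card (?seg ` Z) = card Z" by (rule card_image[OF inj_on_subset[OF inj Z(1)]])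
    ultimately show "card (f ` S) \<le> (?k - 1) * card (output_vertices ss ?m) + card (output_vertices ss ?m) ^ 4"
      using card unfolding K by simp
  qed (rule t)
qed

text \<open>The used colors are renumbered consecutively, as the chromatic number is defined by
  colorings into an initial segment of the naturals.\<close>

lemma chromatic_number_le_card:
  assumes "finite V" "proper_coloring V E f"
  shows "chromatic_number V E \<le> card (f ` V)"
proof -
  obtain h where h: "bij_betw h (f ` V) {0..<card (f ` V)}"
    using ex_bij_betw_finite_nat[of "f ` V"] assms(1) by blast
  then have "proper_coloring V E (h \<circ> f)"
    using assms(2) unfolding proper_coloring_def by (auto simp: bij_betw_def inj_on_def)
  moreover have "(h \<circ> f) ` V \<subseteq> {..<card (f ` V)}"
    using h by (simp add: bij_betw_def image_image atLeast0LessThan)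
  ultimately show ?thesis unfolding chromatic_number_def by (intro Least_le) blast
qed

lemma card_le_clique_number: "finite V \<Longrightarrow> K \<subseteq> V \<Longrightarrow> clique K E \<Longrightarrow> card K \<le> clique_number V E"
  unfolding clique_number_def by (intro Max_ge) auto

text \<open>An affine basis of a set of dimension two has three points.\<close>

lemma plane_obtains_points:
  fixes A :: "(real^'n) set"
  assumes "is_plane A"
  obtains p where "plane_of p = A"
proof -
  obtain B where B: "\<not> affine_dependent B" "affine hull B = affine hull A"
    using affine_basis_exists[of A] by metis
  have A: "affine hull A = A" using assms by (simp add: is_plane_def)
  have "aff_dim B = 2" using B(2) assms A aff_dim_affine_hull by (metis is_plane_def)
  then have "card B = 3" using aff_dim_affine_independent[OF B(1)] by simp
  then obtain p q r where "B = {p, q, r}" by (auto simp: card_3_iff)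
  then show ?thesis using that[of "(p, q, r)"] B(2) A by (simp add: plane_of_def)
qed

text \<open>Every such family of segments and planes is described by some input; this transfers the
  guarantee of the program to the bound on the chromatic number.\<close>

lemma valid_input_exists:
  fixes S P :: "(real^'n) set set"
  assumes "finite S" "\<forall>s\<in>S. is_segment s" "finite P" "P \<noteq> {}" "\<forall>A\<in>P. is_plane A" "\<forall>s\<in>S. s \<subseteq> \<Union>P"
  obtains ss ps where "valid_input ss ps" "set (map segment_of ss) = S" "length ps = card P"
proof -
  obtain xs where xs: "set xs = S" "distinct xs" using finite_distinct_list[OF assms(1)] by blast
  obtain ys where ys: "set ys = P" "distinct ys" using finite_distinct_list[OF assms(3)] by blast
  have "\<forall>s\<in>S. \<exists>e. fst e \<noteq> snd e \<and> segment_of e = s"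
    using assms(2) unfolding is_segment_def segment_of_conv by (metis fst_conv snd_conv)
  then obtain g where g: "\<And>s. s \<in> S \<Longrightarrow> fst (g s) \<noteq> snd (g s) \<and> segment_of (g s) = s" by metis
  have "\<forall>A\<in>P. \<exists>p. plane_of p = A" using assms(5) plane_obtains_points by metis
  then obtain h where h: "\<And>A. A \<in> P \<Longrightarrow> plane_of (h A) = A" by metis
  have sx: "map segment_of (map g xs) = xs" unfolding map_map by (rule map_idI) (use g xs(1) in auto)
  have py: "map plane_of (map h ys) = ys" unfolding map_map by (rule map_idI) (use h ys(1) in auto)
  have "1 \<le> length ys" using ys(1) assms(4) by (cases ys) auto
  then have "valid_input (map g xs) (map h ys)"
    unfolding valid_input_def sx py using xs ys g h assms(5,6) by (auto simp: case_prod_beta)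
  moreover have "set (map segment_of (map g xs)) = S" unfolding sx by (rule xs(1))
  moreover have "length (map h ys) = card P" using ys distinct_card by fastforce
  ultimately show ?thesis using that by blast
qed

theorem theorem3p1:
  assumes "CARD('n::finite) > 2"
  shows
    "(\<forall>(S :: (real^'n) set set) (P :: (real^'n) set set) k.
        finite S \<and> (\<forall>s\<in>S. is_segment s) \<and>
        finite P \<and> card P = k \<and> k \<ge> 1 \<and> (\<forall>A\<in>P. is_plane A) \<and>
        (\<forall>s\<in>S. s \<subseteq> \<Union>P) \<longrightarrow>
        chromatic_number S (disjointness_edges S)
          \<le> (k - 1) * clique_number S (disjointness_edges S)
            + clique_number S (disjointness_edges S) ^ 4)
     \<and>
     (\<exists>(algorithm :: com) (T :: nat poly).
        \<forall>(ss :: ((real^'n) \<times> (real^'n)) list) (ps :: ((real^'n) \<times> (real^'n) \<times> (real^'n)) list).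
          valid_input ss ps \<longrightarrow>
          (let S = set (map segment_of ss); E = disjointness_edges S; k = length ps in
           \<exists>t m. runs algorithm (input_memory ss ps) t m \<and>
             t \<le> poly T (length (input_reals ss ps)) \<and>
             (\<exists>K f. K = output_vertices ss m \<and> output_coloring ss m f \<and>
               K \<subseteq> S \<and> clique K E \<and>
               proper_coloring S E f \<and>
               card (f ` S) \<le> (k - 1) * card K + card K ^ 4)))"
proof (intro conjI allI impI)
  fix S P :: "(real^'n) set set" and k
  assume h: "finite S \<and> (\<forall>s\<in>S. is_segment s) \<and>
        finite P \<and> card P = k \<and> k \<ge> 1 \<and> (\<forall>A\<in>P. is_plane A) \<and> (\<forall>s\<in>S. s \<subseteq> \<Union>P)"
  then have "P \<noteq> {}" by auto
  with h obtain ss ps where valid: "valid_input ss ps" and S: "set (map segment_of ss) = S"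
    and k: "length ps = card P" using valid_input_exists[of S P] by metis
  let ?E = "disjointness_edges S" and ?\<omega> = "clique_number S (disjointness_edges S)"
  obtain K f where K: "K \<subseteq> S" "clique K ?E" and f: "proper_coloring S ?E f"
    and c: "card (f ` S) \<le> (k - 1) * card K + card K ^ 4"
    using segment_coloring_correct[OF valid, unfolded S] k h by metis
  \<comment> \<open>The bound is monotone in the size of the clique, so the clique that is found may
    be replaced by a largest one.\<close>
  have "card K \<le> ?\<omega>" using card_le_clique_number K h by blast
  then have "(k - 1) * card K + card K ^ 4 \<le> (k - 1) * ?\<omega> + ?\<omega> ^ 4"
    by (intro add_mono mult_le_mono2 power_mono) simp_all
  with c chromatic_number_le_card[OF _ f] h
  show "chromatic_number S ?E \<le> (k - 1) * ?\<omega> + ?\<omega> ^ 4" by linarith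
next
  obtain T where T: "\<And>x. time_segment_coloring (x + 4) = poly T x"
    using is_polynomial_time unfolding is_polynomial_def by blast
  \<comment> \<open>The program is built from the dimension alone and \<open>T\<close> is fixed
    before the input, as uniformity requires.\<close>
  show "\<exists>(algorithm :: com) (T :: nat poly).
        \<forall>(ss :: ((real^'n) \<times> (real^'n)) list) (ps :: ((real^'n) \<times> (real^'n) \<times> (real^'n)) list).
          valid_input ss ps \<longrightarrow>
          (let S = set (map segment_of ss); E = disjointness_edges S; k = length ps in
           \<exists>t m. runs algorithm (input_memory ss ps) t m \<and>
             t \<le> poly T (length (input_reals ss ps)) \<and>
             (\<exists>K f. K = output_vertices ss m \<and> output_coloring ss m f \<and>
               K \<subseteq> S \<and> clique K E \<and>
               proper_coloring S E f \<and>
               card (f ` S) \<le> (k - 1) * card K + card K ^ 4))"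
    unfolding Let_def
    by (intro exI[of _ "segment_coloring (InPlane CARD('n)) (Meet CARD('n)) (Related CARD('n))"] exI[of _ T]
        allI impI, erule segment_coloring_correct) (use T in metis)
qed

end
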